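(* Let $G$ be a locally compact abelian group, $\mathcal A$ a van Hove net in $G$, and $\omega$ a translation bounded measure on $G$ whose autocorrelation $\gamma$ exists with respect to $\mathcal A$. Then the following are equivalent: (i) The refined Eberlein decomposition of $\omega$ exists with respect to $\mathcal A$. (ii) There exist translation bounded measures $\omega_1,\omega_2,\omega_3$ on $G$ such that $\omega=\omega_1+\omega_2+\omega_3$, the autocorrelations $\gamma_1,\gamma_2,\gamma_3$ of $\omega_1,\omega_2,\omega_3$ exist with respect to $\mathcal A$, and $\widehat{\gamma_1},\widehat{\gamma_2},\widehat{\gamma_3}$ are pure point, absolutely continuous and singular continuous, respectively.
   Context: $G$ is written additively with neutral element $0$; a Haar measure is fixed, $|A|$ is the Haar measure of $A$. $\widehat G$ is the group of continuous homomorphisms $\xi:G\to\mathbb T$ ($\mathbb T$ = unit circle), with its usual locally compact topology. $C_c(G)$ is the space of compactly supported continuous complex functions. A measure on $G$ is a linear functional $\mu:C_c(G)\to\mathbb C$ such that for each compact $K\subseteq G$ there is $C_K\ge0$ with $|\mu(\varphi)|\le C_K\|\varphi\|_\infty$ for all $\varphi\in C_c(G)$ supported in $K$; $|\mu|$ is its total variation, $\mu|_A$ its restriction to a Borel set $A$. $\mu$ is translation bounded if $\sup_{t\in G}|\mu|(t+V)<\infty$ for one (equivalently every) nonempty open $V$ with compact closure; $\mathcal M^\infty(G)$ is the set of translation bounded measures. $\tilde\varphi(x)=\overline{\varphi(-x)}$, $\tilde\mu(\varphi)=\overline{\mu(\tilde\varphi)}$. For finite measures, $(\mu*\nu)(\varphi)=\int\int\varphi(s+t)\,d\mu(s)\,d\nu(t)$.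 For $\varphi\in C_c(G)$, $(\mu*\varphi)(t)=\int_G\varphi(t-s)\,d\mu(s)$. For compact $K$, $\partial^KA:=(\overline{A+K}\setminus A)\cup(((G\setminus A)-K)\cap\overline A)$. A van Hove net is a net $\mathcal A=(A_i)_{i\in I}$ of open subsets of $G$ with compact closure (with $|A_i|>0$) such that $\lim_i|\partial^KA_i|/|A_i|=0$ for every compact $K\subseteq G$. The autocorrelation of $\mu\in\mathcal M^\infty(G)$ with respect to $\mathcal A$ is the vague limit (pointwise on $C_c(G)$) of $\frac1{|A_i|}\,\mu|_{A_i}*\widetilde{\mu|_{A_i}}$, if it exists. It is positive definite; for positive definite $\gamma$, $\widehat\gamma$ is the unique positive measure on $\widehat G$ with $\gamma*\varphi*\tilde\varphi(0)=\int_{\widehat G}|\widehat\varphi|^2\,d\widehat\gamma$ for all $\varphi\in C_c(G)$, where $\widehat\varphi(\xi)=\int_G\overline{\xi(t)}\varphi(t)\,dt$. For a positive measure $\rho$ on $\widehat G$, $\rho=\rho_{pp}+\rho_{ac}+\rho_{sc}$ is its Lebesgue decomposition into pure point, absolutely continuous and singular continuous parts (with respect to Haar measure on $\widehat G$). A refined Eberlein decomposition of $\omega$ with respect to $\mathcal A$ consists of $\omega_{dpp},\omega_{dac},\omega_{dsc}\in\mathcal M^\infty(G)$ such that (a) $\omega=\omega_{dpp}+\omega_{dac}+\omega_{dsc}$, and (b) the autocorrelations $\eta_{dpp},\eta_{dac},\eta_{dsc}$ of $\omega_{dpp},\omega_{dac},\omega_{dsc}$ exist with respect to $\mathcal A$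 and satisfy $\widehat{\eta_{dpp}}=(\widehat\gamma)_{pp}$, $\widehat{\eta_{dac}}=(\widehat\gamma)_{ac}$, $\widehat{\eta_{dsc}}=(\widehat\gamma)_{sc}$, where $\gamma$ is the autocorrelation of $\omega$. *)

theory Defs
  imports "HOL-Analysis.Analysis"
begin

class lca_group = topological_ab_group_add + t2_space +
  assumes locally_compact: "\<exists>U K. open U \<and> x \<in> U \<and> U \<subseteq> K \<and> compact K"


section \<open>The dual group\<close>

typedef (overloaded) 'a dual =
  "{\<xi> :: 'a :: topological_ab_group_add \<Rightarrow> complex. continuous_on UNIV \<xi> \<and>
      (\<forall>x. cmod (\<xi> x) = 1) \<and> (\<forall>x y. \<xi> (x + y) = \<xi> x * \<xi> y)}"
  morphisms char_of Abs_dual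
  by (rule exI[of _ "\<lambda>_. 1"]) simp

setup_lifting type_definition_dual

text \<open>The group operation is pointwise multiplication, written additively.\<close>

instantiation dual :: (topological_ab_group_add) ab_group_add
begin

lift_definition zero_dual :: "'a dual" is "\<lambda>_. 1"
  by simp

lift_definition plus_dual :: "'a dual \<Rightarrow> 'a dual \<Rightarrow> 'a dual" is "\<lambda>\<xi> \<zeta> x. \<xi> x * \<zeta> x"
  by (auto simp: norm_mult mult_ac intro!: continuous_intros)

lift_definition uminus_dual :: "'a dual \<Rightarrow> 'a dual" is "\<lambda>\<xi> x. cnj (\<xi> x)"
  by (auto intro!: continuous_intros)

lift_definition minus_dual :: "'a dual \<Rightarrow> 'a dual \<Rightarrow> 'a dual" is "\<lambda>\<xi> \<zeta> x. \<xi> x * cnj (\<zeta> x)"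
  by (auto simp: norm_mult mult_ac intro!: continuous_intros)

instance
proof
  fix a b c :: "'a dual"
  show "a + b + c = a + (b + c)" by transfer (simp add: mult.assoc)
  show "a + b = b + a" by transfer (simp add: mult.commute)
  show "0 + a = a" by transfer simp
  show "- a + a = 0"
  proof transfer
    fix \<xi> :: "'a \<Rightarrow> complex"
    assume "continuous_on UNIV \<xi> \<and> (\<forall>x. cmod (\<xi> x) = 1) \<and> (\<forall>x y. \<xi> (x + y) = \<xi> x * \<xi> y)"
    then have "cnj (\<xi> x) * \<xi> x = 1" for x
      using complex_norm_square[of "\<xi> x"] by (simp add: mult.commute[of "cnj (\<xi> x)"])
    then show "(\<lambda>x. cnj (\<xi> x) * \<xi> x) = (\<lambda>_. 1)" by auto
  qed
  show "a - b = a + - b" by transfer simp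
qed

end

text \<open>The topology of uniform convergence on compact sets, i.e. the compact-open topology.\<close>

instantiation dual :: (topological_ab_group_add) topological_space
begin

definition open_dual :: "'a dual set \<Rightarrow> bool" where
  "open_dual U \<longleftrightarrow> (\<forall>\<xi>\<in>U. \<exists>K e. compact K \<and> e > 0 \<and>
     {\<zeta>. \<forall>x\<in>K. cmod (char_of \<zeta> x - char_of \<xi> x) < e} \<subseteq> U)"

instance
proof
  show "open (UNIV :: 'a dual set)"
    unfolding open_dual_def using compact_empty zero_less_one by (metis subset_UNIV)
next
  fix S T :: "'a dual set" assume S: "open S" and T: "open T"
  show "open (S \<inter> T)" unfolding open_dual_def
  proof
    fix \<xi> assume \<xi>: "\<xi> \<in> S \<inter> T"
    obtain K e where 1: "compact K" "e > 0" "{\<zeta>. \<forall>x\<in>K. cmod (char_of \<zeta> x - char_of \<xi> x) < e} \<subseteq> S"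
      using S \<xi> unfolding open_dual_def by (meson IntD1)
    obtain L d where 2: "compact L" "d > 0" "{\<zeta>. \<forall>x\<in>L. cmod (char_of \<zeta> x - char_of \<xi> x) < d} \<subseteq> T"
      using T \<xi> unfolding open_dual_def by (meson IntD2)
    have "{\<zeta>. \<forall>x\<in>K \<union> L. cmod (char_of \<zeta> x - char_of \<xi> x) < min e d} \<subseteq> S \<inter> T"
      using 1(3) 2(3) by auto
    with 1 2 show "\<exists>K e. compact K \<and> e > 0 \<and>
        {\<zeta>. \<forall>x\<in>K. cmod (char_of \<zeta> x - char_of \<xi> x) < e} \<subseteq> S \<inter> T"
      by (intro exI[of _ "K \<union> L"] exI[of _ "min e d"]) (simp add: compact_Un)
  qed
next
  fix \<K> :: "'a dual set set" assume K: "\<forall>S\<in>\<K>. open S"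
  show "open (\<Union>\<K>)" unfolding open_dual_def
  proof
    fix \<xi> assume "\<xi> \<in> \<Union>\<K>"
    then obtain S where S: "S \<in> \<K>" "\<xi> \<in> S" by (rule UnionE)
    then obtain K e where "compact K" "e > 0" "{\<zeta>. \<forall>x\<in>K. cmod (char_of \<zeta> x - char_of \<xi> x) < e} \<subseteq> S"
      using K unfolding open_dual_def by meson
    with S show "\<exists>K e. compact K \<and> e > 0 \<and>
        {\<zeta>. \<forall>x\<in>K. cmod (char_of \<zeta> x - char_of \<xi> x) < e} \<subseteq> \<Union>\<K>"
      by (intro exI[of _ K] exI[of _ e] conjI) (assumption, assumption, rule order_trans[OF _ Union_upper])
  qed
qed

end


section \<open>Positive Radon measures\<close>

text \<open>Positive measures are Radon measures on the Borel sets, which by the Riesz representation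
  theorem are the same as positive functionals on \<open>C\<^sub>c\<close>. The group need not be \<open>\<sigma>\<close>-compact:
  a Radon measure is outer regular on Borel sets, but inner regular only on open sets and on
  sets of finite measure. This is why some notions below are tested on compact sets.\<close>

definition radon_measure :: "'a :: topological_space measure \<Rightarrow> bool" where
  "radon_measure M \<longleftrightarrow>
     sets M = sets borel \<and>
     (\<forall>K. compact K \<longrightarrow> emeasure M K < \<infinity>) \<and>
     (\<forall>B\<in>sets borel. emeasure M B = (INF U\<in>{U. open U \<and> B \<subseteq> U}. emeasure M U)) \<and>
     (\<forall>U. open U \<longrightarrow> emeasure M U = (SUP K\<in>{K. compact K \<and> K \<subseteq> U}. emeasure M K))"

definition haar_measure :: "'a :: {topological_space, ab_group_add} measure \<Rightarrow> bool" where
  "haar_measure M \<longleftrightarrow>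
     radon_measure M \<and> emeasure M UNIV \<noteq> 0 \<and>
     (\<forall>t. \<forall>B\<in>sets borel. emeasure M ((+) t ` B) = emeasure M B)"

definition continuous_measure :: "'a :: topological_space measure \<Rightarrow> bool" where
  "continuous_measure \<rho> \<longleftrightarrow> (\<forall>x. emeasure \<rho> {x} = 0)"

definition pure_point :: "'a :: topological_space measure \<Rightarrow> bool" where
  "pure_point \<rho> \<longleftrightarrow>
     (\<forall>K. compact K \<longrightarrow> (\<exists>C. countable C \<and> C \<subseteq> K \<and> emeasure \<rho> (K - C) = 0))"

definition singular_measure :: "'a :: topological_space measure \<Rightarrow> 'a measure \<Rightarrow> bool" where
  "singular_measure h \<rho> \<longleftrightarrow>
     (\<forall>K. compact K \<longrightarrow> (\<exists>S\<in>sets borel. emeasure h (S \<inter> K) = 0 \<and> emeasure \<rho> (K - S) = 0))"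

definition singular_continuous :: "'a :: topological_space measure \<Rightarrow> 'a measure \<Rightarrow> bool" where
  "singular_continuous h \<rho> \<longleftrightarrow> continuous_measure \<rho> \<and> singular_measure h \<rho>"

text \<open>All atoms belong to the pure point part. For a nondiscrete group the continuity of
  \<open>\<rho>\<^sub>a\<^sub>c\<close> follows from absolute continuity; for a discrete group Haar measure itself has atoms,
  and continuity is what makes the decomposition unique.\<close>

definition lebesgue_decomposition ::
  "'a :: topological_space measure \<Rightarrow> 'a measure \<Rightarrow> 'a measure \<Rightarrow> 'a measure \<Rightarrow> 'a measure \<Rightarrow> bool" where
  "lebesgue_decomposition h \<rho> \<rho>pp \<rho>ac \<rho>sc \<longleftrightarrow>
     radon_measure \<rho>pp \<and> radon_measure \<rho>ac \<and> radon_measure \<rho>sc \<and>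
     (\<forall>B\<in>sets borel. emeasure \<rho> B = emeasure \<rho>pp B + emeasure \<rho>ac B + emeasure \<rho>sc B) \<and>
     pure_point \<rho>pp \<and>
     absolutely_continuous h \<rho>ac \<and> continuous_measure \<rho>ac \<and>
     singular_continuous h \<rho>sc"


section \<open>Complex measures as functionals on \<open>C\<^sub>c\<close>\<close>

definition Cc :: "('a :: topological_space \<Rightarrow> complex) set" where
  "Cc = {\<phi>. continuous_on UNIV \<phi> \<and> compact (closure {x. \<phi> x \<noteq> 0})}"

text \<open>Only the values on \<^term>\<open>Cc\<close> matter.\<close>

definition complex_measure :: "(('a :: topological_space \<Rightarrow> complex) \<Rightarrow> complex) \<Rightarrow> bool" where
  "complex_measure \<mu> \<longleftrightarrow>
     (\<forall>\<phi>\<in>Cc. \<forall>\<psi>\<in>Cc. \<mu> (\<lambda>x. \<phi> x + \<psi> x) = \<mu> \<phi> + \<mu> \<psi>) \<and>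
     (\<forall>c. \<forall>\<phi>\<in>Cc. \<mu> (\<lambda>x. c * \<phi> x) = c * \<mu> \<phi>) \<and>
     (\<forall>K. compact K \<longrightarrow>
        (\<exists>C\<ge>0. \<forall>\<phi>\<in>Cc. closure {x. \<phi> x \<noteq> 0} \<subseteq> K \<longrightarrow> cmod (\<mu> \<phi>) \<le> C * (SUP x. cmod (\<phi> x))))"

text \<open>Bourbaki's upper integral with respect to the total variation \<open>|\<mu>|\<close>. For lower
  semicontinuous \<open>g \<ge> 0\<close>, \<open>\<integral> g d|\<mu>|\<close> is the supremum of \<open>|\<mu>(\<phi>)|\<close> over
  \<open>\<phi> \<in> C\<^sub>c\<close> with \<open>|\<phi>| \<le> g\<close>; for general \<open>f \<ge> 0\<close> take the infimum over such \<open>g \<ge> f\<close>.\<close>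

definition upper_variation_integral ::
  "(('a :: topological_space \<Rightarrow> complex) \<Rightarrow> complex) \<Rightarrow> ('a \<Rightarrow> ennreal) \<Rightarrow> ennreal" where
  "upper_variation_integral \<mu> f =
     (INF g\<in>{g. (\<forall>c. open {x. c < g x}) \<and> (\<forall>x. f x \<le> g x)}.
        SUP \<phi>\<in>{\<phi>\<in>Cc. \<forall>x. ennreal (cmod (\<phi> x)) \<le> g x}. ennreal (cmod (\<mu> \<phi>)))"

definition total_variation ::
  "(('a :: topological_space \<Rightarrow> complex) \<Rightarrow> complex) \<Rightarrow> 'a set \<Rightarrow> ennreal" where
  "total_variation \<mu> B = upper_variation_integral \<mu> (indicator B)"

text \<open>The extension of \<open>\<mu>\<close> from \<open>C\<^sub>c\<close> to \<open>L\<^sup>1(|\<mu>|)\<close> by density; the value is unspecified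
  if \<open>f\<close> is not integrable.\<close>

definition cm_integral ::
  "(('a :: topological_space \<Rightarrow> complex) \<Rightarrow> complex) \<Rightarrow> ('a \<Rightarrow> complex) \<Rightarrow> complex" where
  "cm_integral \<mu> f = (THE c. \<forall>e>0. \<exists>\<psi>\<in>Cc.
     upper_variation_integral \<mu> (\<lambda>x. ennreal (cmod (f x - \<psi> x))) < ennreal e \<and> cmod (c - \<mu> \<psi>) < e)"

definition restrict_cm ::
  "(('a :: topological_space \<Rightarrow> complex) \<Rightarrow> complex) \<Rightarrow> 'a set \<Rightarrow> ('a \<Rightarrow> complex) \<Rightarrow> complex" where
  "restrict_cm \<mu> A \<phi> = cm_integral \<mu> (\<lambda>x. indicator A x * \<phi> x)"

definition translation_bounded ::
  "(('a :: {topological_space, ab_group_add} \<Rightarrow> complex) \<Rightarrow> complex) \<Rightarrow> bool" where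
  "translation_bounded \<mu> \<longleftrightarrow>
     complex_measure \<mu> \<and>
     (\<exists>V. open V \<and> V \<noteq> {} \<and> compact (closure V) \<and> (SUP t. total_variation \<mu> ((+) t ` V)) < \<infinity>)"

definition tilde_fun :: "('a :: ab_group_add \<Rightarrow> complex) \<Rightarrow> 'a \<Rightarrow> complex" where
  "tilde_fun \<phi> x = cnj (\<phi> (- x))"

definition tilde_cm ::
  "(('a :: ab_group_add \<Rightarrow> complex) \<Rightarrow> complex) \<Rightarrow> ('a \<Rightarrow> complex) \<Rightarrow> complex" where
  "tilde_cm \<mu> \<phi> = cnj (\<mu> (tilde_fun \<phi>))"

definition conv_cm ::
  "(('a :: {topological_space, ab_group_add} \<Rightarrow> complex) \<Rightarrow> complex) \<Rightarrow>
   (('a \<Rightarrow> complex) \<Rightarrow> complex) \<Rightarrow> ('a \<Rightarrow> complex) \<Rightarrow> complex" where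
  "conv_cm \<mu> \<nu> \<phi> = cm_integral \<nu> (\<lambda>t. cm_integral \<mu> (\<lambda>s. \<phi> (s + t)))"

definition conv_cm_fun ::
  "(('a :: ab_group_add \<Rightarrow> complex) \<Rightarrow> complex) \<Rightarrow> ('a \<Rightarrow> complex) \<Rightarrow> 'a \<Rightarrow> complex" where
  "conv_cm_fun \<mu> \<phi> t = \<mu> (\<lambda>s. \<phi> (t - s))"

definition conv_fun ::
  "'a :: ab_group_add measure \<Rightarrow> ('a \<Rightarrow> complex) \<Rightarrow> ('a \<Rightarrow> complex) \<Rightarrow> 'a \<Rightarrow> complex" where
  "conv_fun h \<phi> \<psi> t = (\<integral>s. \<phi> (t - s) * \<psi> s \<partial>h)"


section \<open>Fourier transforms\<close>

definition fourier_fun ::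
  "'a :: topological_ab_group_add measure \<Rightarrow> ('a \<Rightarrow> complex) \<Rightarrow> 'a dual \<Rightarrow> complex" where
  "fourier_fun h \<phi> \<xi> = (\<integral>t. cnj (char_of \<xi> t) * \<phi> t \<partial>h)"

text \<open>\<open>\<rho>\<close> is the Fourier transform of \<open>\<gamma>\<close>. It is unique, and it exists iff
  \<open>\<gamma>\<close> is positive definite.\<close>

definition has_fourier_transform ::
  "'a :: topological_ab_group_add measure \<Rightarrow> (('a \<Rightarrow> complex) \<Rightarrow> complex) \<Rightarrow> 'a dual measure \<Rightarrow> bool" where
  "has_fourier_transform h \<gamma> \<rho> \<longleftrightarrow>
     radon_measure \<rho> \<and>
     (\<forall>\<phi>\<in>Cc. integrable \<rho> (\<lambda>\<xi>. (cmod (fourier_fun h \<phi> \<xi>))\<^sup>2) \<and>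
        conv_cm_fun \<gamma> (conv_fun h \<phi> (tilde_fun \<phi>)) 0 =
          complex_of_real (\<integral>\<xi>. (cmod (fourier_fun h \<phi> \<xi>))\<^sup>2 \<partial>\<rho>))"


section \<open>Van Hove nets and autocorrelations\<close>

definition directed_set :: "'i set \<Rightarrow> ('i \<Rightarrow> 'i \<Rightarrow> bool) \<Rightarrow> bool" where
  "directed_set I le \<longleftrightarrow>
     I \<noteq> {} \<and> (\<forall>i\<in>I. le i i) \<and>
     (\<forall>i\<in>I. \<forall>j\<in>I. \<forall>k\<in>I. le i j \<longrightarrow> le j k \<longrightarrow> le i k) \<and>
     (\<forall>i\<in>I. \<forall>j\<in>I. \<exists>k\<in>I. le i k \<and> le j k)"

definition net_filter :: "'i set \<Rightarrow> ('i \<Rightarrow> 'i \<Rightarrow> bool) \<Rightarrow> 'i filter" where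
  "net_filter I le = (INF i\<in>I. principal {j\<in>I. le i j})"

definition vH_boundary :: "'a :: {topological_space, ab_group_add} set \<Rightarrow> 'a set \<Rightarrow> 'a set" where
  "vH_boundary K A =
     (closure {a + k | a k. a \<in> A \<and> k \<in> K} - A) \<union> ({b - k | b k. b \<in> - A \<and> k \<in> K} \<inter> closure A)"

definition van_hove_net ::
  "'a :: {topological_space, ab_group_add} measure \<Rightarrow> 'i set \<Rightarrow> ('i \<Rightarrow> 'i \<Rightarrow> bool) \<Rightarrow> ('i \<Rightarrow> 'a set) \<Rightarrow> bool" where
  "van_hove_net h I le A \<longleftrightarrow>
     directed_set I le \<and>
     (\<forall>i\<in>I. open (A i) \<and> compact (closure (A i)) \<and> measure h (A i) > 0) \<and>
     (\<forall>K. compact K \<longrightarrow>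
        ((\<lambda>i. measure h (vH_boundary K (A i)) / measure h (A i)) \<longlongrightarrow> 0) (net_filter I le))"

definition is_autocorrelation ::
  "'a :: {topological_space, ab_group_add} measure \<Rightarrow> 'i set \<Rightarrow> ('i \<Rightarrow> 'i \<Rightarrow> bool) \<Rightarrow> ('i \<Rightarrow> 'a set) \<Rightarrow>
   (('a \<Rightarrow> complex) \<Rightarrow> complex) \<Rightarrow> (('a \<Rightarrow> complex) \<Rightarrow> complex) \<Rightarrow> bool" where
  "is_autocorrelation h I le A \<mu> \<gamma> \<longleftrightarrow>
     complex_measure \<gamma> \<and>
     (\<forall>\<phi>\<in>Cc.
        ((\<lambda>i. conv_cm (restrict_cm \<mu> (A i)) (tilde_cm (restrict_cm \<mu> (A i))) \<phi>
              / complex_of_real (measure h (A i))) \<longlongrightarrow> \<gamma> \<phi>) (net_filter I le))"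

definition refined_eberlein_decomposition ::
  "'a :: topological_ab_group_add measure \<Rightarrow> 'a dual measure \<Rightarrow>
   'i set \<Rightarrow> ('i \<Rightarrow> 'i \<Rightarrow> bool) \<Rightarrow> ('i \<Rightarrow> 'a set) \<Rightarrow> (('a \<Rightarrow> complex) \<Rightarrow> complex) \<Rightarrow>
   (('a \<Rightarrow> complex) \<Rightarrow> complex) \<Rightarrow> (('a \<Rightarrow> complex) \<Rightarrow> complex) \<Rightarrow> (('a \<Rightarrow> complex) \<Rightarrow> complex) \<Rightarrow> bool" where
  "refined_eberlein_decomposition h hdual I le A \<omega> \<omega>pp \<omega>ac \<omega>sc \<longleftrightarrow>
     translation_bounded \<omega>pp \<and> translation_bounded \<omega>ac \<and> translation_bounded \<omega>sc \<and>
     (\<forall>\<phi>\<in>Cc. \<omega> \<phi> = \<omega>pp \<phi> + \<omega>ac \<phi> + \<omega>sc \<phi>) \<and>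
     (\<exists>\<gamma> \<rho> \<rho>pp \<rho>ac \<rho>sc \<eta>pp \<eta>ac \<eta>sc.
        is_autocorrelation h I le A \<omega> \<gamma> \<and> has_fourier_transform h \<gamma> \<rho> \<and>
        lebesgue_decomposition hdual \<rho> \<rho>pp \<rho>ac \<rho>sc \<and>
        is_autocorrelation h I le A \<omega>pp \<eta>pp \<and> has_fourier_transform h \<eta>pp \<rho>pp \<and>
        is_autocorrelation h I le A \<omega>ac \<eta>ac \<and> has_fourier_transform h \<eta>ac \<rho>ac \<and>
        is_autocorrelation h I le A \<omega>sc \<eta>sc \<and> has_fourier_transform h \<eta>sc \<rho>sc)"

end

theory Submission
  imports Defs
begin

text \<open>
  Let \<open>\<rho>\<^sub>1, \<rho>\<^sub>2, \<rho>\<^sub>3\<close> be the Fourier transforms of the autocorrelations of the three summands.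
  Write \<open>\<omega>|\<^sub>A\<close> for a restriction and \<open>G\<^sub>\<phi> = \<omega>|\<^sub>A * \<phi>'\<close>, where \<open>\<phi>'(x)\<close> is the conjugate of \<open>\<phi>(-x)\<close>.
  Testing the approximants of the autocorrelation \<open>\<gamma>\<close> against \<open>\<phi> * \<phi>'\<close> gives \<open>\<integral>|G\<^sub>\<phi>|\<^sup>2 / |A|\<close>, so
  the integral of the squared Fourier transform of \<open>\<phi>\<close> against that of \<open>\<gamma>\<close> is a limit of
  squared seminorms to which the Cauchy--Schwarz inequality applies.
  A finite linear combination of translations acts on the Fourier side as a trigonometric polynomial
  on the dual group, and has an adjoint with respect to these forms. If two of the measures \<open>\<rho>\<^sub>1, \<rho>\<^sub>2, \<rho>\<^sub>3\<close>
  are mutually singular on compact sets, Stone--Weierstrass provides such a polynomial close to \<open>1\<close>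
  for one and close to \<open>0\<close> for the other, and moving it across the form shows that the cross terms
  vanish. So the Fourier transform of \<open>\<gamma>\<close> is \<open>\<rho>\<^sub>1 + \<rho>\<^sub>2 + \<rho>\<^sub>3\<close>.

  This argument requires that Haar measure on the dual group has no atoms. Otherwise the dual group is
  discrete, \<open>\<rho>\<^sub>1\<close> and \<open>\<rho>\<^sub>2\<close> may both be pure point and may be correlated, but then every
  measure on the dual group is pure point and \<open>\<omega>\<close> itself is the pure point component. What has to
  be shown in this case is that \<open>\<gamma>\<close> has a Fourier transform: the form of \<open>\<gamma>\<close> is dominated by that of
  \<open>3 (\<rho>\<^sub>1 + \<rho>\<^sub>2 + \<rho>\<^sub>3)\<close> and invariant under translations, hence diagonal in the atoms.
\<close>

section \<open>Test functions and complex measures\<close>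

text \<open>\<open>cm_integral\<close> is a definite description, so linearity of
  \<open>restrict_cm\<close> in the function and additivity in the measure do not come with its
  definition. Both are reached by replacing the indicator of A by a continuous cutoff that serves
  all measures and functions of an identity at once. After that only functionals on
  \<open>Cc\<close> and functions in \<open>Cc\<close> occur. Translations cross the form without
  boundary error, because \<open>restrict_conv\<close> is integrated over the whole group and Haar
  measure is invariant. Hence the adjoint identity and the Cauchy--Schwarz bound hold for every
  single A, and limits are taken last. \<open>has_fourier_transform\<close> tests \<gamma> only on
  functions built from \<phi> * \<phi>', so a measure enters only through its integrals of squared
  Fourier transforms, and real parts of cross terms suffice. Singularity and finiteness are
  available only on compact sets; the squared modulus of a Fourier transform serves as an integrable
  weight, almost all of which sits on one compact set, and there a single trigonometric polynomial
  is enough.\<close>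

lemma Cc_iff:
  fixes f :: "'a :: t2_space \<Rightarrow> complex"
  shows "f \<in> Cc \<longleftrightarrow> continuous_on UNIV f \<and> (\<exists>K. compact K \<and> (\<forall>x. x \<notin> K \<longrightarrow> f x = 0))"
proof
  assume "f \<in> Cc"
  then show "continuous_on UNIV f \<and> (\<exists>K. compact K \<and> (\<forall>x. x \<notin> K \<longrightarrow> f x = 0))"
    unfolding Cc_def using closure_subset[of "{x. f x \<noteq> 0}"] by blast
next
  assume *: "continuous_on UNIV f \<and> (\<exists>K. compact K \<and> (\<forall>x. x \<notin> K \<longrightarrow> f x = 0))"
  then obtain K where K: "compact K" "\<forall>x. x \<notin> K \<longrightarrow> f x = 0" by blast
  have "closure {x. f x \<noteq> 0} \<subseteq> K"
    using K by (intro closure_minimal) (auto intro: compact_imp_closed)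
  then have "compact (closure {x. f x \<noteq> 0})"
    using K(1) compact_Int_closed[of K "closure {x. f x \<noteq> 0}"] by (simp add: inf.absorb2)
  with * show "f \<in> Cc" unfolding Cc_def by blast
qed

lemma CcI:
  fixes f :: "'a :: t2_space \<Rightarrow> complex"
  assumes "continuous_on UNIV f" "compact K" "\<And>x. x \<notin> K \<Longrightarrow> f x = 0"
  shows "f \<in> Cc"
  using assms Cc_iff by blast

lemma CcE:
  fixes f :: "'a :: t2_space \<Rightarrow> complex"
  assumes "f \<in> Cc"
  obtains K where "compact K" "\<And>x. x \<notin> K \<Longrightarrow> f x = 0"
  using assms Cc_iff by blast

lemma Cc_continuous: "f \<in> Cc \<Longrightarrow> continuous_on S f"
  unfolding Cc_def using continuous_on_subset by blast

lemma Cc_zero: "(\<lambda>x. 0) \<in> (Cc :: ('a :: t2_space \<Rightarrow> complex) set)"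
  by (rule CcI[of _ "{}"]) auto

lemma Cc_add:
  fixes f :: "'a :: t2_space \<Rightarrow> complex"
  assumes "f \<in> Cc" "g \<in> Cc" shows "(\<lambda>x. f x + g x) \<in> Cc"
proof -
  obtain K where "compact K" "\<And>x. x \<notin> K \<Longrightarrow> f x = 0" by (rule CcE[OF assms(1)]) blast
  moreover obtain L where "compact L" "\<And>x. x \<notin> L \<Longrightarrow> g x = 0" by (rule CcE[OF assms(2)]) blast
  ultimately show ?thesis
    using continuous_on_add[OF Cc_continuous[OF assms(1)] Cc_continuous[OF assms(2)]]
    by (intro CcI[of _ "K \<union> L"]) (auto intro: compact_Un)
qed

lemma Cc_mult_left:
  fixes f :: "'a :: t2_space \<Rightarrow> complex"
  assumes "f \<in> Cc" "continuous_on UNIV g" shows "(\<lambda>x. g x * f x) \<in> Cc"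
proof -
  obtain K where "compact K" "\<And>x. x \<notin> K \<Longrightarrow> f x = 0" by (rule CcE[OF assms(1)]) blast
  then show ?thesis
    using continuous_on_mult[OF assms(2) Cc_continuous[OF assms(1)]] by (intro CcI[of _ K]) auto
qed

lemma Cc_mult_right:
  fixes f :: "'a :: t2_space \<Rightarrow> complex"
  assumes "f \<in> Cc" "continuous_on UNIV g" shows "(\<lambda>x. f x * g x) \<in> Cc"
  using Cc_mult_left[OF assms] by (simp add: mult.commute)

lemma Cc_cmult:
  fixes f :: "'a :: t2_space \<Rightarrow> complex"
  shows "f \<in> Cc \<Longrightarrow> (\<lambda>x. c * f x) \<in> Cc"
  by (rule Cc_mult_left) auto

lemma Cc_diff:
  fixes f :: "'a :: t2_space \<Rightarrow> complex"
  assumes "f \<in> Cc" "g \<in> Cc" shows "(\<lambda>x. f x - g x) \<in> Cc"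
  using Cc_add[OF assms(1) Cc_cmult[OF assms(2), of "-1"]] by simp

lemma Cc_sum:
  fixes f :: "'i \<Rightarrow> 'a :: t2_space \<Rightarrow> complex"
  assumes "\<And>i. i \<in> I \<Longrightarrow> f i \<in> Cc"
  shows "(\<lambda>x. \<Sum>i\<in>I. f i x) \<in> Cc"
  using assms by (induction I rule: infinite_finite_induct) (auto intro: Cc_zero Cc_add)

lemma Cc_cnj:
  fixes f :: "'a :: t2_space \<Rightarrow> complex"
  assumes "f \<in> Cc" shows "(\<lambda>x. cnj (f x)) \<in> Cc"
proof -
  obtain K where "compact K" "\<And>x. x \<notin> K \<Longrightarrow> f x = 0" by (rule CcE[OF assms]) blast
  then show ?thesis
    using continuous_on_cnj[OF Cc_continuous[OF assms]] by (intro CcI[of _ K]) auto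
qed

lemma Cc_norm:
  fixes f :: "'a :: t2_space \<Rightarrow> complex"
  assumes "f \<in> Cc" shows "(\<lambda>x. complex_of_real (cmod (f x))) \<in> Cc"
proof -
  obtain K where "compact K" "\<And>x. x \<notin> K \<Longrightarrow> f x = 0" by (rule CcE[OF assms]) blast
  then show ?thesis
    by (intro CcI[OF continuous_on_of_real[OF continuous_on_norm[OF Cc_continuous[OF assms]]], of K]) auto
qed

lemma Cc_minus_arg:
  fixes f :: "'a :: lca_group \<Rightarrow> complex"
  assumes "f \<in> Cc" shows "(\<lambda>x. f (t - x)) \<in> Cc"
proof -
  obtain K where K: "compact K" "\<And>x. x \<notin> K \<Longrightarrow> f x = 0" by (rule CcE[OF assms(1)]) blast
  have "continuous_on UNIV (\<lambda>x. f (t - x))"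
    by (intro continuous_on_compose2[OF Cc_continuous[OF assms, of UNIV]] continuous_intros) auto
  moreover have "compact ((\<lambda>x. t - x) ` K)"
    by (intro compact_continuous_image K continuous_intros)
  moreover have "f (t - x) = 0" if "x \<notin> (\<lambda>x. t - x) ` K" for x
    using that K(2)[of "t - x"] by (force simp: image_iff)
  ultimately show ?thesis by (rule CcI[of _ "(\<lambda>x. t - x) ` K"])
qed

lemma Cc_plus_arg:
  fixes f :: "'a :: lca_group \<Rightarrow> complex"
  assumes "f \<in> Cc" shows "(\<lambda>x. f (x + t)) \<in> Cc"
  using Cc_minus_arg[OF Cc_minus_arg[OF assms, of 0], of "- t"] by (simp add: add.commute)

lemma Cc_shift:
  fixes f :: "'a :: lca_group \<Rightarrow> complex"
  assumes "f \<in> Cc" shows "(\<lambda>x. f (x - t)) \<in> Cc"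
  using Cc_plus_arg[OF assms, of "- t"] by simp

lemma Cc_bounded:
  fixes f :: "'a :: t2_space \<Rightarrow> complex"
  assumes "f \<in> Cc"
  obtains B where "B > 0" "\<And>x. cmod (f x) \<le> B"
proof -
  obtain K where K: "compact K" "\<And>x. x \<notin> K \<Longrightarrow> f x = 0" by (rule CcE[OF assms(1)]) blast
  have "compact (f ` K)" by (intro compact_continuous_image K Cc_continuous assms)
  then obtain B where B: "\<forall>y\<in>f ` K. cmod y \<le> B"
    using compact_imp_bounded bounded_iff by metis
  have B': "cmod (f x) \<le> max B 1" for x
    using B K(2)[of x] by (cases "x \<in> K") (auto simp: le_max_iff_disj)
  show ?thesis by (rule that[OF _ B']) simp
qed

text \<open>Any pointwise bound replaces the supremum of the definition, and the constant is made
  positive so that later estimates can divide by it.\<close>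

lemma complex_measure_bound:
  fixes \<mu> :: "('a :: t2_space \<Rightarrow> complex) \<Rightarrow> complex"
  assumes "complex_measure \<mu>" "compact K"
  obtains C where "C > 0"
    "\<And>f B. f \<in> Cc \<Longrightarrow> (\<And>x. x \<notin> K \<Longrightarrow> f x = 0) \<Longrightarrow> (\<And>x. cmod (f x) \<le> B) \<Longrightarrow> cmod (\<mu> f) \<le> C * B"
proof -
  obtain C where C: "C \<ge> 0" "\<And>f. f \<in> Cc \<Longrightarrow> closure {x. f x \<noteq> 0} \<subseteq> K \<Longrightarrow> cmod (\<mu> f) \<le> C * (SUP x. cmod (f x))"
    using assms unfolding complex_measure_def by meson
  have *: "cmod (\<mu> f) \<le> (C + 1) * B" if f: "f \<in> Cc" "\<And>x. x \<notin> K \<Longrightarrow> f x = 0" "\<And>x. cmod (f x) \<le> B" for f B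
  proof -
    have "closure {x. f x \<noteq> 0} \<subseteq> K"
      using f(2) assms(2) by (intro closure_minimal) (auto intro: compact_imp_closed)
    then have "cmod (\<mu> f) \<le> C * (SUP x. cmod (f x))" using C f by blast
    also have "\<dots> \<le> C * B" using C(1) f(3) by (intro mult_left_mono cSUP_least) auto
    also have "\<dots> \<le> (C + 1) * B"
      using order_trans[OF norm_ge_zero f(3)] by (simp add: distrib_right)
    finally show ?thesis .
  qed
  show ?thesis using C(1) by (intro that[OF _ *]) simp
qed

lemma complex_measure_add:
  "complex_measure \<mu> \<Longrightarrow> f \<in> Cc \<Longrightarrow> g \<in> Cc \<Longrightarrow> \<mu> (\<lambda>x. f x + g x) = \<mu> f + \<mu> g"
  by (simp add: complex_measure_def)

lemma complex_measure_cmult: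
  "complex_measure \<mu> \<Longrightarrow> f \<in> Cc \<Longrightarrow> \<mu> (\<lambda>x. c * f x) = c * \<mu> f"
  by (simp add: complex_measure_def)

lemma complex_measure_diff:
  fixes f :: "'a :: t2_space \<Rightarrow> complex"
  assumes "complex_measure \<mu>" "f \<in> Cc" "g \<in> Cc"
  shows "\<mu> (\<lambda>x. f x - g x) = \<mu> f - \<mu> g"
  using complex_measure_add[OF assms(1,2) Cc_cmult[OF assms(3), of "-1"]]
    complex_measure_cmult[OF assms(1,3), of "-1"] by simp

lemma complex_measure_zero:
  fixes \<mu> :: "('a :: t2_space \<Rightarrow> complex) \<Rightarrow> complex"
  assumes "complex_measure \<mu>" shows "\<mu> (\<lambda>x. 0) = 0"
  using complex_measure_cmult[OF assms Cc_zero, of 0] by simp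

lemma complex_measure_sum:
  fixes f :: "'i \<Rightarrow> 'a :: t2_space \<Rightarrow> complex"
  assumes "complex_measure \<mu>" "\<And>i. i \<in> I \<Longrightarrow> f i \<in> Cc"
  shows "\<mu> (\<lambda>x. \<Sum>i\<in>I. f i x) = (\<Sum>i\<in>I. \<mu> (f i))"
  using assms(2)
  by (induction I rule: infinite_finite_induct)
     (auto simp: complex_measure_zero[OF assms(1)] complex_measure_add[OF assms(1)] Cc_sum)

text \<open>A locally compact Hausdorff space is completely regular, and there a compact set can be
  separated from a closed one by a continuous function.\<close>

lemma lca_Urysohn:
  fixes S T :: "'a :: lca_group set"
  assumes "compact S" "closed T" "S \<inter> T = {}"
  obtains f :: "'a \<Rightarrow> real" where "continuous_on UNIV f" "\<And>x. 0 \<le> f x" "\<And>x. f x \<le> 1"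
    "\<And>x. x \<in> S \<Longrightarrow> f x = 1" "\<And>x. x \<in> T \<Longrightarrow> f x = 0"
proof -
  have "\<exists>U K. openin euclidean U \<and> compactin euclidean K \<and> x \<in> U \<and> U \<subseteq> K" for x :: 'a
    using locally_compact[of x] by (auto simp: open_openin[symmetric])
  then have "locally_compact_space (euclidean :: 'a topology)"
    unfolding locally_compact_space_def by blast
  moreover have "Hausdorff_space (euclidean :: 'a topology)"
    unfolding Hausdorff_space_def disjnt_def open_openin[symmetric] using hausdorff by blast
  ultimately have "completely_regular_space (euclidean :: 'a topology)"
    using locally_compact_regular_imp_completely_regular_space by blast
  moreover have "compactin euclidean S" "closedin euclidean T" "disjnt S T"
    using assms by (auto simp: disjnt_def)
  ultimately obtain f where f: "continuous_map (euclidean :: 'a topology) (top_of_set {0..1::real}) f"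
      "f ` T \<subseteq> {0}" "f ` S \<subseteq> {1}"
    by (rule Urysohn_completely_regular_compact_closed[OF zero_le_one, of "euclidean :: 'a topology" S T])
  have "continuous_on UNIV f" using f(1) by (simp add: continuous_map_in_subtopology)
  moreover have "f x \<in> {0..1}" for x using f(1) by (auto simp: continuous_map_in_subtopology)
  ultimately show ?thesis using f(2,3) by (intro that[of f]) auto
qed

section \<open>Integration with respect to a complex measure\<close>

text \<open>The inner supremum of \<open>upper_variation_integral\<close>. For lower semicontinuous
  g it is the integral of g with respect to the total variation of \<mu>; it is stated for arbitrary
  g so that monotonicity involves no topology.\<close>

definition lsc_integral :: "(('a :: topological_space \<Rightarrow> complex) \<Rightarrow> complex) \<Rightarrow> ('a \<Rightarrow> ennreal) \<Rightarrow> ennreal" where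
  "lsc_integral \<mu> g = (SUP \<phi>\<in>{\<phi>\<in>Cc. \<forall>x. ennreal (cmod (\<phi> x)) \<le> g x}. ennreal (cmod (\<mu> \<phi>)))"

lemma lsc_integral_upper:
  "\<phi> \<in> Cc \<Longrightarrow> (\<And>x. ennreal (cmod (\<phi> x)) \<le> g x) \<Longrightarrow> ennreal (cmod (\<mu> \<phi>)) \<le> lsc_integral \<mu> g"
  unfolding lsc_integral_def by (rule SUP_upper) auto

lemma upper_variation_integral_le:
  "(\<And>c. open {x. c < g x}) \<Longrightarrow> (\<And>x. f x \<le> g x) \<Longrightarrow> upper_variation_integral \<mu> f \<le> lsc_integral \<mu> g"
  unfolding upper_variation_integral_def lsc_integral_def by (rule INF_lower) auto

lemma upper_variation_integral_lessE:
  assumes "upper_variation_integral \<mu> f < a"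
  obtains g where "\<And>c. open {x. c < g x}" "\<And>x. f x \<le> g x" "lsc_integral \<mu> g < a"
  using assms unfolding upper_variation_integral_def INF_less_iff lsc_integral_def by auto

text \<open>Lower semicontinuity only controls comparison with constants; density of the order of
  \<open>ennreal\<close> inserts a constant c between f x and g x.\<close>

lemma open_less_lsc:
  fixes f :: "'a :: topological_space \<Rightarrow> real" and g :: "'a \<Rightarrow> ennreal"
  assumes "continuous_on UNIV f" "\<And>c. open {x. c < g x}"
  shows "open {x. ennreal (f x) < g x}"
proof -
  have "{x. ennreal (f x) < g x} = (\<Union>c. {x. ennreal (f x) < c} \<inter> {x. c < g x})"
    using dense by (auto intro: less_trans)
  moreover have "open {x. ennreal (f x) < c}" for c
    using assms(1) by (intro open_Collect_less continuous_on_ennreal continuous_on_const)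
  ultimately show ?thesis using assms(2) by (simp only:) (intro open_UN ballI open_Int)
qed

text \<open>The constant \<open>3\<close> is not sharp, but it lets the splitting of \<open>\<theta>\<close> go through with a single
  Urysohn function: where \<open>\<theta> \<noteq> 0\<close>, one of the two majorants strictly exceeds \<open>|\<theta>|/3\<close>.\<close>

lemma cmod_le_upper_variation_integrals:
  fixes \<mu> :: "('a :: lca_group \<Rightarrow> complex) \<Rightarrow> complex"
  assumes \<mu>: "complex_measure \<mu>" and \<theta>: "\<theta> \<in> Cc"
    and le: "\<And>x. ennreal (cmod (\<theta> x)) \<le> f1 x + f2 x"
    and f1: "upper_variation_integral \<mu> f1 < ennreal a" and f2: "upper_variation_integral \<mu> f2 < ennreal b"
  shows "cmod (\<mu> \<theta>) \<le> 3 * (a + b)"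
proof -
  obtain g1 where g1: "\<And>c. open {x. c < g1 x}" "\<And>x. f1 x \<le> g1 x" "lsc_integral \<mu> g1 < ennreal a"
    using f1 by (rule upper_variation_integral_lessE) blast
  obtain g2 where g2: "\<And>c. open {x. c < g2 x}" "\<And>x. f2 x \<le> g2 x" "lsc_integral \<mu> g2 < ennreal b"
    using f2 by (rule upper_variation_integral_lessE) blast
  have cont: "continuous_on UNIV \<theta>" using \<theta> by (rule Cc_continuous)
  define O1 where "O1 = {x. ennreal (cmod (\<theta> x) / 3) < g1 x}"
  define O2 where "O2 = {x. ennreal (cmod (\<theta> x) / 3) < g2 x}"
  have open1: "open O1" and open2: "open O2" unfolding O1_def O2_def
    using cont by (auto intro!: open_less_lsc g1 g2 continuous_intros)
  have cover: "x \<in> O1 \<or> x \<in> O2" if "\<theta> x \<noteq> 0" for x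
  proof (rule ccontr)
    assume "\<not> (x \<in> O1 \<or> x \<in> O2)"
    then have "g1 x + g2 x \<le> ennreal (cmod (\<theta> x) / 3) + ennreal (cmod (\<theta> x) / 3)"
      unfolding O1_def O2_def by (intro add_mono) auto
    also have "\<dots> = ennreal (cmod (\<theta> x) * 2 / 3)" by (simp flip: ennreal_plus)
    finally have "ennreal (cmod (\<theta> x)) \<le> ennreal (cmod (\<theta> x) * 2 / 3)"
      using le[of x] g1(2)[of x] g2(2)[of x] by (meson add_mono order_trans)
    then have "cmod (\<theta> x) \<le> cmod (\<theta> x) * 2 / 3" by (simp add: ennreal_le_iff)
    with that show False by simp
  qed
  obtain L where L: "compact L" "\<And>x. x \<notin> L \<Longrightarrow> \<theta> x = 0" using \<theta> by (rule CcE) blast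
  obtain C where C: "C > 0" "\<And>f B. f \<in> Cc \<Longrightarrow> (\<And>x. x \<notin> L \<Longrightarrow> f x = 0) \<Longrightarrow> (\<And>x. cmod (f x) \<le> B) \<Longrightarrow> cmod (\<mu> f) \<le> C * B"
    using \<mu> L(1) by (rule complex_measure_bound) blast
  \<comment> \<open>Dividing by 3 puts \<psi> under g; this is where the factor 3 of the conclusion
    arises.\<close>
  have third: "cmod (\<mu> \<psi>) \<le> 3 * c"
    if \<psi>: "\<psi> \<in> Cc" "\<And>x. ennreal (cmod (\<psi> x) / 3) \<le> g x" and g: "lsc_integral \<mu> g < ennreal c" for \<psi> g c
  proof -
    have "ennreal (cmod (\<mu> (\<lambda>x. 1/3 * \<psi> x))) \<le> lsc_integral \<mu> g"
    proof (rule lsc_integral_upper)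
      show "(\<lambda>x. 1/3 * \<psi> x) \<in> Cc" by (rule Cc_cmult[OF \<psi>(1)])
      show "ennreal (cmod (1/3 * \<psi> x)) \<le> g x" for x using \<psi>(2)[of x] by (simp add: norm_mult)
    qed
    also note g
    finally have "cmod (\<mu> (\<lambda>x. 1/3 * \<psi> x)) < c" by (simp add: ennreal_less_iff)
    then show ?thesis
      unfolding complex_measure_cmult[OF \<mu> \<psi>(1)] by (simp add: norm_mult)
  qed
  \<comment> \<open>The two open sets cover only the points where \<theta> is nonzero, which need
    not form a compact set. Values below \<delta> are split off first, at the cost C * \<delta>, and
    the rest lives on a compact set.\<close>
  have "cmod (\<mu> \<theta>) \<le> 3 * (a + b) + C * \<delta>" if "\<delta> > 0" for \<delta>
  proof -
    define K where "K = {x. \<delta> \<le> cmod (\<theta> x)}"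
    have "closed K" unfolding K_def using cont by (intro closed_Collect_le continuous_intros)
    moreover have "K \<subseteq> L" using L(2) \<open>\<delta> > 0\<close> unfolding K_def by force
    ultimately have K: "compact K" using L(1) compact_Int_closed[of L K] by (simp add: inf.absorb2)
    \<comment> \<open>On K the function f below lives inside O1 and 1 - f inside O2, so the two
      pieces of \<theta> fall under the two majorants.\<close>
    have "compact (K - O2)" using K open2 by (rule compact_diff)
    moreover have "closed (K - O1)" using K open1 by (intro closed_Diff compact_imp_closed)
    moreover have "(K - O2) \<inter> (K - O1) = {}" using cover \<open>\<delta> > 0\<close> unfolding K_def by force
    ultimately obtain f :: "'a \<Rightarrow> real" where f: "continuous_on UNIV f" "\<And>x. 0 \<le> f x" "\<And>x. f x \<le> 1"
        "\<And>x. x \<in> K - O2 \<Longrightarrow> f x = 1" "\<And>x. x \<in> K - O1 \<Longrightarrow> f x = 0"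
      by (rule lca_Urysohn) blast
    \<comment> \<open>Where |\<theta>| is at least \<delta>, r = 1 - \<delta> / |\<theta>|, and r =
      0 elsewhere; so (1 - r) * |\<theta>| never exceeds \<delta>. The maximum in the denominator
      keeps the quotient continuous at zeros of \<theta>.\<close>
    define r where "r x = max 0 (cmod (\<theta> x) - \<delta>) / max \<delta> (cmod (\<theta> x))" for x
    have r: "continuous_on UNIV r" unfolding r_def
      using cont \<open>\<delta> > 0\<close> by (intro continuous_intros) (auto simp: max_def)
    have r01: "0 \<le> r x" "r x \<le> 1" and r0: "x \<notin> K \<Longrightarrow> r x = 0" and r\<delta>: "(1 - r x) * cmod (\<theta> x) \<le> \<delta>" for x
    proof -
      show "0 \<le> r x" "x \<notin> K \<Longrightarrow> r x = 0" using \<open>\<delta> > 0\<close> unfolding r_def K_def by auto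
      have "r x = (if \<delta> \<le> cmod (\<theta> x) then 1 - \<delta> / cmod (\<theta> x) else 0)"
        using \<open>\<delta> > 0\<close> unfolding r_def by (auto simp: max_def diff_divide_distrib)
      then show "r x \<le> 1" "(1 - r x) * cmod (\<theta> x) \<le> \<delta>" using \<open>\<delta> > 0\<close> by auto
    qed
    define \<theta>1 where "\<theta>1 x = complex_of_real (f x * r x) * \<theta> x" for x
    define \<theta>2 where "\<theta>2 x = complex_of_real ((1 - f x) * r x) * \<theta> x" for x
    define \<theta>3 where "\<theta>3 x = complex_of_real (1 - r x) * \<theta> x" for x
    have c1: "\<theta>1 \<in> Cc" and c2: "\<theta>2 \<in> Cc" and c3: "\<theta>3 \<in> Cc"
      unfolding \<theta>1_def \<theta>2_def \<theta>3_def using f(1) r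
      by (auto intro!: Cc_mult_left[OF \<theta>] continuous_intros)
    have bd: "ennreal (s * cmod (\<theta> x) / 3) \<le> ennreal (cmod (\<theta> x) / 3)" if "s \<le> 1" for s x
      using mult_right_mono[OF that norm_ge_zero[of "\<theta> x"]] by (intro ennreal_leI) simp
    have fr: "f x * r x \<le> 1" "(1 - f x) * r x \<le> 1" for x
      using f(2,3)[of x] r01[of x] by (auto intro!: mult_le_one)
    have n1: "cmod (\<theta>1 x) = f x * r x * cmod (\<theta> x)" and n2: "cmod (\<theta>2 x) = (1 - f x) * r x * cmod (\<theta> x)"
      and n3: "cmod (\<theta>3 x) = (1 - r x) * cmod (\<theta> x)" for x
      unfolding \<theta>1_def \<theta>2_def \<theta>3_def norm_mult norm_of_real using f(2,3)[of x] r01[of x] by (simp_all add: abs_mult)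
    have "ennreal (cmod (\<theta>1 x) / 3) \<le> g1 x" for x
    proof (cases "x \<in> K \<inter> O1")
      case True
      have "ennreal (cmod (\<theta>1 x) / 3) \<le> ennreal (cmod (\<theta> x) / 3)"
        using bd[OF fr(1)[of x], of x] f(2,3)[of x] r01[of x] by (simp add: n1)
      also have "\<dots> \<le> g1 x" using True unfolding O1_def by (simp add: less_imp_le)
      finally show ?thesis .
    next
      case False
      then have "f x * r x = 0" using f(5)[of x] r0[of x] by auto
      then have "\<theta>1 x = 0" unfolding \<theta>1_def by (simp only: of_real_0 mult_zero_left)
      then show ?thesis by simp
    qed
    then have 1: "cmod (\<mu> \<theta>1) \<le> 3 * a" using third[OF c1 _ g1(3)] by blast
    have "ennreal (cmod (\<theta>2 x) / 3) \<le> g2 x" for x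
    proof (cases "x \<in> K \<inter> O2")
      case True
      have "ennreal (cmod (\<theta>2 x) / 3) \<le> ennreal (cmod (\<theta> x) / 3)"
        using bd[OF fr(2)[of x], of x] f(2,3)[of x] r01[of x] by (simp add: n2)
      also have "\<dots> \<le> g2 x" using True unfolding O2_def by (simp add: less_imp_le)
      finally show ?thesis .
    next
      case False
      then have "(1 - f x) * r x = 0" using f(4)[of x] r0[of x] by auto
      then have "\<theta>2 x = 0" unfolding \<theta>2_def by (simp only: of_real_0 mult_zero_left)
      then show ?thesis by simp
    qed
    then have 2: "cmod (\<mu> \<theta>2) \<le> 3 * b" using third[OF c2 _ g2(3)] by blast
    have "cmod (\<theta>3 x) \<le> \<delta>" for x using r\<delta>[of x] r01[of x] by (simp add: n3)
    moreover have "\<theta>3 x = 0" if "x \<notin> L" for x using L(2)[OF that] unfolding \<theta>3_def by simp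
    ultimately have 3: "cmod (\<mu> \<theta>3) \<le> C * \<delta>" using C(2) c3 by blast
    have "\<theta> = (\<lambda>x. (\<theta>1 x + \<theta>2 x) + \<theta>3 x)"
      unfolding \<theta>1_def \<theta>2_def \<theta>3_def by (simp add: algebra_simps)
    then have "\<mu> \<theta> = \<mu> \<theta>1 + \<mu> \<theta>2 + \<mu> \<theta>3"
      using complex_measure_add[OF \<mu> Cc_add[OF c1 c2] c3] complex_measure_add[OF \<mu> c1 c2] by simp
    then show ?thesis using 1 2 3 norm_triangle_ineq[of "\<mu> \<theta>1 + \<mu> \<theta>2" "\<mu> \<theta>3"] norm_triangle_ineq[of "\<mu> \<theta>1" "\<mu> \<theta>2"] by simp
  qed
  from this[of "e / C" for e] have "cmod (\<mu> \<theta>) \<le> 3 * (a + b) + e" if "e > 0" for e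
    using C(1) that by simp
  then show ?thesis by (rule field_le_epsilon)
qed

text \<open>\<open>f\<close> lies in \<open>L\<^sup>1(|\<mu>|)\<close>, the closure of \<open>C\<^sub>c\<close>.\<close>

definition cm_integrable :: "(('a :: topological_space \<Rightarrow> complex) \<Rightarrow> complex) \<Rightarrow> ('a \<Rightarrow> complex) \<Rightarrow> bool" where
  "cm_integrable \<mu> f \<longleftrightarrow>
     (\<forall>e>0. \<exists>\<psi>\<in>Cc. upper_variation_integral \<mu> (\<lambda>x. ennreal (cmod (f x - \<psi> x))) < ennreal e)"

text \<open>Two approximants of the same f differ pointwise by at most the sum of the two errors.
  This will give uniqueness of the value that \<open>cm_integral\<close> selects.\<close>

lemma cmod_diff_le_upper_variation_integrals:
  fixes \<mu> :: "('a :: lca_group \<Rightarrow> complex) \<Rightarrow> complex"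
  assumes "complex_measure \<mu>" "\<psi>1 \<in> Cc" "\<psi>2 \<in> Cc"
    "upper_variation_integral \<mu> (\<lambda>x. ennreal (cmod (f x - \<psi>1 x))) < ennreal a"
    "upper_variation_integral \<mu> (\<lambda>x. ennreal (cmod (f x - \<psi>2 x))) < ennreal b"
  shows "cmod (\<mu> \<psi>1 - \<mu> \<psi>2) \<le> 3 * (a + b)"
proof -
  have "ennreal (cmod (\<psi>1 x - \<psi>2 x)) \<le> ennreal (cmod (f x - \<psi>1 x)) + ennreal (cmod (f x - \<psi>2 x))" for x
  proof -
    have "cmod (\<psi>1 x - \<psi>2 x) \<le> cmod (f x - \<psi>1 x) + cmod (f x - \<psi>2 x)"
      using norm_triangle_ineq4[of "f x - \<psi>2 x" "f x - \<psi>1 x"] by simp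
    then show ?thesis by (simp flip: ennreal_plus)
  qed
  then have "cmod (\<mu> (\<lambda>x. \<psi>1 x - \<psi>2 x)) \<le> 3 * (a + b)"
    by (rule cmod_le_upper_variation_integrals[OF assms(1) Cc_diff[OF assms(2,3)] _ assms(4,5)])
  then show ?thesis by (simp add: complex_measure_diff[OF assms(1-3)])
qed

text \<open>Existence of the described number comes from a Cauchy sequence of approximants,
  uniqueness from comparison with any approximant. The bound is the working form of the integral:
  one good \<psi> computes it up to 3 * a.\<close>

lemma cm_integral_approx:
  fixes \<mu> :: "('a :: lca_group \<Rightarrow> complex) \<Rightarrow> complex"
  assumes \<mu>: "complex_measure \<mu>" and f: "cm_integrable \<mu> f" and \<psi>: "\<psi> \<in> Cc"
    and a: "upper_variation_integral \<mu> (\<lambda>x. ennreal (cmod (f x - \<psi> x))) < ennreal a"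
  shows "cmod (cm_integral \<mu> f - \<mu> \<psi>) \<le> 3 * a"
proof -
  let ?U = "\<lambda>\<psi>. upper_variation_integral \<mu> (\<lambda>x. ennreal (cmod (f x - \<psi> x)))"
  define P where "P c \<longleftrightarrow> (\<forall>e>0. \<exists>\<psi>\<in>Cc. ?U \<psi> < ennreal e \<and> cmod (c - \<mu> \<psi>) < e)" for c
  have near: "cmod (c - \<mu> \<psi>) \<le> 3 * a" if c: "P c" and \<psi>: "\<psi> \<in> Cc" and a: "?U \<psi> < ennreal a" for c \<psi> a
  proof (rule field_le_epsilon)
    fix e :: real assume "e > 0"
    \<comment> \<open>With e / 4 the contributions 3 * (e/4 + a) and e/4 add up to 3 * a +
      e.\<close>
    then have "e / 4 > 0" by simp
    then obtain \<psi>' where \<psi>': "\<psi>' \<in> Cc" "?U \<psi>' < ennreal (e/4)" "cmod (c - \<mu> \<psi>') < e/4"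
      using c unfolding P_def by blast
    then have "cmod (\<mu> \<psi>' - \<mu> \<psi>) \<le> 3 * (e/4 + a)"
      by (intro cmod_diff_le_upper_variation_integrals[OF \<mu> _ \<psi> _ a])
    then show "cmod (c - \<mu> \<psi>) \<le> 3 * a + e"
      using \<psi>'(3) norm_triangle_ineq[of "c - \<mu> \<psi>'" "\<mu> \<psi>' - \<mu> \<psi>"] by simp
  qed
  have "\<forall>n. \<exists>\<psi>\<in>Cc. ?U \<psi> < ennreal (1 / real (Suc n))"
    using f unfolding cm_integrable_def by simp
  then obtain s where s: "\<And>n. s n \<in> Cc" "\<And>n. ?U (s n) < ennreal (1 / real (Suc n))" by metis
  have close: "cmod (\<mu> (s m) - \<mu> (s n)) \<le> 3 * (1 / real (Suc m) + 1 / real (Suc n))" for m n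
    by (rule cmod_diff_le_upper_variation_integrals[OF \<mu> s(1) s(1) s(2) s(2)])
  have inv: "1 / real (Suc n) \<le> 1 / real (Suc M)" if "n \<ge> M" for n M using that by (simp add: frac_le)
  have "Cauchy (\<lambda>n. \<mu> (s n))"
  proof (rule metric_CauchyI)
    fix e :: real assume "e > 0"
    then obtain M where M: "1 / real (Suc M) < e / 6"
      using reals_Archimedean[of "e/6"] by (auto simp: inverse_eq_divide)
    have "dist (\<mu> (s m)) (\<mu> (s n)) < e" if "m \<ge> M" "n \<ge> M" for m n
      using close[of m n] inv[OF that(1)] inv[OF that(2)] M by (simp add: dist_norm)
    then show "\<exists>M. \<forall>m\<ge>M. \<forall>n\<ge>M. dist (\<mu> (s m)) (\<mu> (s n)) < e" by blast
  qed
  then obtain c where c: "(\<lambda>n. \<mu> (s n)) \<longlonglongrightarrow> c" using Cauchy_convergent convergent_def by blast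
  have "P c" unfolding P_def
  proof (intro allI impI)
    fix e :: real assume "e > 0"
    then obtain M where M: "\<And>n. n \<ge> M \<Longrightarrow> cmod (\<mu> (s n) - c) < e"
      using LIMSEQ_D[OF c] by blast
    obtain N where N: "1 / real (Suc N) < e"
      using reals_Archimedean[OF \<open>e > 0\<close>] by (auto simp: inverse_eq_divide)
    have "ennreal (1 / real (Suc (max M N))) \<le> ennreal e"
      using inv[of N "max M N"] N by (intro ennreal_leI) simp
    then have "?U (s (max M N)) < ennreal e" using s(2) less_le_trans by blast
    with M[of "max M N"] s(1) show "\<exists>\<psi>\<in>Cc. ?U \<psi> < ennreal e \<and> cmod (c - \<mu> \<psi>) < e"
      by (intro bexI[of _ "s (max M N)"]) (auto simp: norm_minus_commute)
  qed
  moreover have "c' = c" if "P c'" for c'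
  proof (rule LIMSEQ_unique[OF _ c])
    have "(\<lambda>n. 3 * (1 / real (Suc n))) \<longlonglongrightarrow> 3 * 0"
      using LIMSEQ_inverse_real_of_nat by (intro tendsto_intros) (simp add: inverse_eq_divide)
    then have "(\<lambda>n. 3 * (1 / real (Suc n))) \<longlonglongrightarrow> 0" by simp
    moreover have "cmod (\<mu> (s n) - c') \<le> 3 * (1 / real (Suc n))" for n
      using near[OF that s(1,2)] by (simp add: norm_minus_commute)
    ultimately have "(\<lambda>n. \<mu> (s n) - c') \<longlonglongrightarrow> 0"
      by (rule Lim_null_comparison[OF always_eventually[OF allI], rotated])
    then show "(\<lambda>n. \<mu> (s n)) \<longlonglongrightarrow> c'" by (rule LIM_zero_cancel)
  qed
  ultimately have "cm_integral \<mu> f = c"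
    unfolding cm_integral_def P_def[symmetric] by (rule the_equality)
  with near[OF \<open>P c\<close> \<psi> a] show ?thesis by simp
qed

text \<open>f approximates itself with error 0, because the upper integral of the zero function
  vanishes. Iterated integrals of test functions can therefore be evaluated as plain applications of
  functionals.\<close>

lemma cm_integral_Cc:
  fixes \<mu> :: "('a :: lca_group \<Rightarrow> complex) \<Rightarrow> complex"
  assumes \<mu>: "complex_measure \<mu>" and f: "f \<in> Cc"
  shows "cm_integral \<mu> f = \<mu> f"
proof -
  have "upper_variation_integral \<mu> (\<lambda>x. ennreal (cmod (f x - f x))) \<le> lsc_integral \<mu> (\<lambda>x. 0)"
    by (rule upper_variation_integral_le) auto
  also have "lsc_integral \<mu> (\<lambda>x. 0) \<le> 0"
  proof (unfold lsc_integral_def, rule SUP_least)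
    fix \<phi> :: "'a \<Rightarrow> complex" assume "\<phi> \<in> {\<phi> \<in> Cc. \<forall>x. ennreal (cmod (\<phi> x)) \<le> (0 :: ennreal)}"
    then have "\<phi> = (\<lambda>x. 0)" by auto
    then show "ennreal (cmod (\<mu> \<phi>)) \<le> 0" using complex_measure_zero[OF \<mu>] by simp
  qed
  finally have U: "upper_variation_integral \<mu> (\<lambda>x. ennreal (cmod (f x - f x))) < ennreal e" if "e > 0" for e
    using that by (simp add: le_less_trans)
  then have "cm_integrable \<mu> f" unfolding cm_integrable_def using f by blast
  then have "cmod (cm_integral \<mu> f - \<mu> f) \<le> 3 * a" if "a > 0" for a
    using cm_integral_approx[OF \<mu> _ f U[OF that]] by blast
  from this[of "e / 3" for e] have "cmod (cm_integral \<mu> f - \<mu> f) \<le> 0 + e" if "e > 0" for e using that by simp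
  then have "cmod (cm_integral \<mu> f - \<mu> f) \<le> 0" by (rule field_le_epsilon)
  then show ?thesis by simp
qed

section \<open>Restriction of complex measures\<close>

lemma lsc_integral_mono:
  "(\<And>x. g x \<le> g' x) \<Longrightarrow> lsc_integral \<mu> g \<le> lsc_integral \<mu> g'"
  unfolding lsc_integral_def by (rule SUP_subset_mono) (auto intro: order_trans)

lemma unit_rotation:
  obtains u :: complex where "cmod u = 1" "u * z = complex_of_real (cmod z)"
proof (cases "z = 0")
  case False
  have "cnj (sgn z) * z = complex_of_real (cmod z)"
    using False complex_norm_square[of z]
    by (simp add: sgn_eq field_simps power2_eq_square)
  then show ?thesis using False by (intro that[of "cnj (sgn z)"]) (simp_all add: norm_sgn)
qed (auto intro: that[of 1])

lemma compact_support_dominated: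
  fixes \<phi> :: "'a :: t2_space \<Rightarrow> complex"
  assumes "compact (closure A)" "continuous_on UNIV \<phi>" "\<And>x. cmod (\<phi> x) \<le> B * indicator A x"
  shows "\<phi> \<in> Cc" "x \<notin> closure A \<Longrightarrow> \<phi> x = 0"
proof -
  have "\<phi> x = 0" if "x \<notin> closure A" for x
  proof -
    have "x \<notin> A" using that closure_subset by blast
    then show ?thesis using assms(3)[of x] by simp
  qed
  then show "\<phi> \<in> Cc" "x \<notin> closure A \<Longrightarrow> \<phi> x = 0" using assms by (auto intro: CcI)
qed

text \<open>If \<open>\<phi>\<close> almost attains the supremum defining \<open>|\<mu>|(A)\<close>, then \<open>|\<phi>|\<close> is close to the
  indicator of \<open>A\<close> in \<open>L\<^sup>1(|\<mu>|)\<close>: mass of \<open>|\<mu>|\<close> under \<open>1\<^sub>A - |\<phi>|\<close> could be added to \<open>\<phi>\<close>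
  with the right phase.\<close>

lemma cutoff_single:
  fixes \<mu> :: "('a :: t2_space \<Rightarrow> complex) \<Rightarrow> complex"
  assumes \<mu>: "complex_measure \<mu>" and A: "compact (closure A)" and e: "e > 0"
  obtains \<kappa> :: "'a \<Rightarrow> real" where "continuous_on UNIV \<kappa>" "\<And>x. 0 \<le> \<kappa> x" "\<And>x. \<kappa> x \<le> indicator A x"
    "lsc_integral \<mu> (\<lambda>x. ennreal (indicator A x - \<kappa> x)) \<le> ennreal e"
proof -
  define T where "T = lsc_integral \<mu> (\<lambda>x. ennreal (indicator A x))"
  obtain C where C: "C > 0" "\<And>f B. f \<in> Cc \<Longrightarrow> (\<And>x. x \<notin> closure A \<Longrightarrow> f x = 0) \<Longrightarrow> (\<And>x. cmod (f x) \<le> B) \<Longrightarrow> cmod (\<mu> f) \<le> C * B"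
    using \<mu> A by (rule complex_measure_bound) blast
  \<comment> \<open>Compactness of the closure makes the total variation of A finite, so almost
    attaining the supremum is meaningful.\<close>
  have "T \<le> ennreal C" unfolding T_def lsc_integral_def
  proof (rule SUP_least)
    fix \<phi> :: "'a \<Rightarrow> complex" assume "\<phi> \<in> {\<phi> \<in> Cc. \<forall>x. ennreal (cmod (\<phi> x)) \<le> ennreal (indicator A x)}"
    then have \<phi>: "\<phi> \<in> Cc" "\<And>x. cmod (\<phi> x) \<le> 1 * indicator A x" by auto
    have "cmod (\<phi> x) \<le> 1" for x using \<phi>(2)[of x] by (cases "x \<in> A") auto
    then have "cmod (\<mu> \<phi>) \<le> C * 1"
      using C(2) \<phi>(1) compact_support_dominated(2)[OF A Cc_continuous[OF \<phi>(1)] \<phi>(2)] by blast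
    then show "ennreal (cmod (\<mu> \<phi>)) \<le> ennreal C" by (intro ennreal_leI) simp
  qed
  then obtain t where t: "T = ennreal t" "t \<ge> 0" by (metis ennreal_cases ennreal_neq_top top.extremum_unique)
  have "\<exists>\<phi>\<in>Cc. (\<forall>x. ennreal (cmod (\<phi> x)) \<le> ennreal (indicator A x)) \<and> t - e \<le> cmod (\<mu> \<phi>)"
  proof (cases "t - e \<le> 0")
    case True
    then show ?thesis by (intro bexI[of _ "\<lambda>x. 0"] conjI) (simp, rule order_trans[OF True norm_ge_zero], rule Cc_zero)
  next
    case False
    then have "ennreal (t - e) < T" using t e by (simp add: ennreal_less_iff)
    then show ?thesis unfolding T_def lsc_integral_def less_SUP_iff
      using False by (auto simp: ennreal_less_iff intro: less_imp_le)
  qed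
  then obtain \<phi> where \<phi>: "\<phi> \<in> Cc" "\<And>x. cmod (\<phi> x) \<le> indicator A x" "t - e \<le> cmod (\<mu> \<phi>)" by auto
  have "lsc_integral \<mu> (\<lambda>x. ennreal (indicator A x - cmod (\<phi> x))) \<le> ennreal e"
    unfolding lsc_integral_def
  proof (rule SUP_least)
    fix \<psi> :: "'a \<Rightarrow> complex"
    assume "\<psi> \<in> {\<psi> \<in> Cc. \<forall>x. ennreal (cmod (\<psi> x)) \<le> ennreal (indicator A x - cmod (\<phi> x))}"
    then have \<psi>: "\<psi> \<in> Cc" "\<And>x. cmod (\<psi> x) \<le> indicator A x - cmod (\<phi> x)"
      using \<phi>(2) by (auto simp: ennreal_le_iff)
    \<comment> \<open>The rotations exclude cancellation: the combination has value |\<mu> \<phi>| +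
      |\<mu> \<psi>|, is still dominated by the indicator of A, and so stays below t.\<close>
    obtain u where u: "cmod u = 1" "u * \<mu> \<phi> = complex_of_real (cmod (\<mu> \<phi>))" by (rule unit_rotation)
    obtain v where v: "cmod v = 1" "v * \<mu> \<psi> = complex_of_real (cmod (\<mu> \<psi>))" by (rule unit_rotation)
    have "ennreal (cmod (\<mu> (\<lambda>x. u * \<phi> x + v * \<psi> x))) \<le> T" unfolding T_def
    proof (rule lsc_integral_upper)
      show "(\<lambda>x. u * \<phi> x + v * \<psi> x) \<in> Cc" by (intro Cc_add Cc_cmult \<phi> \<psi>)
      fix x
      have "cmod (u * \<phi> x + v * \<psi> x) \<le> cmod (\<phi> x) + cmod (\<psi> x)"
        using norm_triangle_ineq[of "u * \<phi> x" "v * \<psi> x"] u v by (simp add: norm_mult)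
      then show "ennreal (cmod (u * \<phi> x + v * \<psi> x)) \<le> ennreal (indicator A x)"
        using \<psi>(2)[of x] by (intro ennreal_leI) linarith
    qed
    moreover have "\<mu> (\<lambda>x. u * \<phi> x + v * \<psi> x) = complex_of_real (cmod (\<mu> \<phi>) + cmod (\<mu> \<psi>))"
      using complex_measure_add[OF \<mu> Cc_cmult[OF \<phi>(1)] Cc_cmult[OF \<psi>(1)], of u v] u v
      by (simp add: complex_measure_cmult[OF \<mu>] \<phi>(1) \<psi>(1))
    ultimately have "ennreal (cmod (\<mu> \<phi>) + cmod (\<mu> \<psi>)) \<le> ennreal t"
      unfolding t(1)[symmetric] by (simp only: norm_of_real) simp
    then have "cmod (\<mu> \<psi>) \<le> e" using \<phi>(3) t(2) by (simp add: ennreal_le_iff del: ennreal_plus)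
    then show "ennreal (cmod (\<mu> \<psi>)) \<le> ennreal e" by (rule ennreal_leI)
  qed
  with \<phi> show ?thesis by (intro that[of "\<lambda>x. cmod (\<phi> x)"]) (auto intro: continuous_on_norm Cc_continuous)
qed

text \<open>Enlarging \<kappa> below the indicator only shrinks the defect, so the pointwise maximum
  of cutoffs for single measures serves all of them.\<close>

lemma cutoff:
  fixes M :: "(('a :: t2_space \<Rightarrow> complex) \<Rightarrow> complex) set"
  assumes "finite M" "\<And>\<mu>. \<mu> \<in> M \<Longrightarrow> complex_measure \<mu>" and A: "compact (closure A)" and e: "e > 0"
  shows "\<exists>\<kappa> :: 'a \<Rightarrow> real. continuous_on UNIV \<kappa> \<and> (\<forall>x. 0 \<le> \<kappa> x) \<and> (\<forall>x. \<kappa> x \<le> indicator A x) \<and>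
    (\<forall>\<mu>\<in>M. lsc_integral \<mu> (\<lambda>x. ennreal (indicator A x - \<kappa> x)) \<le> ennreal e)"
  using assms(1,2)
proof (induction M rule: finite_induct)
  case empty
  show ?case by (intro exI[of _ "\<lambda>x. 0"]) simp
next
  case (insert \<nu> M)
  then obtain \<kappa> :: "'a \<Rightarrow> real" where \<kappa>: "continuous_on UNIV \<kappa>" "\<And>x. 0 \<le> \<kappa> x" "\<And>x. \<kappa> x \<le> indicator A x"
    "\<And>\<mu>. \<mu> \<in> M \<Longrightarrow> lsc_integral \<mu> (\<lambda>x. ennreal (indicator A x - \<kappa> x)) \<le> ennreal e" by auto
  have "complex_measure \<nu>" using insert.prems by simp
  then obtain \<kappa>' :: "'a \<Rightarrow> real" where \<kappa>': "continuous_on UNIV \<kappa>'" "\<And>x. 0 \<le> \<kappa>' x" "\<And>x. \<kappa>' x \<le> indicator A x"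
    "lsc_integral \<nu> (\<lambda>x. ennreal (indicator A x - \<kappa>' x)) \<le> ennreal e"
    using A e by (rule cutoff_single) blast
  have "lsc_integral \<mu> (\<lambda>x. ennreal (indicator A x - max (\<kappa> x) (\<kappa>' x))) \<le> ennreal e" if \<mu>: "\<mu> \<in> insert \<nu> M" for \<mu>
  proof (cases "\<mu> = \<nu>")
    case True
    show ?thesis unfolding True
      by (rule order_trans[OF lsc_integral_mono \<kappa>'(4)]) (auto intro!: ennreal_leI)
  next
    case False
    with \<mu> have "\<mu> \<in> M" by simp
    show ?thesis
      by (rule order_trans[OF lsc_integral_mono \<kappa>(4)[OF \<open>\<mu> \<in> M\<close>]]) (auto intro!: ennreal_leI)
  qed
  then show ?case
    using \<kappa>(1-3) \<kappa>'(1-3)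
    by (intro exI[of _ "\<lambda>x. max (\<kappa> x) (\<kappa>' x)"] conjI ballI allI) (auto intro: continuous_on_max simp: le_max_iff_disj)
qed

text \<open>The error is dominated by B * (\<open>indicator A\<close> - \<kappa>), which is lower
  semicontinuous because A is open and \<kappa> vanishes outside A; so this one majorant settles the
  infimum. The factor 2 only makes the inequality strict.\<close>

lemma upper_variation_cutoff:
  fixes \<mu> :: "('a :: t2_space \<Rightarrow> complex) \<Rightarrow> complex" and \<kappa> :: "'a \<Rightarrow> real"
  assumes \<mu>: "complex_measure \<mu>" and A: "open A"
    and \<kappa>: "continuous_on UNIV \<kappa>" "\<And>x. 0 \<le> \<kappa> x" "\<And>x. \<kappa> x \<le> indicator A x"
      "lsc_integral \<mu> (\<lambda>x. ennreal (indicator A x - \<kappa> x)) \<le> ennreal e" "e > 0"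
    and B: "B > 0" "\<And>x. cmod (\<phi> x) \<le> B"
  shows "upper_variation_integral \<mu> (\<lambda>x. ennreal (cmod (indicator A x * \<phi> x - complex_of_real (\<kappa> x) * \<phi> x))) < ennreal (2 * B * e)"
proof -
  let ?g = "\<lambda>x. ennreal (B * (indicator A x - \<kappa> x))"
  have "upper_variation_integral \<mu> (\<lambda>x. ennreal (cmod (indicator A x * \<phi> x - complex_of_real (\<kappa> x) * \<phi> x))) \<le> lsc_integral \<mu> ?g"
  proof (rule upper_variation_integral_le)
    fix c :: ennreal
    have "\<kappa> x = 0" if "x \<notin> A" for x using \<kappa>(2,3)[of x] that by simp
    then have "{x. c < ?g x} = A \<inter> {x. c < ennreal (B * (1 - \<kappa> x))}"
      by (auto simp: indicator_def split: if_splits)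
    moreover have "open {x. c < ennreal (B * (1 - \<kappa> x))}"
      using \<kappa>(1) by (intro open_Collect_less continuous_on_ennreal continuous_intros)
    ultimately show "open {x. c < ?g x}" using A by auto
  next
    fix x
    have "cmod (indicator A x * \<phi> x - complex_of_real (\<kappa> x) * \<phi> x) = cmod (complex_of_real (indicator A x - \<kappa> x) * \<phi> x)"
      by (simp add: algebra_simps indicator_def)
    also have "\<dots> = (indicator A x - \<kappa> x) * cmod (\<phi> x)"
      unfolding norm_mult norm_of_real using \<kappa>(3)[of x] by simp
    also have "\<dots> \<le> (indicator A x - \<kappa> x) * B" using \<kappa>(3)[of x] B(2) by (intro mult_left_mono) auto
    finally show "ennreal (cmod (indicator A x * \<phi> x - complex_of_real (\<kappa> x) * \<phi> x)) \<le> ?g x"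
      by (intro ennreal_leI) (simp add: mult.commute)
  qed
  also have "lsc_integral \<mu> ?g \<le> ennreal (B * e)"
  proof (subst lsc_integral_def, rule SUP_least)
    fix \<psi> :: "'a \<Rightarrow> complex" assume \<psi>: "\<psi> \<in> {\<psi> \<in> Cc. \<forall>x. ennreal (cmod (\<psi> x)) \<le> ?g x}"
    have "ennreal (cmod (\<mu> (\<lambda>x. complex_of_real (1/B) * \<psi> x))) \<le> lsc_integral \<mu> (\<lambda>x. ennreal (indicator A x - \<kappa> x))"
    proof (rule lsc_integral_upper)
      show "(\<lambda>x. complex_of_real (1/B) * \<psi> x) \<in> Cc" using \<psi> by (intro Cc_cmult) simp
      fix x
      have "0 \<le> B * (indicator A x - \<kappa> x)" using B(1) \<kappa>(3)[of x] by simp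
      moreover have "ennreal (cmod (\<psi> x)) \<le> ?g x" using \<psi> by blast
      ultimately have "cmod (\<psi> x) \<le> B * (indicator A x - \<kappa> x)" by (simp only: ennreal_le_iff)
      then show "ennreal (cmod (complex_of_real (1/B) * \<psi> x)) \<le> ennreal (indicator A x - \<kappa> x)"
        using B(1) by (intro ennreal_leI) (simp add: norm_mult norm_divide field_simps)
    qed
    then have "ennreal (cmod (\<mu> (\<lambda>x. complex_of_real (1/B) * \<psi> x))) \<le> ennreal e" using \<kappa>(4) by (rule order_trans)
    then have "cmod (complex_of_real (1/B) * \<mu> \<psi>) \<le> e"
      using \<psi> \<kappa>(5) by (simp only: complex_measure_cmult[OF \<mu>] mem_Collect_eq) (simp add: ennreal_le_iff)
    then show "ennreal (cmod (\<mu> \<psi>)) \<le> ennreal (B * e)"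
      using B(1) by (intro ennreal_leI) (simp add: norm_mult norm_divide field_simps)
  qed
  also have "\<dots> < ennreal (2 * B * e)" using B(1) \<kappa>(5) by (simp add: ennreal_less_iff)
  finally show ?thesis .
qed

text \<open>One cutoff function serves finitely many measures and test functions simultaneously; this is
  what makes restriction additive both in the function and in the measure.\<close>

lemma restrict_cm_cutoff:
  fixes M :: "(('a :: lca_group \<Rightarrow> complex) \<Rightarrow> complex) set"
  assumes M: "finite M" "M \<subseteq> Collect complex_measure" and A: "open A" "compact (closure A)"
    and \<Phi>: "finite \<Phi>" "\<Phi> \<subseteq> Cc" and e: "e > 0"
  shows "\<exists>\<kappa> :: 'a \<Rightarrow> real. continuous_on UNIV \<kappa> \<and> (\<forall>x. 0 \<le> \<kappa> x) \<and> (\<forall>x. \<kappa> x \<le> indicator A x) \<and>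
    (\<forall>\<mu>\<in>M. \<forall>\<phi>\<in>\<Phi>. cmod (restrict_cm \<mu> A \<phi> - \<mu> (\<lambda>x. complex_of_real (\<kappa> x) * \<phi> x)) \<le> e)"
proof -
  have cm: "complex_measure \<mu>" if "\<mu> \<in> M" for \<mu> using that M(2) by blast
  have "\<forall>\<phi>\<in>\<Phi>. \<exists>B>0. \<forall>x. cmod (\<phi> x) \<le> B"
  proof
    fix \<phi> assume "\<phi> \<in> \<Phi>"
    then have "\<phi> \<in> Cc" using \<Phi> by blast
    then obtain B where "B > 0" "\<And>x. cmod (\<phi> x) \<le> B" by (rule Cc_bounded) blast
    then show "\<exists>B>0. \<forall>x. cmod (\<phi> x) \<le> B" by blast
  qed
  then obtain b where b: "\<And>\<phi>. \<phi> \<in> \<Phi> \<Longrightarrow> b \<phi> > 0" "\<And>\<phi> x. \<phi> \<in> \<Phi> \<Longrightarrow> cmod (\<phi> x) \<le> b \<phi>" by metis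
  \<comment> \<open>One bound for all of \<Phi>; the 1 keeps it positive when \<Phi> is
    empty.\<close>
  define B where "B = 1 + sum b \<Phi>"
  have B: "B > 0" unfolding B_def using b(1) by (intro add_pos_nonneg sum_nonneg) (auto intro: less_imp_le)
  have bB: "cmod (\<phi> x) \<le> B" if "\<phi> \<in> \<Phi>" for \<phi> x
  proof -
    have "b \<phi> \<le> sum b \<Phi>" using that \<Phi>(1) b(1) by (intro member_le_sum) (auto intro: less_imp_le)
    then show ?thesis using b(2)[OF that, of x] unfolding B_def by simp
  qed
  have cut: "\<exists>\<kappa> :: 'a \<Rightarrow> real. continuous_on UNIV \<kappa> \<and> (\<forall>x. 0 \<le> \<kappa> x) \<and> (\<forall>x. \<kappa> x \<le> indicator A x) \<and>
      (\<forall>\<mu>\<in>M. \<forall>\<phi>\<in>\<Phi>. upper_variation_integral \<mu> (\<lambda>x. ennreal (cmod (indicator A x * \<phi> x - complex_of_real (\<kappa> x) * \<phi> x))) < ennreal d)"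
    if "d > 0" for d
  proof -
    define d' where "d' = d / (2 * B)"
    have d': "d' > 0" "2 * B * d' = d" unfolding d'_def using that B by auto
    obtain \<kappa> :: "'a \<Rightarrow> real" where \<kappa>: "continuous_on UNIV \<kappa>" "\<And>x. 0 \<le> \<kappa> x" "\<And>x. \<kappa> x \<le> indicator A x"
        "\<And>\<mu>. \<mu> \<in> M \<Longrightarrow> lsc_integral \<mu> (\<lambda>x. ennreal (indicator A x - \<kappa> x)) \<le> ennreal d'"
      using cutoff[OF M(1) cm A(2) d'(1)] by blast
    have "upper_variation_integral \<mu> (\<lambda>x. ennreal (cmod (indicator A x * \<phi> x - complex_of_real (\<kappa> x) * \<phi> x))) < ennreal d"
      if "\<mu> \<in> M" "\<phi> \<in> \<Phi>" for \<mu> \<phi>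
      using upper_variation_cutoff[OF cm[OF that(1)] A(1) \<kappa>(1-3) \<kappa>(4)[OF that(1)] d'(1) B bB[OF that(2)]]
      unfolding d'(2) .
    with \<kappa>(1-3) show ?thesis by blast
  qed
  have Cc: "(\<lambda>x. complex_of_real (\<kappa> x) * \<phi> x) \<in> Cc" if "continuous_on UNIV \<kappa>" "\<phi> \<in> \<Phi>" for \<kappa> :: "'a \<Rightarrow> real" and \<phi>
    using that \<Phi>(2) by (intro Cc_mult_left continuous_on_of_real) auto
  have int: "cm_integrable \<mu> (\<lambda>x. indicator A x * \<phi> x)" if "\<mu> \<in> M" "\<phi> \<in> \<Phi>" for \<mu> \<phi>
    unfolding cm_integrable_def
  proof (intro allI impI)
    fix d :: real assume "d > 0"
    from cut[OF this] that Cc show "\<exists>\<psi>\<in>Cc. upper_variation_integral \<mu> (\<lambda>x. ennreal (cmod (indicator A x * \<phi> x - \<psi> x))) < ennreal d"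
      by meson
  qed
  \<comment> \<open>Compensates the factor 3 of \<open>cm_integral_approx\<close>.\<close>
  have "e / 3 > 0" using e by simp
  from cut[OF this] obtain \<kappa> :: "'a \<Rightarrow> real" where \<kappa>: "continuous_on UNIV \<kappa>" "\<And>x. 0 \<le> \<kappa> x" "\<And>x. \<kappa> x \<le> indicator A x"
      "\<And>\<mu> \<phi>. \<mu> \<in> M \<Longrightarrow> \<phi> \<in> \<Phi> \<Longrightarrow> upper_variation_integral \<mu> (\<lambda>x. ennreal (cmod (indicator A x * \<phi> x - complex_of_real (\<kappa> x) * \<phi> x))) < ennreal (e / 3)"
    by blast
  have "cmod (restrict_cm \<mu> A \<phi> - \<mu> (\<lambda>x. complex_of_real (\<kappa> x) * \<phi> x)) \<le> e" if "\<mu> \<in> M" "\<phi> \<in> \<Phi>" for \<mu> \<phi>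
    unfolding restrict_cm_def
    using cm_integral_approx[OF cm[OF that(1)] int[OF that] Cc[OF \<kappa>(1) that(2)] \<kappa>(4)[OF that]] by simp
  with \<kappa>(1-3) show ?thesis by blast
qed

lemma norm_diff3_le:
  assumes "norm a \<le> e" "norm b \<le> e" "norm c \<le> e" shows "norm (a - b - c) \<le> 3 * e"
  using assms norm_triangle_ineq4[of "a - b" c] norm_triangle_ineq4[of a b] by linarith

lemma norm_diff4_le:
  assumes "norm a \<le> e" "norm b \<le> e" "norm c \<le> e" "norm d \<le> e" shows "norm (a - b - c - d) \<le> 4 * e"
  using assms(4) norm_diff3_le[OF assms(1-3)] norm_triangle_ineq4[of "a - b - c" d] by linarith

lemma cmod_le_epsilon_zero:
  assumes "\<And>e. e > 0 \<Longrightarrow> cmod z \<le> c * e" "c > 0" shows "z = 0"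
proof -
  have "cmod z \<le> 0 + e" if "e > 0" for e using assms(1)[of "e / c"] assms(2) that by simp
  then have "cmod z \<le> 0" by (rule field_le_epsilon)
  then show ?thesis by simp
qed

section \<open>Linearity, boundedness and locality of the restriction of a measure\<close>

context
  fixes A :: "'a :: lca_group set"
  assumes A: "open A" "compact (closure A)"
begin

lemma restrict_cm_add:
  assumes \<mu>: "complex_measure \<mu>" and fg: "f \<in> Cc" "g \<in> Cc"
  shows "restrict_cm \<mu> A (\<lambda>x. f x + g x) = restrict_cm \<mu> A f + restrict_cm \<mu> A g"
proof -
  have "cmod (restrict_cm \<mu> A (\<lambda>x. f x + g x) - (restrict_cm \<mu> A f + restrict_cm \<mu> A g)) \<le> 3 * e" if e: "e > 0" for e
  proof -
    have prem: "finite {\<mu>}" "{\<mu>} \<subseteq> Collect complex_measure" "finite {f, g, \<lambda>x. f x + g x}" "{f, g, \<lambda>x. f x + g x} \<subseteq> Cc"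
      using \<mu> fg Cc_add by auto
    obtain \<kappa> :: "'a \<Rightarrow> real" where \<kappa>: "continuous_on UNIV \<kappa>" "\<forall>x. 0 \<le> \<kappa> x" "\<forall>x. \<kappa> x \<le> indicator A x"
      and ap: "\<forall>\<nu>\<in>{\<mu>}. \<forall>\<phi>\<in>{f, g, \<lambda>x. f x + g x}.
        cmod (restrict_cm \<nu> A \<phi> - \<nu> (\<lambda>x. complex_of_real (\<kappa> x) * \<phi> x)) \<le> e"
      using restrict_cm_cutoff[OF prem(1,2) A prem(3,4) e] by (elim exE conjE) (rule that)
    have "\<mu> (\<lambda>x. complex_of_real (\<kappa> x) * (f x + g x)) = \<mu> (\<lambda>x. complex_of_real (\<kappa> x) * f x) + \<mu> (\<lambda>x. complex_of_real (\<kappa> x) * g x)"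
      unfolding distrib_left using fg \<kappa>(1) by (intro complex_measure_add[OF \<mu>] Cc_mult_left continuous_on_of_real)
    then have eq: "restrict_cm \<mu> A (\<lambda>x. f x + g x) - (restrict_cm \<mu> A f + restrict_cm \<mu> A g) =
      (restrict_cm \<mu> A (\<lambda>x. f x + g x) - \<mu> (\<lambda>x. complex_of_real (\<kappa> x) * (f x + g x)))
      - (restrict_cm \<mu> A f - \<mu> (\<lambda>x. complex_of_real (\<kappa> x) * f x)) - (restrict_cm \<mu> A g - \<mu> (\<lambda>x. complex_of_real (\<kappa> x) * g x))"
      by simp
    have "cmod (restrict_cm \<mu> A \<phi> - \<mu> (\<lambda>x. complex_of_real (\<kappa> x) * \<phi> x)) \<le> e"
      if "\<phi> \<in> {f, g, \<lambda>x. f x + g x}" for \<phi>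
      using ap that by blast
    from this[of f] this[of g] this[of "\<lambda>x. f x + g x"] show ?thesis
      unfolding eq by (intro norm_diff3_le) simp_all
  qed
  then show ?thesis using cmod_le_epsilon_zero[of "restrict_cm \<mu> A (\<lambda>x. f x + g x) - (restrict_cm \<mu> A f + restrict_cm \<mu> A g)" 3] by simp
qed

lemma restrict_cm_cmult:
  assumes \<mu>: "complex_measure \<mu>" and f: "f \<in> Cc"
  shows "restrict_cm \<mu> A (\<lambda>x. c * f x) = c * restrict_cm \<mu> A f"
proof -
  have "cmod (restrict_cm \<mu> A (\<lambda>x. c * f x) - c * restrict_cm \<mu> A f) \<le> (1 + cmod c) * e" if e: "e > 0" for e
  proof -
    have prem: "finite {\<mu>}" "{\<mu>} \<subseteq> Collect complex_measure" "finite {f, \<lambda>x. c * f x}" "{f, \<lambda>x. c * f x} \<subseteq> Cc"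
      using \<mu> f Cc_cmult by auto
    obtain \<kappa> :: "'a \<Rightarrow> real" where \<kappa>: "continuous_on UNIV \<kappa>" "\<forall>x. 0 \<le> \<kappa> x" "\<forall>x. \<kappa> x \<le> indicator A x"
      and ap: "\<forall>\<nu>\<in>{\<mu>}. \<forall>\<phi>\<in>{f, \<lambda>x. c * f x}.
        cmod (restrict_cm \<nu> A \<phi> - \<nu> (\<lambda>x. complex_of_real (\<kappa> x) * \<phi> x)) \<le> e"
      using restrict_cm_cutoff[OF prem(1,2) A prem(3,4) e] by (elim exE conjE) (rule that)
    have "\<mu> (\<lambda>x. complex_of_real (\<kappa> x) * (c * f x)) = c * \<mu> (\<lambda>x. complex_of_real (\<kappa> x) * f x)"
      using complex_measure_cmult[OF \<mu> Cc_mult_left[OF f continuous_on_of_real[OF \<kappa>(1)]], of c] by (simp add: mult.left_commute)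
    then have eq: "restrict_cm \<mu> A (\<lambda>x. c * f x) - c * restrict_cm \<mu> A f =
      (restrict_cm \<mu> A (\<lambda>x. c * f x) - \<mu> (\<lambda>x. complex_of_real (\<kappa> x) * (c * f x)))
      - c * (restrict_cm \<mu> A f - \<mu> (\<lambda>x. complex_of_real (\<kappa> x) * f x))"
      by (simp add: algebra_simps)
    have "cmod (c * (restrict_cm \<mu> A f - \<mu> (\<lambda>x. complex_of_real (\<kappa> x) * f x))) \<le> cmod c * e"
      unfolding norm_mult using ap[rule_format, of \<mu> f] by (intro mult_left_mono) auto
    then show ?thesis unfolding eq
      using ap[rule_format, of \<mu> "\<lambda>x. c * f x"] by (simp add: distrib_right) (smt (verit) norm_triangle_ineq4)
  qed
  then show ?thesis
    using cmod_le_epsilon_zero[of "restrict_cm \<mu> A (\<lambda>x. c * f x) - c * restrict_cm \<mu> A f" "1 + cmod c"]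
    by (simp add: add_pos_nonneg)
qed

text \<open>The assumed identity holds on \<open>Cc\<close>, while the restrictions evaluate
  discontinuous functions. It is applied to the product of f with a cutoff common to all four
  functionals.\<close>

lemma restrict_cm_add3:
  assumes \<mu>: "complex_measure \<mu>" "complex_measure \<mu>1" "complex_measure \<mu>2" "complex_measure \<mu>3"
    and sum: "\<And>\<phi>. \<phi> \<in> Cc \<Longrightarrow> \<mu> \<phi> = \<mu>1 \<phi> + \<mu>2 \<phi> + \<mu>3 \<phi>" and f: "f \<in> Cc"
  shows "restrict_cm \<mu> A f = restrict_cm \<mu>1 A f + restrict_cm \<mu>2 A f + restrict_cm \<mu>3 A f"
proof -
  let ?d = "restrict_cm \<mu> A f - (restrict_cm \<mu>1 A f + restrict_cm \<mu>2 A f + restrict_cm \<mu>3 A f)"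
  have "cmod ?d \<le> 4 * e" if e: "e > 0" for e
  proof -
    have prem: "finite {\<mu>, \<mu>1, \<mu>2, \<mu>3}" "{\<mu>, \<mu>1, \<mu>2, \<mu>3} \<subseteq> Collect complex_measure" "finite {f}" "{f} \<subseteq> Cc"
      using \<mu> f by auto
    obtain \<kappa> :: "'a \<Rightarrow> real" where \<kappa>: "continuous_on UNIV \<kappa>" "\<forall>x. 0 \<le> \<kappa> x" "\<forall>x. \<kappa> x \<le> indicator A x"
      and ap: "\<forall>\<nu>\<in>{\<mu>, \<mu>1, \<mu>2, \<mu>3}. \<forall>\<phi>\<in>{f}.
        cmod (restrict_cm \<nu> A \<phi> - \<nu> (\<lambda>x. complex_of_real (\<kappa> x) * \<phi> x)) \<le> e"
      using restrict_cm_cutoff[OF prem(1,2) A prem(3,4) e] by (elim exE conjE) (rule that)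
    let ?f = "\<lambda>x. complex_of_real (\<kappa> x) * f x"
    have "\<mu> ?f = \<mu>1 ?f + \<mu>2 ?f + \<mu>3 ?f" using f \<kappa>(1) by (intro sum Cc_mult_left continuous_on_of_real)
    then have eq: "?d = (restrict_cm \<mu> A f - \<mu> ?f) - (restrict_cm \<mu>1 A f - \<mu>1 ?f) - (restrict_cm \<mu>2 A f - \<mu>2 ?f) - (restrict_cm \<mu>3 A f - \<mu>3 ?f)"
      by simp
    have "cmod (restrict_cm \<nu> A f - \<nu> ?f) \<le> e" if "\<nu> \<in> {\<mu>, \<mu>1, \<mu>2, \<mu>3}" for \<nu>
      using ap that by blast
    from this[of \<mu>] this[of \<mu>1] this[of \<mu>2] this[of \<mu>3] show ?thesis
      unfolding eq by (intro norm_diff4_le) simp_all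
  qed
  then show ?thesis using cmod_le_epsilon_zero[of ?d 4] by simp
qed

text \<open>Only values on A count, since every cutoff vanishes outside A. The constant is that of
  \<mu> on the closure of A and does not depend on the support of f, so the restriction is a finite
  measure.\<close>

lemma restrict_cm_bound:
  assumes \<mu>: "complex_measure \<mu>"
  obtains C where "C > 0"
    "\<And>f B. f \<in> Cc \<Longrightarrow> 0 \<le> B \<Longrightarrow> (\<And>x. x \<in> A \<Longrightarrow> cmod (f x) \<le> B) \<Longrightarrow> cmod (restrict_cm \<mu> A f) \<le> C * B"
proof -
  obtain C where C: "C > 0" "\<And>f B. f \<in> Cc \<Longrightarrow> (\<And>x. x \<notin> closure A \<Longrightarrow> f x = 0) \<Longrightarrow> (\<And>x. cmod (f x) \<le> B) \<Longrightarrow> cmod (\<mu> f) \<le> C * B"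
    using \<mu> A(2) by (rule complex_measure_bound) blast
  have bound: "cmod (restrict_cm \<mu> A f) \<le> C * B" if f: "f \<in> Cc" "0 \<le> B" "\<And>x. x \<in> A \<Longrightarrow> cmod (f x) \<le> B" for f B
  proof (rule field_le_epsilon)
    fix e :: real assume e: "e > 0"
    have prem: "finite {\<mu>}" "{\<mu>} \<subseteq> Collect complex_measure" "finite {f}" "{f} \<subseteq> Cc"
      using \<mu> f by auto
    obtain \<kappa> :: "'a \<Rightarrow> real" where \<kappa>: "continuous_on UNIV \<kappa>" "\<forall>x. 0 \<le> \<kappa> x" "\<forall>x. \<kappa> x \<le> indicator A x"
      and ap: "\<forall>\<nu>\<in>{\<mu>}. \<forall>\<phi>\<in>{f}.
        cmod (restrict_cm \<nu> A \<phi> - \<nu> (\<lambda>x. complex_of_real (\<kappa> x) * \<phi> x)) \<le> e"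
      using restrict_cm_cutoff[OF prem(1,2) A prem(3,4) e] by (elim exE conjE) (rule that)
    let ?f = "\<lambda>x. complex_of_real (\<kappa> x) * f x"
    have le: "cmod (?f x) \<le> B * indicator A x" for x
    proof (cases "x \<in> A")
      case True
      have "\<kappa> x * cmod (f x) \<le> 1 * B"
        using \<kappa>(2,3)[rule_format, of x] f(3)[OF True] True by (intro mult_mono) auto
      then show ?thesis using True \<kappa>(2)[rule_format, of x] by (simp add: norm_mult)
    next
      case False
      then show ?thesis using \<kappa>(2,3)[rule_format, of x] by simp
    qed
    have cont: "continuous_on UNIV ?f"
      by (intro continuous_on_mult continuous_on_of_real \<kappa>(1) Cc_continuous f(1))
    have "cmod (?f x) \<le> B" for x using le[of x] f(2) by (cases "x \<in> A") auto
    then have "cmod (\<mu> ?f) \<le> C * B"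
      using C(2) compact_support_dominated[OF A(2) cont le] by blast
    then show "cmod (restrict_cm \<mu> A f) \<le> C * B + e"
      using ap[rule_format, of \<mu> f] norm_triangle_ineq[of "restrict_cm \<mu> A f - \<mu> ?f" "\<mu> ?f"] by simp
  qed
  show ?thesis using C(1) bound by (rule that)
qed

lemma complex_measure_restrict_cm:
  assumes \<mu>: "complex_measure \<mu>"
  shows "complex_measure (restrict_cm \<mu> A)"
proof -
  obtain C where C: "C > 0"
    "\<And>f B. f \<in> Cc \<Longrightarrow> 0 \<le> B \<Longrightarrow> (\<And>x. x \<in> A \<Longrightarrow> cmod (f x) \<le> B) \<Longrightarrow> cmod (restrict_cm \<mu> A f) \<le> C * B"
    using \<mu> by (rule restrict_cm_bound) blast
  have "cmod (restrict_cm \<mu> A f) \<le> C * (SUP x. cmod (f x))" if f: "f \<in> Cc" for f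
  proof -
    obtain B where B: "\<And>x. cmod (f x) \<le> B" using f by (rule Cc_bounded) blast
    have le: "cmod (f x) \<le> (SUP x. cmod (f x))" for x
      using B by (intro cSUP_upper bdd_aboveI2) auto
    show ?thesis using le by (intro C(2) f order_trans[OF norm_ge_zero le])
  qed
  then show ?thesis
    unfolding complex_measure_def
    using restrict_cm_add[OF \<mu>] restrict_cm_cmult[OF \<mu>] C(1) by (auto intro!: exI[of _ C])
qed

lemma restrict_cm_eq_0:
  assumes \<mu>: "complex_measure \<mu>" and f: "f \<in> Cc" "\<And>x. x \<in> A \<Longrightarrow> f x = 0"
  shows "restrict_cm \<mu> A f = 0"
proof -
  obtain C where C: "C > 0"
    "\<And>f B. f \<in> Cc \<Longrightarrow> 0 \<le> B \<Longrightarrow> (\<And>x. x \<in> A \<Longrightarrow> cmod (f x) \<le> B) \<Longrightarrow> cmod (restrict_cm \<mu> A f) \<le> C * B"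
    using \<mu> by (rule restrict_cm_bound) blast
  from C(2)[of f 0] f show ?thesis by simp
qed

end

section \<open>Convolution of test functions\<close>

lemma continuous_openI:
  fixes F :: "'a :: topological_space \<Rightarrow> 'b :: metric_space"
  assumes "\<And>x e. e > 0 \<Longrightarrow> \<exists>U. open U \<and> x \<in> U \<and> (\<forall>y\<in>U. dist (F y) (F x) \<le> e)"
  shows "continuous_on UNIV F"
proof -
  have "(F \<longlongrightarrow> F x) (at x)" for x
  proof (rule tendstoI)
    fix e :: real assume "e > 0"
    then have "e / 2 > 0" by simp
    from assms[OF this, of x] obtain U where U: "open U" "x \<in> U" "\<And>y. y \<in> U \<Longrightarrow> dist (F y) (F x) \<le> e / 2"
      by blast
    have "dist (F y) (F x) < e" if "y \<in> U" for y using U(3)[OF that] \<open>e > 0\<close> by linarith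
    with U(1,2) show "\<forall>\<^sub>F y in at x. dist (F y) (F x) < e"
      unfolding eventually_at_topological by blast
  qed
  then show ?thesis by (simp add: continuous_on_def)
qed

lemma compact_plus:
  fixes K L :: "'a :: topological_ab_group_add set"
  assumes "compact K" "compact L"
  shows "compact ((\<lambda>(x, y). x + y) ` (K \<times> L))"
  using assms by (intro compact_continuous_image compact_Times) (auto simp: case_prod_unfold intro!: continuous_intros)

lemma sum_setI:
  fixes s :: "'a :: ab_group_add"
  shows "s - u \<in> K \<Longrightarrow> u \<in> L \<Longrightarrow> s \<in> (\<lambda>(x, y). x + y) ` (K \<times> L)"
  by (rule image_eqI[of _ _ "(s - u, u)"]) auto

text \<open>Near u0 all translates vanish off the compact set K + C, with C a compact neighbourhood
  of u0; on that set uniformity in s follows from continuity on a product with a compact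
  factor.\<close>

lemma Cc_uniform:
  fixes k :: "'a :: lca_group \<Rightarrow> complex"
  assumes k: "k \<in> Cc" and e: "e > 0"
  obtains U S where "open U" "u0 \<in> U" "compact S" "\<And>u s. u \<in> U \<Longrightarrow> cmod (k (s - u) - k (s - u0)) \<le> e"
    "\<And>u s. u \<in> U \<Longrightarrow> s \<notin> S \<Longrightarrow> k (s - u) = 0"
proof -
  obtain K where K: "compact K" "\<And>x. x \<notin> K \<Longrightarrow> k x = 0" using k by (rule CcE) blast
  obtain W C where W: "open W" "u0 \<in> W" "W \<subseteq> C" "compact C" using locally_compact by blast
  define S where "S = (\<lambda>(x, y). x + y) ` (K \<times> C)"
  have S: "compact S" unfolding S_def by (rule compact_plus[OF K(1) W(4)])
  have z: "k (s - u) = 0" if "u \<in> C" "s \<notin> S" for u s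
    using K(2) sum_setI[of s u K C] that unfolding S_def by blast
  have "continuous_on (UNIV \<times> S) (\<lambda>(u, s). k (s - u))" unfolding case_prod_unfold
    by (rule continuous_on_compose2[OF Cc_continuous[OF k, of UNIV]]) (auto intro!: continuous_intros)
  then obtain X where X: "u0 \<in> X" "open X"
      "\<forall>u\<in>X \<inter> UNIV. \<forall>s\<in>S. dist ((\<lambda>(u, s). k (s - u)) (u, s)) ((\<lambda>(u, s). k (s - u)) (u0, s)) \<le> e"
    by (rule continuous_on_prod_compactE[OF _ S UNIV_I e])
  show ?thesis
  proof (rule that[of "X \<inter> W" S])
    show "cmod (k (s - u) - k (s - u0)) \<le> e" if "u \<in> X \<inter> W" for u s
    proof (cases "s \<in> S")
      case True
      then show ?thesis using X(3) that by (auto simp: dist_norm)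
    next
      case False
      then have "k (s - u) = 0" "k (s - u0) = 0" using z that W(2,3) by blast+
      then show ?thesis using e by simp
    qed
    show "k (s - u) = 0" if "u \<in> X \<inter> W" "s \<notin> S" for u s using z that W(3) by blast
  qed (use X W S in auto)
qed

lemma continuous_complex_measure_shift:
  fixes k :: "'a :: lca_group \<Rightarrow> complex"
  assumes \<mu>: "complex_measure \<mu>" and k: "k \<in> Cc"
  shows "continuous_on UNIV (\<lambda>u. \<mu> (\<lambda>s. k (s - u)))"
proof (rule continuous_openI)
  fix u0 :: 'a and e :: real assume e: "e > 0"
  \<comment> \<open>The constant C of \<mu> depends on the common support S, so S is fixed first,
    with the arbitrary tolerance 1; the tolerance e / C can be chosen only afterwards.\<close>
  obtain U0 S where S: "open U0" "u0 \<in> U0" "compact S" "\<And>u s. u \<in> U0 \<Longrightarrow> s \<notin> S \<Longrightarrow> k (s - u) = 0"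
    using k zero_less_one by (rule Cc_uniform[of k 1 u0]) blast
  obtain C where C: "C > 0" "\<And>f B. f \<in> Cc \<Longrightarrow> (\<And>x. x \<notin> S \<Longrightarrow> f x = 0) \<Longrightarrow> (\<And>x. cmod (f x) \<le> B) \<Longrightarrow> cmod (\<mu> f) \<le> C * B"
    using \<mu> S(3) by (rule complex_measure_bound) blast
  have "e / C > 0" using e C(1) by simp
  with k obtain U where U: "open U" "u0 \<in> U" "\<And>u s. u \<in> U \<Longrightarrow> cmod (k (s - u) - k (s - u0)) \<le> e / C"
    by (rule Cc_uniform[of k "e / C" u0]) blast
  have "dist (\<mu> (\<lambda>s. k (s - u))) (\<mu> (\<lambda>s. k (s - u0))) \<le> e" if "u \<in> U0 \<inter> U" for u
  proof -
    have "cmod (\<mu> (\<lambda>s. k (s - u) - k (s - u0))) \<le> C * (e / C)"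
      using that S U by (intro C(2) Cc_diff Cc_shift k) auto
    then show ?thesis
      using C(1) by (simp add: dist_norm complex_measure_diff[OF \<mu> Cc_shift[OF k] Cc_shift[OF k]])
  qed
  then show "\<exists>U. open U \<and> u0 \<in> U \<and> (\<forall>u\<in>U. dist (\<mu> (\<lambda>s. k (s - u))) (\<mu> (\<lambda>s. k (s - u0))) \<le> e)"
    using S U by (intro exI[of _ "U0 \<inter> U"]) auto
qed

lemma radon_sets: "radon_measure M \<Longrightarrow> sets M = sets borel"
  and radon_compact: "radon_measure M \<Longrightarrow> compact K \<Longrightarrow> emeasure M K < \<infinity>"
  unfolding radon_measure_def by auto

lemma radon_continuous_measurable:
  fixes f :: "'a :: topological_space \<Rightarrow> 'b :: topological_space"
  assumes "radon_measure h" "continuous_on UNIV f"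
  shows "f \<in> borel_measurable h"
  using borel_measurable_continuous_onI[OF assms(2)] measurable_cong_sets[OF radon_sets[OF assms(1)] refl] by blast

lemma integrable_Cc:
  fixes f :: "'a :: t2_space \<Rightarrow> complex"
  assumes h: "radon_measure h" and f: "f \<in> Cc"
  shows "integrable h f"
proof -
  obtain K where K: "compact K" "\<And>x. x \<notin> K \<Longrightarrow> f x = 0" using f by (rule CcE) blast
  obtain B where B: "\<And>x. cmod (f x) \<le> B" using f by (rule Cc_bounded) blast
  show ?thesis
  proof (rule integrableI_bounded_set[of K])
    show "K \<in> sets h" using K(1) radon_sets[OF h] by (auto intro: borel_closed compact_imp_closed)
    show "f \<in> borel_measurable h" by (rule radon_continuous_measurable[OF h Cc_continuous[OF f]])
    show "emeasure h K < \<infinity>" by (rule radon_compact[OF h K(1)])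
  qed (use K B in auto)
qed

lemma haar_radon: "haar_measure h \<Longrightarrow> radon_measure h"
  unfolding haar_measure_def by blast

lemma haar_integral_shift:
  fixes f :: "'a :: lca_group \<Rightarrow> complex"
  assumes h: "haar_measure h" and f: "continuous_on UNIV f"
  shows "(\<integral>x. f (x + t) \<partial>h) = (\<integral>x. f x \<partial>h)"
proof -
  have s: "sets h = sets borel" by (rule radon_sets[OF haar_radon[OF h]])
  have sp: "space h = UNIV" using sets_eq_imp_space_eq[OF s] by simp
  have m: "(\<lambda>x. x + t) \<in> measurable h h"
    unfolding measurable_cong_sets[OF s s] by (intro borel_measurable_continuous_onI continuous_intros)
  have "distr h h (\<lambda>x. x + t) = h"
  proof (rule measure_eqI)
    fix B assume "B \<in> sets (distr h h (\<lambda>x. x + t))"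
    then have B: "B \<in> sets h" by simp
    have "emeasure (distr h h (\<lambda>x. x + t)) B = emeasure h ((\<lambda>x. x + t) -` B)"
      using emeasure_distr[OF m B] sp by simp
    also have "(\<lambda>x. x + t) -` B = (+) (- t) ` B"
      by (auto simp: image_iff intro!: bexI[of _ "_ + t"])
    also have "emeasure h ((+) (- t) ` B) = emeasure h B"
      using h B s unfolding haar_measure_def by blast
    finally show "emeasure (distr h h (\<lambda>x. x + t)) B = emeasure h B" .
  qed simp
  then show ?thesis
    using integral_distr[OF m radon_continuous_measurable[OF haar_radon[OF h] f]] by simp
qed

lemma norm_integral_le_integral:
  fixes f :: "'a \<Rightarrow> 'b :: {banach, second_countable_topology}"
  assumes "integrable M f" "integrable M g" "\<And>x. norm (f x) \<le> g x"
  shows "norm (\<integral>x. f x \<partial>M) \<le> (\<integral>x. g x \<partial>M)"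
  by (rule order_trans[OF integral_norm_bound Bochner_Integration.integral_mono[OF integrable_norm]])
    (use assms in auto)

text \<open>A Riemann sum with weight g: g is integrated exactly over each cell and only the factor
  a is frozen at b j. The exchange of integrals below uses it twice with the same cells, before and
  after \<mu> is applied.\<close>

lemma integral_step_approx:
  fixes n :: nat and a g :: "'a \<Rightarrow> complex"
  assumes g: "integrable h g" and ag: "integrable h (\<lambda>u. a u * g u)"
    and D: "\<And>j. j < n \<Longrightarrow> D j \<in> sets h" "disjoint_family_on D {..<n}" "\<And>u. g u \<noteq> 0 \<Longrightarrow> \<exists>j<n. u \<in> D j"
    and a: "\<And>j u. j < n \<Longrightarrow> u \<in> D j \<Longrightarrow> cmod (a u - b j) \<le> e"
  shows "cmod ((\<integral>u. a u * g u \<partial>h) - (\<Sum>j<n. b j * (\<integral>u. indicator (D j) u *\<^sub>R g u \<partial>h))) \<le> e * (\<integral>u. cmod (g u) \<partial>h)"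
proof -
  have int: "integrable h (\<lambda>u. b j * indicator (D j) u *\<^sub>R g u)" if "j < n" for j
    using integrable_mult_right[OF integrable_mult_indicator[OF D(1)[OF that] g], of "b j"] by simp
  have "(\<integral>u. a u * g u \<partial>h) - (\<Sum>j<n. b j * (\<integral>u. indicator (D j) u *\<^sub>R g u \<partial>h)) =
      (\<integral>u. a u * g u - (\<Sum>j<n. b j * indicator (D j) u *\<^sub>R g u) \<partial>h)"
  proof -
    have "(\<integral>u. (\<Sum>j<n. b j * indicator (D j) u *\<^sub>R g u) \<partial>h) = (\<Sum>j<n. (\<integral>u. b j * indicator (D j) u *\<^sub>R g u \<partial>h))"
      by (rule Bochner_Integration.integral_sum) (use int in auto)
    also have "\<dots> = (\<Sum>j<n. b j * (\<integral>u. indicator (D j) u *\<^sub>R g u \<partial>h))"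
      by (intro sum.cong refl integral_mult_right_zero)
    finally show ?thesis
      using Bochner_Integration.integral_diff[OF ag Bochner_Integration.integrable_sum[of "{..<n}" h "\<lambda>j u. b j * indicator (D j) u *\<^sub>R g u"]] int
      by simp
  qed
  also have "cmod \<dots> \<le> (\<integral>u. e * cmod (g u) \<partial>h)"
  proof (rule norm_integral_le_integral)
    show "integrable h (\<lambda>u. a u * g u - (\<Sum>j<n. b j * indicator (D j) u *\<^sub>R g u))"
      using int ag by (intro Bochner_Integration.integrable_diff Bochner_Integration.integrable_sum) auto
    show "integrable h (\<lambda>u. e * cmod (g u))" using g by simp
    fix u
    show "cmod (a u * g u - (\<Sum>j<n. b j * indicator (D j) u *\<^sub>R g u)) \<le> e * cmod (g u)"
    proof (cases "g u = 0")
      case False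
      then obtain j where j: "j < n" "u \<in> D j" using D(3) by blast
      have "u \<notin> D i" if "i < n" "i \<noteq> j" for i
        using D(2) that j unfolding disjoint_family_on_def by blast
      then have "(\<Sum>i<n. b i * indicator (D i) u *\<^sub>R g u) = (\<Sum>i<n. if i = j then b j * g u else 0)"
        using j by (intro sum.cong) (auto simp: indicator_def)
      also have "\<dots> = b j * g u" using j(1) by (subst sum.delta) auto
      finally have "a u * g u - (\<Sum>i<n. b i * indicator (D i) u *\<^sub>R g u) = (a u - b j) * g u"
        by (simp add: algebra_simps)
      then show ?thesis using a[OF j] by (simp add: norm_mult mult_right_mono)
    qed simp
  qed
  finally show ?thesis by simp
qed

lemma Cc_conv:
  fixes k g :: "'a :: lca_group \<Rightarrow> complex"
  assumes h: "radon_measure h" and k: "k \<in> Cc" and g: "g \<in> Cc"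
  shows "(\<lambda>s. \<integral>u. k (s - u) * g u \<partial>h) \<in> Cc"
proof -
  obtain K where K: "compact K" "\<And>x. x \<notin> K \<Longrightarrow> k x = 0" using k by (rule CcE) blast
  obtain L where L: "compact L" "\<And>x. x \<notin> L \<Longrightarrow> g x = 0" using g by (rule CcE) blast
  define G where "G = (\<integral>u. cmod (g u) \<partial>h) + 1"
  have G: "G > 0" unfolding G_def by (intro add_nonneg_pos Bochner_Integration.integral_nonneg) auto
  \<comment> \<open>Reflecting k makes s the translated variable: k (s - u) is the reflected
    function at u - s.\<close>
  have k': "(\<lambda>x. k (0 - x)) \<in> Cc" by (rule Cc_minus_arg[OF k])
  have int: "integrable h (\<lambda>u. k (s - u) * g u)" for s
    by (rule integrable_Cc[OF h Cc_mult_left[OF g Cc_continuous[OF Cc_minus_arg[OF k]]]])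
  have gn: "integrable h (\<lambda>u. cmod (g u))" using integrable_Cc[OF h g] by simp
  have "continuous_on UNIV (\<lambda>s. \<integral>u. k (s - u) * g u \<partial>h)"
  proof (rule continuous_openI)
    fix s0 :: 'a and e :: real assume "e > 0"
    then have "e / G > 0" using G by simp
    with k' obtain U where U: "open U" "s0 \<in> U"
      "\<And>s u. s \<in> U \<Longrightarrow> cmod (k (0 - (u - s)) - k (0 - (u - s0))) \<le> e / G"
      by (rule Cc_uniform[of _ "e / G" s0]) blast
    have "dist (\<integral>u. k (s - u) * g u \<partial>h) (\<integral>u. k (s0 - u) * g u \<partial>h) \<le> e" if "s \<in> U" for s
    proof -
      have "(\<integral>u. k (s - u) * g u \<partial>h) - (\<integral>u. k (s0 - u) * g u \<partial>h) = (\<integral>u. (k (s - u) - k (s0 - u)) * g u \<partial>h)"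
        using int by (simp add: left_diff_distrib)
      also have "cmod \<dots> \<le> (\<integral>u. (e / G) * cmod (g u) \<partial>h)"
      proof (rule norm_integral_le_integral)
        show "integrable h (\<lambda>u. (k (s - u) - k (s0 - u)) * g u)"
          using int by (simp add: left_diff_distrib)
        show "integrable h (\<lambda>u. (e / G) * cmod (g u))" using gn by simp
        show "cmod ((k (s - u) - k (s0 - u)) * g u) \<le> (e / G) * cmod (g u)" for u
          using U(3)[OF that, of u] unfolding norm_mult by (intro mult_right_mono) auto
      qed
      also have "\<dots> = (e / G) * (\<integral>u. cmod (g u) \<partial>h)" by simp
      also have "\<dots> \<le> (e / G) * G" unfolding G_def using \<open>e / G > 0\<close>
        by (intro mult_left_mono) (auto simp: G_def)
      finally show ?thesis using G by (simp add: dist_norm)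
    qed
    with U(1,2) show "\<exists>U. open U \<and> s0 \<in> U \<and> (\<forall>s\<in>U. dist (\<integral>u. k (s - u) * g u \<partial>h) (\<integral>u. k (s0 - u) * g u \<partial>h) \<le> e)"
      by blast
  qed
  moreover have "(\<integral>u. k (s - u) * g u \<partial>h) = 0" if s: "s \<notin> (\<lambda>(x, y). x + y) ` (K \<times> L)" for s
  proof -
    have "(\<lambda>u. k (s - u) * g u) = (\<lambda>u. 0)"
      using s sum_setI[of s _ K L] K(2)[of "s - _"] L(2) by (intro ext) (metis mult_eq_0_iff)
    then show ?thesis by simp
  qed
  ultimately show ?thesis by (rule CcI[OF _ compact_plus[OF K(1) L(1)]])
qed

text \<open>No product measure is available here (\<open>h\<close> need not be \<open>\<sigma>\<close>-finite and \<open>\<mu>\<close> is only a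
  functional), so the inner integral is approximated by Riemann sums uniformly in the outer variable.\<close>

lemma complex_measure_integral_swap:
  fixes k g :: "'a :: lca_group \<Rightarrow> complex"
  assumes h: "radon_measure h" and \<mu>: "complex_measure \<mu>" and k: "k \<in> Cc" and g: "g \<in> Cc"
  shows "\<mu> (\<lambda>s. \<integral>u. k (s - u) * g u \<partial>h) = (\<integral>u. \<mu> (\<lambda>s. k (s - u)) * g u \<partial>h)"
proof -
  obtain K where K: "compact K" "\<And>x. x \<notin> K \<Longrightarrow> k x = 0" using k by (rule CcE) blast
  obtain L where L: "compact L" "\<And>x. x \<notin> L \<Longrightarrow> g x = 0" using g by (rule CcE) blast
  define S where "S = (\<lambda>(x, y). x + y) ` (K \<times> L)"
  have S: "compact S" unfolding S_def by (rule compact_plus[OF K(1) L(1)])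
  have z: "k (s - u) = 0" if "u \<in> L" "s \<notin> S" for u s
    using K(2) sum_setI[of s u K L] that unfolding S_def by blast
  obtain C where C: "C > 0" "\<And>f B. f \<in> Cc \<Longrightarrow> (\<And>x. x \<notin> S \<Longrightarrow> f x = 0) \<Longrightarrow> (\<And>x. cmod (f x) \<le> B) \<Longrightarrow> cmod (\<mu> f) \<le> C * B"
    using \<mu> S by (rule complex_measure_bound) blast
  define G where "G = (\<integral>u. cmod (g u) \<partial>h)"
  have G: "G \<ge> 0" unfolding G_def by (intro Bochner_Integration.integral_nonneg) auto
  have ig: "integrable h g" by (rule integrable_Cc[OF h g])
  have int1: "integrable h (\<lambda>u. k (s - u) * g u)" for s
    by (rule integrable_Cc[OF h Cc_mult_left[OF g Cc_continuous[OF Cc_minus_arg[OF k]]]])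
  have int2: "integrable h (\<lambda>u. \<mu> (\<lambda>s. k (s - u)) * g u)"
    by (rule integrable_Cc[OF h Cc_mult_left[OF g continuous_complex_measure_shift[OF \<mu> k]]])
  let ?F = "\<lambda>s. \<integral>u. k (s - u) * g u \<partial>h"
  have F: "?F \<in> Cc" by (rule Cc_conv[OF h k g])
  have "cmod (\<mu> ?F - (\<integral>u. \<mu> (\<lambda>s. k (s - u)) * g u \<partial>h)) \<le> (2 * C * G + 1) * e" if e: "e > 0" for e
  proof -
    have "\<forall>u0. \<exists>U. open U \<and> u0 \<in> U \<and> (\<forall>u\<in>U. \<forall>s. cmod (k (s - u) - k (s - u0)) \<le> e)"
    proof
      fix u0
      obtain U where "open U" "u0 \<in> U" "\<And>u s. u \<in> U \<Longrightarrow> cmod (k (s - u) - k (s - u0)) \<le> e"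
        using k e by (rule Cc_uniform[of k e u0]) blast
      then show "\<exists>U. open U \<and> u0 \<in> U \<and> (\<forall>u\<in>U. \<forall>s. cmod (k (s - u) - k (s - u0)) \<le> e)" by blast
    qed
    then obtain V where V: "\<And>u0. open (V u0)" "\<And>u0. u0 \<in> V u0"
      "\<And>u0 u s. u \<in> V u0 \<Longrightarrow> cmod (k (s - u) - k (s - u0)) \<le> e" by metis
    have "L \<subseteq> (\<Union>u\<in>L. V u)" using V(2) by blast
    then obtain P where P: "P \<subseteq> L" "finite P" "L \<subseteq> (\<Union>u\<in>P. V u)"
      by (rule compactE_image[OF L(1) V(1)])
    obtain n :: nat and p where p: "P = p ` {i. i < n}"
      using finite_imp_nat_seg_image_inj_on[OF P(2)] by blast
    \<comment> \<open>Disjoint Borel cells from a finite subcover of L: on the cell of index j, k (s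
      - u) differs from k (s - p j) by at most e, uniformly in s.\<close>
    define D where "D = (\<lambda>j. disjointed (\<lambda>j. V (p j)) j \<inter> L)"
    have D1: "D j \<in> sets h" for j
    proof -
      have "range (disjointed (\<lambda>j. V (p j))) \<subseteq> sets borel"
        by (intro sets.range_disjointed_sets) (use V(1) in auto)
      then have "disjointed (\<lambda>j. V (p j)) j \<in> sets borel" by blast
      moreover have "L \<in> sets borel" by (rule borel_closed[OF compact_imp_closed[OF L(1)]])
      ultimately show ?thesis unfolding D_def radon_sets[OF h] by (rule sets.Int)
    qed
    have D2: "disjoint_family_on D {..<n}"
      using disjoint_family_disjointed[of "\<lambda>j. V (p j)"] unfolding disjoint_family_on_def D_def by blast
    have D3: "\<exists>j<n. u \<in> D j" if "g u \<noteq> 0" for u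
    proof -
      have u: "u \<in> L" using L(2) that by blast
      then obtain i where "i < n" "u \<in> V (p i)" using P(3) unfolding p by blast
      then have "u \<in> (\<Union>i\<in>{0..<n}. V (p i))" by auto
      then have "u \<in> (\<Union>i\<in>{0..<n}. disjointed (\<lambda>j. V (p j)) i)" by (simp only: finite_UN_disjointed_eq)
      then obtain j where "j \<in> {0..<n}" "u \<in> disjointed (\<lambda>j. V (p j)) j" by (rule UN_E)
      then show ?thesis unfolding D_def using u by (intro exI[of _ j]) simp
    qed
    have D4: "u \<in> L" "u \<in> V (p j)" if "u \<in> D j" for u j
      using that disjointed_subset[of "\<lambda>j. V (p j)" j] unfolding D_def by auto
    have pL: "p j \<in> L" if "j < n" for j using P(1) p that by blast
    define c where "c j = (\<integral>u. indicator (D j) u *\<^sub>R g u \<partial>h)" for j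
    \<comment> \<open>A finite combination of translates of k, so \<mu> passes through by linearity.
      It is compared with the inner integral before \<mu> is applied, and with the outer integral
      after.\<close>
    define T where "T s = (\<Sum>j<n. k (s - p j) * c j)" for s
    have T: "T \<in> Cc" unfolding T_def by (intro Cc_sum Cc_mult_right Cc_shift k continuous_on_const)
    have \<mu>T: "\<mu> T = (\<Sum>j<n. \<mu> (\<lambda>s. k (s - p j)) * c j)"
    proof -
      have "\<mu> T = (\<Sum>j<n. \<mu> (\<lambda>s. k (s - p j) * c j))"
        unfolding T_def by (intro complex_measure_sum[OF \<mu>] Cc_mult_right Cc_shift k continuous_on_const)
      then show ?thesis
        using complex_measure_cmult[OF \<mu> Cc_shift[OF k]] by (simp add: mult.commute)
    qed
    have FT: "cmod (?F s - T s) \<le> e * G" for s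
      unfolding T_def c_def G_def
      by (rule integral_step_approx[OF ig int1 D1 D2 D3]) (use V(3) D4 in auto)
    have FT0: "?F s - T s = 0" if s: "s \<notin> S" for s
    proof -
      have "(\<lambda>u. k (s - u) * g u) = (\<lambda>u. 0)" using z[of _ s] s L(2) by force
      then show ?thesis unfolding T_def using z[OF pL s] by simp
    qed
    have "cmod (\<mu> (\<lambda>s. ?F s - T s)) \<le> C * (e * G)" by (rule C(2)[OF Cc_diff[OF F T] FT0 FT])
    then have 1: "cmod (\<mu> ?F - \<mu> T) \<le> C * (e * G)" by (simp only: complex_measure_diff[OF \<mu> F T])
    have step: "cmod (\<mu> (\<lambda>s. k (s - u)) - \<mu> (\<lambda>s. k (s - p j))) \<le> C * e" if "j < n" "u \<in> D j" for u j
    proof -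
      have "cmod (\<mu> (\<lambda>s. k (s - u) - k (s - p j))) \<le> C * e"
        using that by (intro C(2) Cc_diff Cc_shift k V(3) D4) (auto simp: z[OF pL] z[OF D4(1)])
      then show ?thesis by (simp only: complex_measure_diff[OF \<mu> Cc_shift[OF k] Cc_shift[OF k]])
    qed
    have 2: "cmod ((\<integral>u. \<mu> (\<lambda>s. k (s - u)) * g u \<partial>h) - \<mu> T) \<le> C * e * G"
      unfolding \<mu>T c_def G_def by (rule integral_step_approx[OF ig int2 D1 D2 D3 step])
    have "cmod (\<mu> ?F - (\<integral>u. \<mu> (\<lambda>s. k (s - u)) * g u \<partial>h)) \<le> C * (e * G) + C * e * G"
    proof -
      have "cmod (\<mu> ?F - (\<integral>u. \<mu> (\<lambda>s. k (s - u)) * g u \<partial>h)) \<le> cmod (\<mu> ?F - \<mu> T) + cmod ((\<integral>u. \<mu> (\<lambda>s. k (s - u)) * g u \<partial>h) - \<mu> T)"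
        using norm_triangle_ineq4[of "\<mu> ?F - \<mu> T" "(\<integral>u. \<mu> (\<lambda>s. k (s - u)) * g u \<partial>h) - \<mu> T"] by simp
      then show ?thesis using 1 2 by linarith
    qed
    also have "\<dots> \<le> (2 * C * G + 1) * e" using e by (simp add: algebra_simps)
    finally show ?thesis .
  qed
  then have "\<mu> ?F - (\<integral>u. \<mu> (\<lambda>s. k (s - u)) * g u \<partial>h) = 0"
    by (rule cmod_le_epsilon_zero) (use C(1) G in \<open>auto intro!: add_nonneg_pos\<close>)
  then show ?thesis by simp
qed

section \<open>Square-integrable functions and restricted convolutions\<close>

text \<open>The right side of the assumption is minimised at t = sqrt y / sqrt x. If x = 0 or y = 0,
  t tends to infinity or to 0 instead.\<close>

lemma le_sqrt_mult_sqrtI: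
  fixes p x y :: real
  assumes "\<And>t. t > 0 \<Longrightarrow> 2 * p \<le> t * x + y / t" "x \<ge> 0" "y \<ge> 0"
  shows "p \<le> sqrt x * sqrt y"
proof -
  consider "x = 0" | "y = 0" | "x > 0" "y > 0" using assms by fastforce
  then show ?thesis
  proof cases
    case 1
    have "p \<le> 0 + e" if "e > 0" for e
    proof -
      have "(y + 1) / e > 0" using that assms(3) by simp
      from assms(1)[OF this] have "2 * p \<le> y * e / (y + 1)" using 1 that by (simp add: field_simps)
      also have "\<dots> \<le> e" using assms(3) that by (simp add: field_simps)
      finally show ?thesis using that by simp
    qed
    then have "p \<le> 0" by (rule field_le_epsilon)
    then show ?thesis using 1 by simp
  next
    case 2
    have "p \<le> 0 + e" if "e > 0" for e
    proof -
      have "e / (x + 1) > 0" using that assms(2) by simp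
      from assms(1)[OF this] have "2 * p \<le> x * e / (x + 1)" using 2 that by (simp add: field_simps)
      also have "\<dots> \<le> e" using assms(2) that by (simp add: field_simps)
      finally show ?thesis using that by simp
    qed
    then have "p \<le> 0" by (rule field_le_epsilon)
    then show ?thesis using 2 by simp
  next
    case 3
    then have "sqrt y / sqrt x > 0" by simp
    from assms(1)[OF this] have "2 * p \<le> sqrt y / sqrt x * x + y / (sqrt y / sqrt x)" .
    also have "sqrt y / sqrt x * x = sqrt x * sqrt y" using 3 real_sqrt_mult_self[of x] by (simp add: field_simps)
    also have "y / (sqrt y / sqrt x) = sqrt x * sqrt y" using 3 real_sqrt_mult_self[of y] by (simp add: field_simps)
    finally show ?thesis by simp
  qed
qed

definition sq_integrable :: "'a measure \<Rightarrow> ('a \<Rightarrow> complex) \<Rightarrow> bool" where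
  "sq_integrable M f \<longleftrightarrow> f \<in> borel_measurable M \<and> integrable M (\<lambda>x. (cmod (f x))\<^sup>2)"

definition L2norm :: "'a measure \<Rightarrow> ('a \<Rightarrow> complex) \<Rightarrow> real" where
  "L2norm M f = sqrt (\<integral>x. (cmod (f x))\<^sup>2 \<partial>M)"

lemma L2norm_nonneg: "0 \<le> L2norm M f"
  unfolding L2norm_def by simp

lemma L2norm_sq: "(L2norm M f)\<^sup>2 = (\<integral>x. (cmod (f x))\<^sup>2 \<partial>M)"
  unfolding L2norm_def by simp

lemma integrable_mult_cnj:
  assumes "sq_integrable M f" "sq_integrable M g"
  shows "integrable M (\<lambda>x. f x * cnj (g x))"
proof (rule Bochner_Integration.integrable_bound)
  show "integrable M (\<lambda>x. (cmod (f x))\<^sup>2 + (cmod (g x))\<^sup>2)"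
    using assms unfolding sq_integrable_def by simp
  have [measurable]: "f \<in> borel_measurable M" "g \<in> borel_measurable M"
    using assms unfolding sq_integrable_def by auto
  show "(\<lambda>x. f x * cnj (g x)) \<in> borel_measurable M"
    by (intro borel_measurable_times borel_measurable_continuous_on[OF continuous_on_cnj[OF continuous_on_id]]) measurable
  have "cmod a * cmod b \<le> (cmod a)\<^sup>2 + (cmod b)\<^sup>2" for a b :: complex
    using sum_squares_bound[of "cmod a" "cmod b"] mult_nonneg_nonneg[OF norm_ge_zero[of a] norm_ge_zero[of b]] by linarith
  then show "AE x in M. norm (f x * cnj (g x)) \<le> norm ((cmod (f x))\<^sup>2 + (cmod (g x))\<^sup>2)"
    by (simp add: norm_mult)
qed

text \<open>Integrates the weighted inequality 2 |f| |g| \<le> t |f|^2 + |g|^2 / t and optimises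
  over t, so that no norm has to be divided by.\<close>

lemma integral_Cauchy_Schwarz:
  assumes f: "sq_integrable M f" and g: "sq_integrable M g"
  shows "cmod (\<integral>x. f x * cnj (g x) \<partial>M) \<le> L2norm M f * L2norm M g"
  unfolding L2norm_def
proof (rule le_sqrt_mult_sqrtI)
  fix t :: real assume t: "t > 0"
  have "cmod (\<integral>x. f x * cnj (g x) \<partial>M) \<le> (\<integral>x. (t * (cmod (f x))\<^sup>2 + (cmod (g x))\<^sup>2 / t) / 2 \<partial>M)"
  proof (rule norm_integral_le_integral)
    show "integrable M (\<lambda>x. f x * cnj (g x))" by (rule integrable_mult_cnj[OF f g])
    show "integrable M (\<lambda>x. (t * (cmod (f x))\<^sup>2 + (cmod (g x))\<^sup>2 / t) / 2)"
      using f g unfolding sq_integrable_def by simp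
    fix x
    have "0 \<le> (t * cmod (f x) - cmod (g x))\<^sup>2 / t" using t by simp
    also have "\<dots> = t * (cmod (f x))\<^sup>2 + (cmod (g x))\<^sup>2 / t - 2 * cmod (f x) * cmod (g x)"
      using t by (simp add: power2_eq_square field_simps)
    finally show "norm (f x * cnj (g x)) \<le> (t * (cmod (f x))\<^sup>2 + (cmod (g x))\<^sup>2 / t) / 2"
      by (simp add: norm_mult)
  qed
  also have "\<dots> = (t * (\<integral>x. (cmod (f x))\<^sup>2 \<partial>M) + (\<integral>x. (cmod (g x))\<^sup>2 \<partial>M) / t) / 2"
    using f g unfolding sq_integrable_def by simp
  finally show "2 * cmod (\<integral>x. f x * cnj (g x) \<partial>M) \<le> t * (\<integral>x. (cmod (f x))\<^sup>2 \<partial>M) + (\<integral>x. (cmod (g x))\<^sup>2 \<partial>M) / t"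
    by simp
qed auto

lemma sq_integrable_add:
  assumes "sq_integrable M f" "sq_integrable M g" shows "sq_integrable M (\<lambda>x. f x + g x)"
proof -
  have [measurable]: "f \<in> borel_measurable M" "g \<in> borel_measurable M"
    using assms unfolding sq_integrable_def by auto
  have "integrable M (\<lambda>x. (cmod (f x + g x))\<^sup>2)"
  proof (rule Bochner_Integration.integrable_bound)
    show "integrable M (\<lambda>x. 2 * (cmod (f x))\<^sup>2 + 2 * (cmod (g x))\<^sup>2)"
      using assms unfolding sq_integrable_def by simp
    have "(cmod (a + b))\<^sup>2 \<le> 2 * (cmod a)\<^sup>2 + 2 * (cmod b)\<^sup>2" for a b :: complex
    proof -
      have "(cmod (a + b))\<^sup>2 \<le> (cmod a + cmod b)\<^sup>2" by (intro power_mono norm_triangle_ineq) simp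
      also have "\<dots> \<le> 2 * (cmod a)\<^sup>2 + 2 * (cmod b)\<^sup>2"
        using sum_squares_bound[of "cmod a" "cmod b"] by (simp add: power2_sum)
      finally show ?thesis .
    qed
    then show "AE x in M. norm ((cmod (f x + g x))\<^sup>2) \<le> norm (2 * (cmod (f x))\<^sup>2 + 2 * (cmod (g x))\<^sup>2)"
      by simp
  qed measurable
  then show ?thesis unfolding sq_integrable_def by simp
qed

lemma sq_integrable_cmult:
  assumes "sq_integrable M f" shows "sq_integrable M (\<lambda>x. c * f x)"
  using assms unfolding sq_integrable_def by (auto simp: norm_mult power_mult_distrib)

lemma sq_integrable_diff:
  assumes "sq_integrable M f" "sq_integrable M g" shows "sq_integrable M (\<lambda>x. f x - g x)"
  using sq_integrable_add[OF assms(1) sq_integrable_cmult[OF assms(2), of "-1"]] by simp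

lemma integral_norm_sq_add:
  assumes f: "sq_integrable M f" and g: "sq_integrable M g"
  shows "(\<integral>x. (cmod (f x + g x))\<^sup>2 \<partial>M) =
    (\<integral>x. (cmod (f x))\<^sup>2 \<partial>M) + (\<integral>x. (cmod (g x))\<^sup>2 \<partial>M) + 2 * Re (\<integral>x. f x * cnj (g x) \<partial>M)"
proof -
  have "(cmod (a + b))\<^sup>2 = (cmod a)\<^sup>2 + (cmod b)\<^sup>2 + 2 * Re (a * cnj b)" for a b :: complex
    unfolding cmod_power2 by (simp add: power2_eq_square algebra_simps)
  then have "(\<integral>x. (cmod (f x + g x))\<^sup>2 \<partial>M) = (\<integral>x. (cmod (f x))\<^sup>2 + (cmod (g x))\<^sup>2 + 2 * Re (f x * cnj (g x)) \<partial>M)"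
    by (intro Bochner_Integration.integral_cong refl)
  also have "\<dots> = (\<integral>x. (cmod (f x))\<^sup>2 + (cmod (g x))\<^sup>2 \<partial>M) + (\<integral>x. 2 * Re (f x * cnj (g x)) \<partial>M)"
    using f g integrable_Re[OF integrable_mult_cnj[OF f g]] unfolding sq_integrable_def
    by (intro Bochner_Integration.integral_add Bochner_Integration.integrable_add integrable_mult_right) auto
  also have "(\<integral>x. (cmod (f x))\<^sup>2 + (cmod (g x))\<^sup>2 \<partial>M) = (\<integral>x. (cmod (f x))\<^sup>2 \<partial>M) + (\<integral>x. (cmod (g x))\<^sup>2 \<partial>M)"
    using f g unfolding sq_integrable_def by (intro Bochner_Integration.integral_add) auto
  also have "(\<integral>x. 2 * Re (f x * cnj (g x)) \<partial>M) = 2 * (\<integral>x. Re (f x * cnj (g x)) \<partial>M)"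
    by (rule integral_mult_right_zero)
  also have "(\<integral>x. Re (f x * cnj (g x)) \<partial>M) = Re (\<integral>x. f x * cnj (g x) \<partial>M)"
    by (rule integral_Re[OF integrable_mult_cnj[OF f g]])
  finally show ?thesis .
qed

lemma L2norm_triangle:
  assumes f: "sq_integrable M f" and g: "sq_integrable M g"
  shows "L2norm M (\<lambda>x. f x + g x) \<le> L2norm M f + L2norm M g"
proof (rule power2_le_imp_le)
  have "Re (\<integral>x. f x * cnj (g x) \<partial>M) \<le> L2norm M f * L2norm M g"
    using integral_Cauchy_Schwarz[OF f g] complex_Re_le_cmod order_trans by blast
  then show "(L2norm M (\<lambda>x. f x + g x))\<^sup>2 \<le> (L2norm M f + L2norm M g)\<^sup>2"
    unfolding power2_sum L2norm_sq integral_norm_sq_add[OF f g] by simp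
qed (simp add: L2norm_nonneg)

lemma L2norm_cmult: "L2norm M (\<lambda>x. c * f x) = cmod c * L2norm M f"
  unfolding L2norm_def by (simp add: norm_mult power_mult_distrib real_sqrt_mult)

lemma sq_integrable_Cc:
  fixes f :: "'a :: t2_space \<Rightarrow> complex"
  assumes "radon_measure h" "f \<in> Cc" shows "sq_integrable h f"
proof -
  have "(\<lambda>x. complex_of_real (cmod (f x)) * complex_of_real (cmod (f x))) \<in> Cc"
    by (intro Cc_mult_left Cc_norm assms continuous_on_of_real continuous_on_norm Cc_continuous)
  from integrable_Re[OF integrable_Cc[OF assms(1) this]] show ?thesis
    unfolding sq_integrable_def using radon_continuous_measurable[OF assms(1) Cc_continuous[OF assms(2)]]
    by (simp add: power2_eq_square)
qed

lemma Cc_tilde: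
  fixes f :: "'a :: lca_group \<Rightarrow> complex"
  assumes "f \<in> Cc" shows "tilde_fun f \<in> Cc"
  unfolding tilde_fun_def[abs_def] using Cc_cnj[OF Cc_minus_arg[OF assms, of 0]] by simp

lemma complex_measure_tilde:
  fixes \<mu> :: "('a :: lca_group \<Rightarrow> complex) \<Rightarrow> complex"
  assumes \<mu>: "complex_measure \<mu>"
  shows "complex_measure (tilde_cm \<mu>)"
  unfolding complex_measure_def
proof (intro conjI ballI allI impI)
  fix f g :: "'a \<Rightarrow> complex" assume f: "f \<in> Cc" and g: "g \<in> Cc"
  show "tilde_cm \<mu> (\<lambda>x. f x + g x) = tilde_cm \<mu> f + tilde_cm \<mu> g"
    using complex_measure_add[OF \<mu> Cc_tilde[OF f] Cc_tilde[OF g]]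
    unfolding tilde_cm_def by (simp add: tilde_fun_def[abs_def])
next
  fix c and f :: "'a \<Rightarrow> complex" assume f: "f \<in> Cc"
  show "tilde_cm \<mu> (\<lambda>x. c * f x) = c * tilde_cm \<mu> f"
    using complex_measure_cmult[OF \<mu> Cc_tilde[OF f], of "cnj c"]
    unfolding tilde_cm_def by (simp add: tilde_fun_def[abs_def])
next
  fix K :: "'a set" assume K: "compact K"
  have "compact (uminus ` K)" by (intro compact_continuous_image K continuous_intros)
  with \<mu> obtain C where C: "C > 0" "\<And>f B. f \<in> Cc \<Longrightarrow> (\<And>x. x \<notin> uminus ` K \<Longrightarrow> f x = 0) \<Longrightarrow> (\<And>x. cmod (f x) \<le> B) \<Longrightarrow> cmod (\<mu> f) \<le> C * B"
    by (rule complex_measure_bound) blast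
  have "cmod (tilde_cm \<mu> f) \<le> C * (SUP x. cmod (f x))" if f: "f \<in> Cc" "closure {x. f x \<noteq> 0} \<subseteq> K" for f
  proof -
    obtain B where B: "\<And>x. cmod (f x) \<le> B" using f(1) by (rule Cc_bounded) blast
    have "cmod (f x) \<le> (SUP x. cmod (f x))" for x
      using B by (intro cSUP_upper bdd_aboveI2) auto
    moreover have "tilde_fun f x = 0" if "x \<notin> uminus ` K" for x
    proof -
      have "- x \<notin> K" using that by (metis add.inverse_inverse imageI)
      then show ?thesis using f(2) closure_subset[of "{x. f x \<noteq> 0}"] unfolding tilde_fun_def by auto
    qed
    ultimately show ?thesis
      unfolding tilde_cm_def complex_mod_cnj by (intro C(2) Cc_tilde f(1)) (auto simp: tilde_fun_def)
  qed
  then show "\<exists>C\<ge>0. \<forall>f\<in>Cc. closure {x. f x \<noteq> 0} \<subseteq> K \<longrightarrow> cmod (tilde_cm \<mu> f) \<le> C * (SUP x. cmod (f x))"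
    using C(1) by (intro exI[of _ C]) auto
qed

text \<open>The function G of the overview, evaluated at u. The conjugate makes it conjugate-linear
  in \<phi>, which is why scalars come out as \<open>cnj c\<close>; a translation of \<phi> becomes
  a translation of the argument u.\<close>

definition restrict_conv :: "(('a :: {topological_space, ab_group_add} \<Rightarrow> complex) \<Rightarrow> complex) \<Rightarrow> 'a set \<Rightarrow> ('a \<Rightarrow> complex) \<Rightarrow> 'a \<Rightarrow> complex" where
  "restrict_conv \<mu> A \<phi> u = restrict_cm \<mu> A (\<lambda>s. cnj (\<phi> (s - u)))"

context
  fixes A :: "'a :: lca_group set"
  assumes A: "open A" "compact (closure A)"
begin

text \<open>k (s - u) vanishes for all s in A unless u lies in the closure of A minus the support of
  k. Compactness of that set puts the convolution back into \<open>Cc\<close>, so it can be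
  integrated over the whole group.\<close>

lemma restrict_cm_shift_Cc:
  fixes k :: "'a \<Rightarrow> complex"
  assumes \<mu>: "complex_measure \<mu>" and k: "k \<in> Cc"
  shows "(\<lambda>u. restrict_cm \<mu> A (\<lambda>s. k (s - u))) \<in> Cc"
proof -
  obtain K where K: "compact K" "\<And>x. x \<notin> K \<Longrightarrow> k x = 0" using k by (rule CcE) blast
  define S where "S = (\<lambda>(x, y). x + y) ` (closure A \<times> uminus ` K)"
  have "compact (uminus ` K)" by (intro compact_continuous_image K continuous_intros)
  then have S: "compact S" unfolding S_def by (rule compact_plus[OF A(2)])
  have "restrict_cm \<mu> A (\<lambda>s. k (s - u)) = 0" if "u \<notin> S" for u
  proof (rule restrict_cm_eq_0[OF A \<mu> Cc_shift[OF k]])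
    fix s assume "s \<in> A"
    then have s: "s \<in> closure A" using closure_subset by blast
    have "s - u \<notin> K"
    proof
      assume "s - u \<in> K"
      then have "(s, - (s - u)) \<in> closure A \<times> uminus ` K" using s by blast
      then have "u \<in> S" unfolding S_def by (rule image_eqI[rotated]) simp
      with that show False by blast
    qed
    then show "k (s - u) = 0" by (rule K(2))
  qed
  then show ?thesis
    using continuous_complex_measure_shift[OF complex_measure_restrict_cm[OF A \<mu>] k] S by (rule CcI[rotated 2])
qed

lemma restrict_conv_Cc:
  "complex_measure \<mu> \<Longrightarrow> \<phi> \<in> Cc \<Longrightarrow> restrict_conv \<mu> A \<phi> \<in> Cc"
  unfolding restrict_conv_def[abs_def] by (rule restrict_cm_shift_Cc[OF _ Cc_cnj])

text \<open>The test function is the reflection of \<phi> * \<phi>', because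
  \<open>has_fourier_transform\<close> evaluates a convolution at 0. At s - t it is an integral over
  u of a function of s times a function of t; exchanging each of the two measures with that integral
  leaves the squared modulus of G.\<close>

lemma conv_cm_restrict:
  assumes h: "haar_measure h" and \<mu>: "complex_measure \<mu>" and \<phi>: "\<phi> \<in> Cc"
  shows "conv_cm (restrict_cm \<mu> A) (tilde_cm (restrict_cm \<mu> A)) (\<lambda>s. conv_fun h \<phi> (tilde_fun \<phi>) (0 - s)) =
    (\<integral>u. restrict_conv \<mu> A \<phi> u * cnj (restrict_conv \<mu> A \<phi> u) \<partial>h)"
proof -
  define R where "R = restrict_cm \<mu> A"
  define G where "G = restrict_conv \<mu> A \<phi>"
  define E where "E = (\<lambda>s. conv_fun h \<phi> (tilde_fun \<phi>) (0 - s))"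
  have r: "radon_measure h" by (rule haar_radon[OF h])
  have R: "complex_measure R" unfolding R_def by (rule complex_measure_restrict_cm[OF A \<mu>])
  have G: "G \<in> Cc" unfolding G_def by (rule restrict_conv_Cc[OF \<mu> \<phi>])
  have GR: "G u = R (\<lambda>s. cnj (\<phi> (s - u)))" for u unfolding G_def R_def restrict_conv_def ..
  have E: "E \<in> Cc" unfolding E_def conv_fun_def
    by (rule Cc_minus_arg[OF Cc_conv[OF r \<phi> Cc_tilde[OF \<phi>]]])
  define p where "p t = R (\<lambda>s. E (s + t))" for t
  have p: "p \<in> Cc"
    using Cc_minus_arg[OF restrict_cm_shift_Cc[OF \<mu> E], of 0] unfolding p_def[abs_def] R_def by simp
  \<comment> \<open>Substituting u - s for the integration variable separates s from t.\<close>
  have shift: "E (s - t) = (\<integral>u. cnj (\<phi> (s - u)) * \<phi> (t - u) \<partial>h)" for s t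
  proof -
    have "continuous_on UNIV (\<lambda>u. \<phi> (0 - (s - t) - u) * tilde_fun \<phi> u)"
      by (intro continuous_on_mult Cc_continuous Cc_minus_arg[OF \<phi>] Cc_tilde[OF \<phi>])
    from haar_integral_shift[OF h this, of "- s"] show ?thesis
      unfolding E_def conv_fun_def tilde_fun_def by (simp add: algebra_simps)
  qed
  \<comment> \<open>The inner functional is exchanged at - t and conjugated, which is the form in
    which \<open>tilde_cm\<close> evaluates p; the outer exchange follows below.\<close>
  have pt: "cnj (p (- t)) = (\<integral>u. cnj (\<phi> (t - u)) * cnj (G u) \<partial>h)" for t
  proof -
    have "p (- t) = R (\<lambda>s. \<integral>u. cnj (\<phi> (s - u)) * \<phi> (t - u) \<partial>h)"
      unfolding p_def using shift by simp
    also have "\<dots> = (\<integral>u. R (\<lambda>s. cnj (\<phi> (s - u))) * \<phi> (t - u) \<partial>h)"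
      by (rule complex_measure_integral_swap[OF r R Cc_cnj[OF \<phi>] Cc_minus_arg[OF \<phi>]])
    finally have "cnj (p (- t)) = cnj (\<integral>u. G u * \<phi> (t - u) \<partial>h)" unfolding GR[symmetric] by simp
    also have "\<dots> = (\<integral>u. cnj (G u * \<phi> (t - u)) \<partial>h)" by (rule Bochner_Integration.integral_cnj[symmetric])
    finally show ?thesis by (simp only: complex_cnj_mult mult.commute)
  qed
  have "conv_cm R (tilde_cm R) E = cm_integral (tilde_cm R) p"
    unfolding conv_cm_def p_def[abs_def] using cm_integral_Cc[OF R Cc_plus_arg[OF E]] by simp
  also have "\<dots> = tilde_cm R p" by (rule cm_integral_Cc[OF complex_measure_tilde[OF R] p])
  also have "\<dots> = cnj (R (\<lambda>t. \<integral>u. cnj (\<phi> (t - u)) * cnj (G u) \<partial>h))"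
    unfolding tilde_cm_def tilde_fun_def[abs_def] pt ..
  also have "R (\<lambda>t. \<integral>u. cnj (\<phi> (t - u)) * cnj (G u) \<partial>h) = (\<integral>u. G u * cnj (G u) \<partial>h)"
    unfolding GR by (rule complex_measure_integral_swap[OF r R Cc_cnj[OF \<phi>] Cc_cnj[OF G, unfolded GR]])
  also have "cnj \<dots> = (\<integral>u. cnj (G u * cnj (G u)) \<partial>h)" by (rule Bochner_Integration.integral_cnj[symmetric])
  also have "\<dots> = (\<integral>u. G u * cnj (G u) \<partial>h)" by (simp only: complex_cnj_mult complex_cnj_cnj mult.commute)
  finally show ?thesis unfolding R_def G_def E_def .
qed

lemma restrict_conv_add:
  assumes "complex_measure \<mu>" "\<phi> \<in> Cc" "\<psi> \<in> Cc"
  shows "restrict_conv \<mu> A (\<lambda>x. \<phi> x + \<psi> x) u = restrict_conv \<mu> A \<phi> u + restrict_conv \<mu> A \<psi> u"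
  unfolding restrict_conv_def complex_cnj_add
  by (rule restrict_cm_add[OF A assms(1) Cc_shift[OF Cc_cnj[OF assms(2)]] Cc_shift[OF Cc_cnj[OF assms(3)]]])

lemma restrict_conv_cmult:
  assumes "complex_measure \<mu>" "\<phi> \<in> Cc"
  shows "restrict_conv \<mu> A (\<lambda>x. c * \<phi> x) u = cnj c * restrict_conv \<mu> A \<phi> u"
  unfolding restrict_conv_def complex_cnj_mult
  by (rule restrict_cm_cmult[OF A assms(1) Cc_shift[OF Cc_cnj[OF assms(2)]]])

lemma restrict_conv_shift:
  "restrict_conv \<mu> A (\<lambda>x. \<phi> (x - t)) u = restrict_conv \<mu> A \<phi> (u + t)"
  unfolding restrict_conv_def by (simp add: algebra_simps)

lemma restrict_conv_add3:
  assumes "complex_measure \<mu>" "complex_measure \<mu>1" "complex_measure \<mu>2" "complex_measure \<mu>3"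
    and "\<And>\<phi>. \<phi> \<in> Cc \<Longrightarrow> \<mu> \<phi> = \<mu>1 \<phi> + \<mu>2 \<phi> + \<mu>3 \<phi>" and "\<phi> \<in> Cc"
  shows "restrict_conv \<mu> A \<phi> u = restrict_conv \<mu>1 A \<phi> u + restrict_conv \<mu>2 A \<phi> u + restrict_conv \<mu>3 A \<phi> u"
  unfolding restrict_conv_def
  by (rule restrict_cm_add3[OF A assms(1-5) Cc_shift[OF Cc_cnj[OF assms(6)]]])

end

section \<open>Trigonometric polynomials on the dual group\<close>

lemma char_of_continuous: "continuous_on S (char_of \<xi>)"
  and char_of_norm: "cmod (char_of \<xi> x) = 1"
  and char_of_add: "char_of \<xi> (x + y) = char_of \<xi> x * char_of \<xi> y"
proof -
  note * = char_of[of \<xi>, unfolded mem_Collect_eq]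
  show "continuous_on S (char_of \<xi>)" by (rule continuous_on_subset[OF conjunct1[OF *]]) simp
  show "cmod (char_of \<xi> x) = 1" "char_of \<xi> (x + y) = char_of \<xi> x * char_of \<xi> y" using * by blast+
qed

lemma char_of_zero: "char_of \<xi> 0 = 1"
proof -
  have "char_of \<xi> 0 * char_of \<xi> 0 = char_of \<xi> 0" using char_of_add[of \<xi> 0 0, symmetric] by simp
  moreover have "char_of \<xi> 0 \<noteq> 0" using char_of_norm[of \<xi> 0] by auto
  ultimately show ?thesis by simp
qed

lemma char_of_minus: "char_of \<xi> (- x) = cnj (char_of \<xi> x)"
proof -
  have "char_of \<xi> x * char_of \<xi> (- x) = 1" using char_of_add[of \<xi> x "- x", symmetric] by (simp add: char_of_zero)
  also have "1 = char_of \<xi> x * cnj (char_of \<xi> x)"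
    using complex_norm_square[of "char_of \<xi> x"] char_of_norm[of \<xi> x] by simp
  finally have "char_of \<xi> x * char_of \<xi> (- x) = char_of \<xi> x * cnj (char_of \<xi> x)" .
  moreover have "char_of \<xi> x \<noteq> 0" using char_of_norm[of \<xi> x] by auto
  ultimately show ?thesis using mult_cancel_left by blast
qed

lemma continuous_on_dualI:
  fixes F :: "'a :: topological_ab_group_add dual \<Rightarrow> 'b :: metric_space"
  assumes "\<And>\<xi> e. e > 0 \<Longrightarrow> \<exists>K d. compact K \<and> d > 0 \<and>
    (\<forall>\<zeta>. (\<forall>x\<in>K. cmod (char_of \<zeta> x - char_of \<xi> x) < d) \<longrightarrow> dist (F \<zeta>) (F \<xi>) < e)"
  shows "continuous_on UNIV F"
proof (subst continuous_on_open_vimage[OF open_UNIV], intro allI impI)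
  fix B :: "'b set" assume B: "open B"
  show "open (F -` B \<inter> UNIV)" unfolding open_dual_def
  proof
    fix \<xi> assume "\<xi> \<in> F -` B \<inter> UNIV"
    then have "F \<xi> \<in> B" by simp
    then obtain e where e: "e > 0" "\<And>y. dist y (F \<xi>) < e \<Longrightarrow> y \<in> B"
      using B[unfolded open_dist, rule_format, of "F \<xi>"] by auto
    obtain K d where K: "compact K" "d > 0"
      "\<forall>\<zeta>. (\<forall>x\<in>K. cmod (char_of \<zeta> x - char_of \<xi> x) < d) \<longrightarrow> dist (F \<zeta>) (F \<xi>) < e"
      using assms[OF e(1), of \<xi>] by (elim exE conjE) (rule that)
    have "{\<zeta>. \<forall>x\<in>K. cmod (char_of \<zeta> x - char_of \<xi> x) < d} \<subseteq> F -` B \<inter> UNIV"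
      using K(3) e(2) by simp blast
    with K(1,2) show "\<exists>K e. compact K \<and> e > 0 \<and> {\<zeta>. \<forall>x\<in>K. cmod (char_of \<zeta> x - char_of \<xi> x) < e} \<subseteq> F -` B \<inter> UNIV"
      by (intro exI conjI)
  qed
qed

lemma continuous_on_eval: "continuous_on UNIV (\<lambda>\<xi> :: 'a :: topological_ab_group_add dual. char_of \<xi> t)"
proof (rule continuous_on_dualI)
  fix \<xi> :: "'a dual" and e :: real assume "e > 0"
  then show "\<exists>K d. compact K \<and> d > 0 \<and>
      (\<forall>\<zeta>. (\<forall>x\<in>K. cmod (char_of \<zeta> x - char_of \<xi> x) < d) \<longrightarrow> dist (char_of \<zeta> t) (char_of \<xi> t) < e)"
    by (intro exI[of _ "{t}"] exI[of _ e]) (auto simp: dist_norm)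
qed

text \<open>Evaluations are continuous and separate characters. The Hausdorff property makes compact
  subsets of the dual closed and hence Borel.\<close>

instance dual :: (topological_ab_group_add) t2_space
proof
  fix \<xi> \<zeta> :: "'a dual" assume "\<xi> \<noteq> \<zeta>"
  then have "char_of \<xi> \<noteq> char_of \<zeta>" by (simp add: char_of_inject)
  then obtain t where t: "char_of \<xi> t \<noteq> char_of \<zeta> t" by blast
  obtain U V where UV: "open U" "open V" "char_of \<xi> t \<in> U" "char_of \<zeta> t \<in> V" "U \<inter> V = {}"
    using hausdorff[OF t] by (elim exE conjE) (rule that)
  have "open ((\<lambda>\<xi> :: 'a dual. char_of \<xi> t) -` W)" if "open W" for W
    using continuous_on_eval[of t] that by (simp add: continuous_on_open_vimage)
  note open_preimage = this
  show "\<exists>U V. open U \<and> open V \<and> \<xi> \<in> U \<and> \<zeta> \<in> V \<and> U \<inter> V = {}"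
  proof (intro exI conjI)
    show "open ((\<lambda>\<xi> :: 'a dual. char_of \<xi> t) -` U)" "open ((\<lambda>\<xi> :: 'a dual. char_of \<xi> t) -` V)"
      by (rule open_preimage[OF UV(1)], rule open_preimage[OF UV(2)])
    show "\<xi> \<in> (\<lambda>\<xi>. char_of \<xi> t) -` U" "\<zeta> \<in> (\<lambda>\<xi>. char_of \<xi> t) -` V" using UV(3,4) by simp_all
    show "(\<lambda>\<xi>. char_of \<xi> t) -` U \<inter> (\<lambda>\<xi>. char_of \<xi> t) -` V = {}" using UV(5) by blast
  qed
qed

context
  fixes h :: "'a :: lca_group measure"
  assumes h: "haar_measure h"
begin

lemma fourier_integrable: "\<phi> \<in> Cc \<Longrightarrow> integrable h (\<lambda>t. cnj (char_of \<xi> t) * \<phi> t)"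
  by (rule integrable_Cc[OF haar_radon[OF h] Cc_mult_left[OF _ continuous_on_cnj[OF char_of_continuous]]])

lemma fourier_add:
  "\<phi> \<in> Cc \<Longrightarrow> \<psi> \<in> Cc \<Longrightarrow> fourier_fun h (\<lambda>x. \<phi> x + \<psi> x) \<xi> = fourier_fun h \<phi> \<xi> + fourier_fun h \<psi> \<xi>"
  unfolding fourier_fun_def distrib_left by (rule Bochner_Integration.integral_add[OF fourier_integrable fourier_integrable])

lemma fourier_cmult: "fourier_fun h (\<lambda>x. c * \<phi> x) \<xi> = c * fourier_fun h \<phi> \<xi>"
proof -
  have "fourier_fun h (\<lambda>x. c * \<phi> x) \<xi> = (\<integral>t. c * (cnj (char_of \<xi> t) * \<phi> t) \<partial>h)"
    unfolding fourier_fun_def by (simp only: mult.left_commute)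
  also have "\<dots> = c * fourier_fun h \<phi> \<xi>" unfolding fourier_fun_def by (rule integral_mult_right_zero)
  finally show ?thesis .
qed

lemma fourier_shift:
  assumes "\<phi> \<in> Cc"
  shows "fourier_fun h (\<lambda>x. \<phi> (x - t)) \<xi> = cnj (char_of \<xi> t) * fourier_fun h \<phi> \<xi>"
proof -
  let ?f = "\<lambda>y. cnj (char_of \<xi> t) * (cnj (char_of \<xi> y) * \<phi> y)"
  have pointwise: "cnj (char_of \<xi> t) * (cnj (char_of \<xi> (x - t)) * \<phi> (x - t)) = cnj (char_of \<xi> x) * \<phi> (x - t)" for x
    using char_of_add[of \<xi> t "x - t"] by simp
  have "fourier_fun h (\<lambda>x. \<phi> (x - t)) \<xi> = (\<integral>x. ?f (x - t) \<partial>h)"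
    unfolding fourier_fun_def pointwise ..
  also have "\<dots> = (\<integral>x. ?f (x + (- t)) \<partial>h)" by (simp only: diff_conv_add_uminus)
  also have "\<dots> = (\<integral>x. ?f x \<partial>h)"
    by (rule haar_integral_shift[OF h])
       (intro continuous_on_mult continuous_on_const continuous_on_cnj char_of_continuous Cc_continuous assms)
  also have "\<dots> = cnj (char_of \<xi> t) * fourier_fun h \<phi> \<xi>"
    unfolding fourier_fun_def by (rule integral_mult_right_zero)
  finally show ?thesis .
qed

lemma fourier_bound: "\<phi> \<in> Cc \<Longrightarrow> cmod (fourier_fun h \<phi> \<xi>) \<le> (\<integral>t. cmod (\<phi> t) \<partial>h)"
  unfolding fourier_fun_def
  by (rule norm_integral_le_integral[OF fourier_integrable integrable_norm[OF integrable_Cc[OF haar_radon[OF h]]]])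
     (auto simp: norm_mult char_of_norm)

text \<open>The integral sees characters only on the compact support of \<phi>, and uniform
  closeness there defines a neighbourhood in the compact-open topology.\<close>

lemma fourier_continuous:
  assumes \<phi>: "\<phi> \<in> Cc"
  shows "continuous_on UNIV (fourier_fun h \<phi>)"
proof (rule continuous_on_dualI)
  fix \<xi> :: "'a dual" and e :: real assume e: "e > 0"
  obtain K where K: "compact K" "\<And>x. x \<notin> K \<Longrightarrow> \<phi> x = 0" using \<phi> by (rule CcE) blast
  define G where "G = (\<integral>t. cmod (\<phi> t) \<partial>h)"
  have G: "G \<ge> 0" unfolding G_def by (intro Bochner_Integration.integral_nonneg) auto
  have "dist (fourier_fun h \<phi> \<zeta>) (fourier_fun h \<phi> \<xi>) < e"
    if \<zeta>: "\<forall>x\<in>K. cmod (char_of \<zeta> x - char_of \<xi> x) < e / (G + 1)" for \<zeta>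
  proof -
    have "fourier_fun h \<phi> \<zeta> - fourier_fun h \<phi> \<xi> = (\<integral>t. cnj (char_of \<zeta> t) * \<phi> t - cnj (char_of \<xi> t) * \<phi> t \<partial>h)"
      unfolding fourier_fun_def
      by (rule Bochner_Integration.integral_diff[OF fourier_integrable[OF \<phi>] fourier_integrable[OF \<phi>], symmetric])
    also have "cmod \<dots> \<le> (\<integral>t. e / (G + 1) * cmod (\<phi> t) \<partial>h)"
    proof (rule norm_integral_le_integral)
      show "integrable h (\<lambda>t. cnj (char_of \<zeta> t) * \<phi> t - cnj (char_of \<xi> t) * \<phi> t)"
        by (intro Bochner_Integration.integrable_diff fourier_integrable \<phi>)
      show "integrable h (\<lambda>t. e / (G + 1) * cmod (\<phi> t))"
        using integrable_Cc[OF haar_radon[OF h] \<phi>] by simp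
      fix t
      have "cmod (cnj (char_of \<zeta> t) * \<phi> t - cnj (char_of \<xi> t) * \<phi> t) = cmod (char_of \<zeta> t - char_of \<xi> t) * cmod (\<phi> t)"
        by (simp only: left_diff_distrib[symmetric] complex_cnj_diff[symmetric] norm_mult complex_mod_cnj)
      also have "\<dots> \<le> e / (G + 1) * cmod (\<phi> t)"
      proof (cases "t \<in> K")
        case True
        then show ?thesis using \<zeta> by (intro mult_right_mono) (auto intro: less_imp_le)
      next
        case False
        then show ?thesis using K(2) by simp
      qed
      finally show "cmod (cnj (char_of \<zeta> t) * \<phi> t - cnj (char_of \<xi> t) * \<phi> t) \<le> e / (G + 1) * cmod (\<phi> t)" .
    qed
    also have "\<dots> = e / (G + 1) * G" unfolding G_def by (rule integral_mult_right_zero)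
    also have "\<dots> < e" using e G by (simp add: field_simps)
    finally show ?thesis by (simp add: dist_norm)
  qed
  then show "\<exists>K d. compact K \<and> d > 0 \<and>
      (\<forall>\<zeta>. (\<forall>x\<in>K. cmod (char_of \<zeta> x - char_of \<xi> x) < d) \<longrightarrow> dist (fourier_fun h \<phi> \<zeta>) (fourier_fun h \<phi> \<xi>) < e)"
    using K(1) e G by (intro exI[of _ K] exI[of _ "e / (G + 1)"]) auto
qed

end

text \<open>A list of pairs \<open>(c, t)\<close> encodes the operator \<open>\<phi> \<mapsto> \<Sum> c \<phi>(\<cdot> - t)\<close>, on the
  Fourier side multiplication by the trigonometric polynomial \<open>\<xi> \<mapsto> \<Sum> c \<xi>(-t)\<close>.\<close>

definition trig_op :: "(complex \<times> 'a :: ab_group_add) list \<Rightarrow> ('a \<Rightarrow> complex) \<Rightarrow> 'a \<Rightarrow> complex" where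
  "trig_op xs \<phi> x = (\<Sum>(c, t)\<leftarrow>xs. c * \<phi> (x - t))"

definition trig_sym :: "(complex \<times> 'a :: topological_ab_group_add) list \<Rightarrow> 'a dual \<Rightarrow> complex" where
  "trig_sym xs \<xi> = (\<Sum>(c, t)\<leftarrow>xs. c * cnj (char_of \<xi> t))"

definition trig_adj :: "(complex \<times> 'a :: ab_group_add) list \<Rightarrow> (complex \<times> 'a) list" where
  "trig_adj xs = map (\<lambda>(c, t). (cnj c, - t)) xs"

lemma trig_op_simps:
  "trig_op [] \<phi> = (\<lambda>x. 0)"
  "trig_op ((c, t) # xs) \<phi> = (\<lambda>x. c * \<phi> (x - t) + trig_op xs \<phi> x)"
  unfolding trig_op_def[abs_def] by simp_all

lemma trig_sym_simps:
  "trig_sym [] \<xi> = 0"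
  "trig_sym ((c, t) # xs) \<xi> = c * cnj (char_of \<xi> t) + trig_sym xs \<xi>"
  "trig_sym (xs @ ys) \<xi> = trig_sym xs \<xi> + trig_sym ys \<xi>"
  unfolding trig_sym_def by simp_all

lemma trig_sym_adj: "trig_sym (trig_adj xs) \<xi> = cnj (trig_sym xs \<xi>)"
  by (induction xs) (auto simp: trig_adj_def trig_sym_def char_of_minus)

lemma trig_op_Cc:
  fixes \<phi> :: "'a :: lca_group \<Rightarrow> complex"
  assumes "\<phi> \<in> Cc" shows "trig_op xs \<phi> \<in> Cc"
proof (induction xs)
  case (Cons x xs)
  then show ?case
    by (cases x) (simp only: trig_op_simps, intro Cc_add Cc_cmult Cc_shift assms)
qed (simp add: trig_op_simps Cc_zero)

lemma fourier_trig_op: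
  fixes h :: "'a :: lca_group measure"
  assumes h: "haar_measure h" and \<phi>: "\<phi> \<in> Cc"
  shows "fourier_fun h (trig_op xs \<phi>) \<xi> = trig_sym xs \<xi> * fourier_fun h \<phi> \<xi>"
proof (induction xs)
  case Nil
  then show ?case by (simp add: trig_op_simps trig_sym_simps fourier_fun_def)
next
  case (Cons x xs)
  obtain c t where x: "x = (c, t)" by (cases x)
  have "fourier_fun h (trig_op (x # xs) \<phi>) \<xi> = fourier_fun h (\<lambda>x. c * \<phi> (x - t)) \<xi> + fourier_fun h (trig_op xs \<phi>) \<xi>"
    unfolding x trig_op_simps by (rule fourier_add[OF h Cc_cmult[OF Cc_shift[OF \<phi>]] trig_op_Cc[OF \<phi>]])
  then show ?case
    unfolding fourier_cmult[OF h, of c "\<lambda>x. \<phi> (x - t)"] fourier_shift[OF h \<phi>] Cons x trig_sym_simps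
    by (simp add: algebra_simps)
qed

text \<open>Translating \<phi> translates \<open>restrict_conv\<close>, and invariance of Haar
  measure moves the translation, with opposite sign, to the other factor. The two measures may
  differ, as cross terms require.\<close>

lemma restrict_conv_trig_adj:
  fixes h :: "'a :: lca_group measure"
  assumes h: "haar_measure h" and A: "open A" "compact (closure A)"
    and \<mu>: "complex_measure \<mu>" and \<nu>: "complex_measure \<nu>" and \<phi>: "\<phi> \<in> Cc" and \<psi>: "\<psi> \<in> Cc"
  shows "(\<integral>u. restrict_conv \<mu> A (trig_op xs \<phi>) u * cnj (restrict_conv \<nu> A \<psi> u) \<partial>h) =
    (\<integral>u. restrict_conv \<mu> A \<phi> u * cnj (restrict_conv \<nu> A (trig_op (trig_adj xs) \<psi>) u) \<partial>h)"
proof (induction xs)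
  case Nil
  have "restrict_conv \<mu> A (\<lambda>x. 0) u = 0" if "complex_measure \<mu>" for \<mu> u
    using restrict_conv_cmult[OF A that Cc_zero, of 0] by simp
  then show ?case using \<mu> \<nu> by (simp add: trig_op_simps trig_adj_def)
next
  case (Cons x xs)
  obtain c t where x: "x = (c, t)" by (cases x)
  have r: "radon_measure h" by (rule haar_radon[OF h])
  define F where "F = restrict_conv \<mu> A \<phi>"
  define H where "H = restrict_conv \<nu> A \<psi>"
  have F: "F \<in> Cc" and H: "H \<in> Cc" unfolding F_def H_def
    by (rule restrict_conv_Cc[OF A \<mu> \<phi>], rule restrict_conv_Cc[OF A \<nu> \<psi>])
  have F': "restrict_conv \<mu> A (trig_op xs \<phi>) \<in> Cc" and H': "restrict_conv \<nu> A (trig_op (trig_adj xs) \<psi>) \<in> Cc"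
    by (rule restrict_conv_Cc[OF A \<mu> trig_op_Cc[OF \<phi>]], rule restrict_conv_Cc[OF A \<nu> trig_op_Cc[OF \<psi>]])
  have 1: "restrict_conv \<mu> A (trig_op (x # xs) \<phi>) u = cnj c * F (u + t) + restrict_conv \<mu> A (trig_op xs \<phi>) u" for u
    unfolding x trig_op_simps
    by (simp only: restrict_conv_add[OF A \<mu> Cc_cmult[OF Cc_shift[OF \<phi>]] trig_op_Cc[OF \<phi>]]
        restrict_conv_cmult[OF A \<mu> Cc_shift[OF \<phi>]] restrict_conv_shift[OF A] F_def)
  have adj: "trig_adj (x # xs) = (cnj c, - t) # trig_adj xs" by (simp add: x trig_adj_def)
  have 2: "restrict_conv \<nu> A (trig_op (trig_adj (x # xs)) \<psi>) u = c * H (u + - t) + restrict_conv \<nu> A (trig_op (trig_adj xs) \<psi>) u" for u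
    unfolding adj trig_op_simps
    by (simp only: restrict_conv_add[OF A \<nu> Cc_cmult[OF Cc_shift[OF \<psi>]] trig_op_Cc[OF \<psi>]]
        restrict_conv_cmult[OF A \<nu> Cc_shift[OF \<psi>]] restrict_conv_shift[OF A] H_def complex_cnj_cnj)
  have i: "integrable h (\<lambda>u. f u * cnj (g u))" if "f \<in> Cc" "g \<in> Cc" for f g
    by (rule integrable_mult_cnj[OF sq_integrable_Cc[OF r that(1)] sq_integrable_Cc[OF r that(2)]])
  have "(\<integral>u. restrict_conv \<mu> A (trig_op (x # xs) \<phi>) u * cnj (H u) \<partial>h) =
      (\<integral>u. (cnj c * F (u + t)) * cnj (H u) + restrict_conv \<mu> A (trig_op xs \<phi>) u * cnj (H u) \<partial>h)"
    unfolding 1 by (simp only: distrib_right)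
  also have "\<dots> = (\<integral>u. (cnj c * F (u + t)) * cnj (H u) \<partial>h) + (\<integral>u. restrict_conv \<mu> A (trig_op xs \<phi>) u * cnj (H u) \<partial>h)"
    by (rule Bochner_Integration.integral_add[OF i[OF Cc_cmult[OF Cc_plus_arg[OF F]] H] i[OF F' H]])
  also have "(\<integral>u. (cnj c * F (u + t)) * cnj (H u) \<partial>h) = (\<integral>u. F u * cnj (c * H (u + - t)) \<partial>h)"
  proof -
    have "continuous_on UNIV (\<lambda>u. (cnj c * F (u + t)) * cnj (H u))"
      by (intro continuous_on_mult continuous_on_const continuous_on_cnj Cc_continuous[OF H] Cc_continuous[OF Cc_plus_arg[OF F]])
    note shift = haar_integral_shift[OF h this, of "- t"]
    have "(cnj c * F (u + - t + t)) * cnj (H (u + - t)) = F u * cnj (c * H (u + - t))" for u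
      by (simp add: mult_ac)
    then show ?thesis using shift by (simp only:)
  qed
  also have "(\<integral>u. restrict_conv \<mu> A (trig_op xs \<phi>) u * cnj (H u) \<partial>h) =
      (\<integral>u. F u * cnj (restrict_conv \<nu> A (trig_op (trig_adj xs) \<psi>) u) \<partial>h)"
    unfolding F_def H_def by (rule Cons)
  also have "(\<integral>u. F u * cnj (c * H (u + - t)) \<partial>h) + \<dots> =
      (\<integral>u. F u * cnj (c * H (u + - t)) + F u * cnj (restrict_conv \<nu> A (trig_op (trig_adj xs) \<psi>) u) \<partial>h)"
    by (rule Bochner_Integration.integral_add[OF i[OF F Cc_cmult[OF Cc_plus_arg[OF H]]] i[OF F H'], symmetric])
  also have "\<dots> = (\<integral>u. F u * cnj (restrict_conv \<nu> A (trig_op (trig_adj (x # xs)) \<psi>) u) \<partial>h)"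
    unfolding 2 by (simp only: distrib_left complex_cnj_add)
  finally show ?case unfolding F_def H_def .
qed

text \<open>Real values let the real form of Stone--Weierstrass apply; moreover the adjoint list
  then has the same symbol, so such a polynomial acts alike on both arguments of a form.\<close>

definition real_trig :: "('a :: topological_ab_group_add dual \<Rightarrow> real) set" where
  "real_trig = {f. \<exists>xs. \<forall>\<xi>. trig_sym xs \<xi> = complex_of_real (f \<xi>)}"

lemma trig_sym_continuous: "continuous_on UNIV (trig_sym xs)"
proof (induction xs)
  case (Cons x xs)
  then show ?case
    by (cases x) (simp only: trig_sym_simps, intro continuous_on_add continuous_on_mult continuous_on_const continuous_on_cnj continuous_on_eval)
qed (simp add: trig_sym_simps)

lemma trig_sym_bounded: "\<exists>B. \<forall>\<xi>. cmod (trig_sym xs \<xi>) \<le> B"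
proof (induction xs)
  case (Cons x xs)
  obtain c t where x: "x = (c, t)" by (cases x)
  from Cons obtain B where B: "\<And>\<xi>. cmod (trig_sym xs \<xi>) \<le> B" by blast
  have "cmod (trig_sym (x # xs) \<xi>) \<le> cmod c + B" for \<xi>
    using norm_triangle_ineq[of "c * cnj (char_of \<xi> t)" "trig_sym xs \<xi>"] B[of \<xi>]
    unfolding x trig_sym_simps by (simp add: norm_mult char_of_norm)
  then show ?case by blast
qed (auto simp: trig_sym_simps)

lemma real_trig_add:
  assumes "f \<in> real_trig" "g \<in> real_trig" shows "(\<lambda>\<xi>. f \<xi> + g \<xi>) \<in> real_trig"
proof -
  obtain xs ys where "\<And>\<xi>. trig_sym xs \<xi> = complex_of_real (f \<xi>)" "\<And>\<xi>. trig_sym ys \<xi> = complex_of_real (g \<xi>)"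
    using assms unfolding real_trig_def by blast
  then have "trig_sym (xs @ ys) \<xi> = complex_of_real (f \<xi> + g \<xi>)" for \<xi> by (simp add: trig_sym_simps(3))
  then show ?thesis unfolding real_trig_def by blast
qed

lemma real_trig_const: "(\<lambda>\<xi>. c) \<in> real_trig"
  unfolding real_trig_def by (auto intro!: exI[of _ "[(complex_of_real c, 0)]"] simp: trig_sym_simps char_of_zero)

lemma trig_sym_mult: "\<exists>zs. \<forall>\<xi>. trig_sym zs \<xi> = trig_sym xs \<xi> * trig_sym ys \<xi>"
proof (induction xs)
  case Nil
  then show ?case by (auto simp: trig_sym_simps intro!: exI[of _ "[]"])
next
  case (Cons x xs)
  obtain c t where x: "x = (c, t)" by (cases x)
  from Cons obtain zs where zs: "\<And>\<xi>. trig_sym zs \<xi> = trig_sym xs \<xi> * trig_sym ys \<xi>" by blast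
  have "trig_sym (map (\<lambda>(d, s). (c * d, t + s)) ys) \<xi> = c * cnj (char_of \<xi> t) * trig_sym ys \<xi>" for \<xi>
    by (induction ys) (auto simp: trig_sym_simps char_of_add algebra_simps)
  then have "trig_sym (map (\<lambda>(d, s). (c * d, t + s)) ys @ zs) \<xi> = trig_sym (x # xs) \<xi> * trig_sym ys \<xi>" for \<xi>
    unfolding trig_sym_simps x zs by (simp add: distrib_right)
  then show ?case by blast
qed

lemma real_trig_mult: 
  assumes "f \<in> real_trig" "g \<in> real_trig" shows "(\<lambda>\<xi>. f \<xi> * g \<xi>) \<in> real_trig"
proof -
  obtain xs ys where "\<And>\<xi>. trig_sym xs \<xi> = complex_of_real (f \<xi>)" "\<And>\<xi>. trig_sym ys \<xi> = complex_of_real (g \<xi>)"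
    using assms unfolding real_trig_def by blast
  moreover obtain zs where "\<And>\<xi>. trig_sym zs \<xi> = trig_sym xs \<xi> * trig_sym ys \<xi>" using trig_sym_mult by blast
  ultimately have "trig_sym zs \<xi> = complex_of_real (f \<xi> * g \<xi>)" for \<xi> by simp
  then show ?thesis unfolding real_trig_def by blast
qed

text \<open>Real and imaginary part of the evaluation at t are combinations of the translations by t
  and - t.\<close>

lemma real_trig_separates:
  fixes \<xi> \<zeta> :: "'a :: topological_ab_group_add dual"
  assumes "\<xi> \<noteq> \<zeta>" shows "\<exists>f\<in>real_trig. f \<xi> \<noteq> f \<zeta>"
proof -
  have "char_of \<xi> \<noteq> char_of \<zeta>" using assms by (simp add: char_of_inject)
  then obtain t where t: "char_of \<xi> t \<noteq> char_of \<zeta> t" by blast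
  have "trig_sym [(1/2, t), (1/2, - t)] \<eta> = complex_of_real (Re (char_of \<eta> t))" for \<eta> :: "'a dual"
    by (simp add: trig_sym_simps char_of_minus complex_eq_iff)
  then have re: "(\<lambda>\<eta> :: 'a dual. Re (char_of \<eta> t)) \<in> real_trig" unfolding real_trig_def by blast
  have "trig_sym [(\<i>/2, t), (-\<i>/2, - t)] \<eta> = complex_of_real (Im (char_of \<eta> t))" for \<eta> :: "'a dual"
    by (simp add: trig_sym_simps char_of_minus complex_eq_iff)
  then have im: "(\<lambda>\<eta> :: 'a dual. Im (char_of \<eta> t)) \<in> real_trig" unfolding real_trig_def by blast
  show ?thesis
  proof (cases "Re (char_of \<xi> t) = Re (char_of \<zeta> t)")
    case True
    then have "Im (char_of \<xi> t) \<noteq> Im (char_of \<zeta> t)" using t by (simp add: complex_eq_iff)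
    then show ?thesis by (rule bexI[OF _ im])
  next
    case False
    then show ?thesis by (rule bexI[OF _ re])
  qed
qed

lemma real_trig_continuous:
  assumes "f \<in> real_trig" shows "continuous_on S f"
proof -
  obtain xs where xs: "\<And>\<xi>. trig_sym xs \<xi> = complex_of_real (f \<xi>)" using assms unfolding real_trig_def by blast
  have "continuous_on UNIV (\<lambda>\<xi>. Re (trig_sym xs \<xi>))" by (rule continuous_on_Re[OF trig_sym_continuous])
  then have "continuous_on UNIV f" unfolding xs Re_complex_of_real .
  then show ?thesis by (rule continuous_on_subset) simp
qed

lemma real_trig_poly:
  fixes p :: "real \<Rightarrow> real"
  assumes "real_polynomial_function p" "f \<in> real_trig"
  shows "(\<lambda>\<xi>. p (f \<xi>)) \<in> real_trig"
  using assms(1)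
proof (induction p rule: real_polynomial_function.induct)
  case (linear p)
  have "p x = p 1 * x" for x
    using linear_scale[OF bounded_linear.linear[OF linear], of x 1] by (simp add: mult.commute)
  then have "(\<lambda>\<xi>. p (f \<xi>)) = (\<lambda>\<xi>. p 1 * f \<xi>)" by blast
  then show ?case using real_trig_mult[OF real_trig_const assms(2)] by simp
qed (auto intro: real_trig_const real_trig_add real_trig_mult)

text \<open>Stone--Weierstrass only controls the approximation on a compact set; composing with a
  polynomial that approximates truncation to \<open>[0, 1]\<close> gives a global bound as well.\<close>

lemma real_trig_separation:
  fixes K1 K2 :: "'a :: topological_ab_group_add dual set"
  assumes K: "compact K1" "compact K2" "K1 \<inter> K2 = {}" and e: "0 < e" "e \<le> 1"
  obtains f where "f \<in> real_trig" "\<And>\<xi>. \<bar>f \<xi>\<bar> \<le> 2" "\<And>\<xi>. \<xi> \<in> K1 \<Longrightarrow> \<bar>f \<xi> - 1\<bar> \<le> e" "\<And>\<xi>. \<xi> \<in> K2 \<Longrightarrow> \<bar>f \<xi>\<bar> \<le> e"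
proof -
  interpret R: function_ring_on "real_trig :: ('a dual \<Rightarrow> real) set" "K1 \<union> K2"
  proof
    show "compact (K1 \<union> K2)" by (rule compact_Un[OF K(1,2)])
  qed (rule real_trig_continuous real_trig_add real_trig_mult real_trig_const real_trig_separates; assumption)+
  \<comment> \<open>The indicator is continuous here, although it need not be on the whole dual,
    because K1 and K2 are disjoint and closed.\<close>
  have "continuous_on (K1 \<union> K2) (indicator K1 :: 'a dual \<Rightarrow> real)"
  proof (rule continuous_on_closed_Un)
    show "continuous_on K1 (indicator K1 :: 'a dual \<Rightarrow> real)"
      by (rule continuous_on_eq[OF continuous_on_const[of _ 1]]) simp
    have "indicator K1 x = (0::real)" if "x \<in> K2" for x using that K(3) by (auto simp: indicator_def)
    then show "continuous_on K2 (indicator K1 :: 'a dual \<Rightarrow> real)"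
      by (intro continuous_on_eq[OF continuous_on_const[of _ 0]]) simp
  qed (use K in \<open>auto intro: compact_imp_closed\<close>)
  from R.Stone_Weierstrass_basic[OF this, of "e / 2"] e(1)
  obtain g where g: "g \<in> real_trig" "\<And>\<xi>. \<xi> \<in> K1 \<union> K2 \<Longrightarrow> \<bar>indicator K1 \<xi> - g \<xi>\<bar> < e / 2" by auto
  obtain xs where xs: "\<And>\<xi>. trig_sym xs \<xi> = complex_of_real (g \<xi>)" using g(1) unfolding real_trig_def by blast
  obtain B where bound: "\<And>\<xi>. cmod (trig_sym xs \<xi>) \<le> B" using trig_sym_bounded by blast
  have B: "g \<xi> \<in> {- B..B}" for \<xi>
  proof -
    have "\<bar>g \<xi>\<bar> \<le> B" using bound[of \<xi>] unfolding xs norm_of_real .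
    then show ?thesis unfolding abs_le_iff by simp
  qed
  \<comment> \<open>g is bounded by B on the whole dual, so a polynomial close to
    \<open>clip\<close> on [-B, B] controls p (g \<xi>) everywhere. On K1 and K2 each of the two
    approximations contributes e / 2.\<close>
  define clip :: "real \<Rightarrow> real" where "clip x = max 0 (min 1 x)" for x
  have clip: "continuous_on {- B..B} clip" unfolding clip_def by (intro continuous_intros)
  have "0 < e / 2" using e(1) by simp
  then obtain p where p: "real_polynomial_function p" "\<And>x. x \<in> {- B..B} \<Longrightarrow> \<bar>clip x - p x\<bar> < e / 2"
    using Stone_Weierstrass_real_polynomial_function[OF compact_Icc clip] by blast
  have near: "\<bar>clip (g \<xi>) - p (g \<xi>)\<bar> < e / 2" for \<xi> using p(2)[OF B] .
  show ?thesis
  proof (rule that[of "\<lambda>\<xi>. p (g \<xi>)"])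
    show "(\<lambda>\<xi>. p (g \<xi>)) \<in> real_trig" by (rule real_trig_poly[OF p(1) g(1)])
    have clip_bounds: "0 \<le> clip x" "clip x \<le> 1" "\<bar>clip x - 1\<bar> \<le> \<bar>x - 1\<bar>" "\<bar>clip x\<bar> \<le> \<bar>x\<bar>" for x
      unfolding clip_def by linarith+
    show "\<bar>p (g \<xi>)\<bar> \<le> 2" for \<xi>
      using clip_bounds(1,2)[of "g \<xi>"] near[of \<xi>] e(2) by linarith
    show "\<bar>p (g \<xi>) - 1\<bar> \<le> e" if "\<xi> \<in> K1" for \<xi>
    proof -
      have "\<bar>1 - g \<xi>\<bar> < e / 2" using g(2)[of \<xi>] that by simp
      then show ?thesis using clip_bounds(3)[of "g \<xi>"] near[of \<xi>] by linarith
    qed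
    show "\<bar>p (g \<xi>)\<bar> \<le> e" if "\<xi> \<in> K2" for \<xi>
    proof -
      have "\<xi> \<notin> K1" using that K(3) by blast
      then have "\<bar>g \<xi>\<bar> < e / 2" using g(2)[of \<xi>] that by simp
      then show ?thesis using clip_bounds(4)[of "g \<xi>"] near[of \<xi>] by linarith
    qed
  qed
qed

section \<open>Radon measures\<close>

text \<open>Serves twice: to build the Fourier transform of \<gamma>, and as a single measure
  \<sigma> such that an error small for \<sigma> is small for every summand.\<close>

definition sum_measure :: "'a measure \<Rightarrow> 'a measure \<Rightarrow> 'a measure" where
  "sum_measure M N = measure_of (space M) (sets M) (\<lambda>B. emeasure M B + emeasure N B)"

lemma sets_sum_measure [simp]: "sets (sum_measure M N) = sets M"
  and space_sum_measure [simp]: "space (sum_measure M N) = space M"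
  unfolding sum_measure_def by simp_all

lemma emeasure_sum_measure:
  assumes N: "sets N = sets M" and B: "B \<in> sets M"
  shows "emeasure (sum_measure M N) B = emeasure M B + emeasure N B"
  unfolding sum_measure_def
proof (rule emeasure_measure_of_sigma[OF sets.sigma_algebra_axioms _ _ B])
  show "positive (sets M) (\<lambda>B. emeasure M B + emeasure N B)" by (simp add: positive_def)
  show "countably_additive (sets M) (\<lambda>B. emeasure M B + emeasure N B)"
  proof (rule countably_additiveI)
    fix F :: "nat \<Rightarrow> 'a set" assume F: "range F \<subseteq> sets M" "disjoint_family F" "(\<Union>i. F i) \<in> sets M"
    have FN: "range F \<subseteq> sets N" using F(1) N by simp
    have "(\<Sum>i. emeasure M (F i) + emeasure N (F i)) = (\<Sum>i. emeasure M (F i)) + (\<Sum>i. emeasure N (F i))"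
      by (rule suminf_add[symmetric]) auto
    also have "\<dots> = emeasure M (\<Union>i. F i) + emeasure N (\<Union>i. F i)"
      using suminf_emeasure[OF F(1,2)] suminf_emeasure[OF FN F(2)] by simp
    finally show "(\<Sum>i. emeasure M (F i) + emeasure N (F i)) = emeasure M (\<Union>i. F i) + emeasure N (\<Union>i. F i)" .
  qed
qed

lemma nn_integral_sum_measure:
  assumes N: "sets N = sets M" and f: "f \<in> borel_measurable M"
  shows "(\<integral>\<^sup>+x. f x \<partial>sum_measure M N) = (\<integral>\<^sup>+x. f x \<partial>M) + (\<integral>\<^sup>+x. f x \<partial>N)"
proof -
  have S: "borel_measurable (sum_measure M N) = borel_measurable M" "borel_measurable N = borel_measurable M"
    by (rule measurable_cong_sets, simp_all, rule measurable_cong_sets[OF N refl])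
  have sp: "space N = space M" using N by (rule sets_eq_imp_space_eq)
  show ?thesis using f
  proof (induction rule: borel_measurable_induct)
    case (cong f g)
    have "(\<integral>\<^sup>+x. f x \<partial>L) = (\<integral>\<^sup>+x. g x \<partial>L)" if "space L = space M" for L
      using cong(3) that by (intro nn_integral_cong) simp
    from this[of M] this[of N] this[of "sum_measure M N"] cong(4) sp show ?case by simp
  next
    case (set A)
    then show ?case using N by (simp add: emeasure_sum_measure)
  next
    case (mult u c)
    then show ?case by (simp add: nn_integral_cmult S distrib_left)
  next
    case (add u v)
    then show ?case by (simp add: nn_integral_add S add_ac)
  next
    case (seq U)
    have inc: "incseq (\<lambda>i. \<integral>\<^sup>+x. U i x \<partial>L)" for L
    proof (rule incseq_SucI, rule nn_integral_mono)
      show "U i x \<le> U (Suc i) x" for i x using incseq_SucD[OF seq.hyps(3), of i] by (rule le_funD)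
    qed
    have SUP: "(\<integral>\<^sup>+x. (SUP i. U i) x \<partial>L) = (SUP i. \<integral>\<^sup>+x. U i x \<partial>L)"
      if "borel_measurable L = (borel_measurable M :: ('a \<Rightarrow> ennreal) set)" for L :: "'a measure"
      using nn_integral_monotone_convergence_SUP[OF seq.hyps(3), of L] seq.hyps(1) that by (simp add: image_comp)
    show ?case
      unfolding SUP[OF S(1)] SUP[OF S(2)] SUP[OF refl] seq.IH by (rule ennreal_SUP_add[OF inc inc])
  qed
qed

lemma integrable_sum_measure:
  fixes f :: "'a \<Rightarrow> real"
  assumes N: "sets N = sets M" and f: "f \<in> borel_measurable M" "\<And>x. 0 \<le> f x"
  shows "integrable (sum_measure M N) f \<longleftrightarrow> integrable M f \<and> integrable N f"
    and "integrable M f \<Longrightarrow> integrable N f \<Longrightarrow>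
      (\<integral>x. f x \<partial>sum_measure M N) = (\<integral>x. f x \<partial>M) + (\<integral>x. f x \<partial>N)"
proof -
  have S: "borel_measurable (sum_measure M N) = borel_measurable M" "borel_measurable N = borel_measurable M"
    by (rule measurable_cong_sets, simp_all, rule measurable_cong_sets[OF N refl])
  have nn: "(\<integral>\<^sup>+x. ennreal (f x) \<partial>sum_measure M N) = (\<integral>\<^sup>+x. ennreal (f x) \<partial>M) + (\<integral>\<^sup>+x. ennreal (f x) \<partial>N)"
    by (rule nn_integral_sum_measure[OF N]) (use f in measurable)
  show "integrable (sum_measure M N) f \<longleftrightarrow> integrable M f \<and> integrable N f"
    unfolding integrable_iff_bounded S using f nn by simp
  assume i: "integrable M f" "integrable N f"
  have e: "(\<integral>x. f x \<partial>L) = enn2real (\<integral>\<^sup>+x. ennreal (f x) \<partial>L)" if L: "borel_measurable L = (borel_measurable M :: ('a \<Rightarrow> real) set)" for L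
    by (rule integral_eq_nn_integral[OF f(1)[folded L]]) (use f(2) in auto)
  have "(\<integral>\<^sup>+x. ennreal (f x) \<partial>M) < top" "(\<integral>\<^sup>+x. ennreal (f x) \<partial>N) < top"
    using i f(2) unfolding integrable_iff_bounded by simp_all
  then show "(\<integral>x. f x \<partial>sum_measure M N) = (\<integral>x. f x \<partial>M) + (\<integral>x. f x \<partial>N)"
    unfolding e[OF S(1)] e[OF S(2)] e[OF refl] nn by (rule enn2real_plus)
qed

lemma radon_outer:
  assumes "radon_measure M" "B \<in> sets borel"
  shows "emeasure M B = (INF U\<in>{U. open U \<and> B \<subseteq> U}. emeasure M U)"
proof -
  have "\<forall>B\<in>sets borel. emeasure M B = (INF U\<in>{U. open U \<and> B \<subseteq> U}. emeasure M U)"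
    using assms(1) unfolding radon_measure_def by (elim conjE)
  then show ?thesis using assms(2) by (rule bspec)
qed

lemma radon_inner:
  assumes "radon_measure M" "open U"
  shows "emeasure M U = (SUP K\<in>{K. compact K \<and> K \<subseteq> U}. emeasure M K)"
proof -
  have "\<forall>U. open U \<longrightarrow> emeasure M U = (SUP K\<in>{K. compact K \<and> K \<subseteq> U}. emeasure M K)"
    using assms(1) unfolding radon_measure_def by (elim conjE)
  from spec[OF this, of U] assms(2) show ?thesis by (rule mp)
qed

text \<open>Open neighbourhoods for the two measures are intersected, compact subsets united; since
  the compact subsets are directed, the two suprema add.\<close>

lemma radon_sum_measure:
  fixes M N :: "'a :: t2_space measure"
  assumes M: "radon_measure M" and N: "radon_measure N"
  shows "radon_measure (sum_measure M N)"
proof -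
  have sM: "sets M = sets borel" and sN: "sets N = sets M" using radon_sets[OF M] radon_sets[OF N] by simp_all
  have em: "emeasure (sum_measure M N) B = emeasure M B + emeasure N B" if "B \<in> sets borel" for B
    by (rule emeasure_sum_measure[OF sN]) (simp add: sM that)
  have op: "U \<in> sets borel" if "open U" for U :: "'a set" using that by simp
  have cp: "K \<in> sets borel" if "compact K" for K :: "'a set" using that by (intro borel_closed compact_imp_closed)
  show ?thesis unfolding radon_measure_def
  proof (intro conjI allI impI ballI)
    show "sets (sum_measure M N) = sets borel" by (simp add: sM)
  next
    fix K :: "'a set" assume K: "compact K"
    show "emeasure (sum_measure M N) K < \<infinity>"
      unfolding em[OF cp[OF K]] using radon_compact[OF M K] radon_compact[OF N K] by simp
  next
    fix B :: "'a set" assume B: "B \<in> sets borel"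
    show "emeasure (sum_measure M N) B = (INF U\<in>{U. open U \<and> B \<subseteq> U}. emeasure (sum_measure M N) U)"
    proof (rule antisym)
      show "emeasure (sum_measure M N) B \<le> (INF U\<in>{U. open U \<and> B \<subseteq> U}. emeasure (sum_measure M N) U)"
        by (rule INF_greatest, rule emeasure_mono) (auto simp: sM)
      have oM: "emeasure M B = (INF U\<in>{U. open U \<and> B \<subseteq> U}. emeasure M U)"
        and oN: "emeasure N B = (INF U\<in>{U. open U \<and> B \<subseteq> U}. emeasure N U)"
        by (rule radon_outer[OF M B], rule radon_outer[OF N B])
      show "(INF U\<in>{U. open U \<and> B \<subseteq> U}. emeasure (sum_measure M N) U) \<le> emeasure (sum_measure M N) B"
      proof (rule ennreal_le_epsilon)
        fix e :: real assume fin: "emeasure (sum_measure M N) B < top" and e: "0 < e"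
        have finM: "emeasure M B < top" and finN: "emeasure N B < top" using fin unfolding em[OF B] by simp_all
        have "(INF U\<in>{U. open U \<and> B \<subseteq> U}. emeasure M U) < emeasure M B + ennreal (e/2)"
          using finM e unfolding oM[symmetric] by (simp add: ennreal_add_left_cancel_less)
        then obtain U where U: "open U" "B \<subseteq> U" "emeasure M U < emeasure M B + ennreal (e/2)"
          unfolding INF_less_iff by blast
        have "(INF U\<in>{U. open U \<and> B \<subseteq> U}. emeasure N U) < emeasure N B + ennreal (e/2)"
          using finN e unfolding oN[symmetric] by (simp add: ennreal_add_left_cancel_less)
        then obtain V where V: "open V" "B \<subseteq> V" "emeasure N V < emeasure N B + ennreal (e/2)"
          unfolding INF_less_iff by blast
        have "(INF U\<in>{U. open U \<and> B \<subseteq> U}. emeasure (sum_measure M N) U) \<le> emeasure (sum_measure M N) (U \<inter> V)"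
          by (rule INF_lower) (use U V in auto)
        also have "\<dots> = emeasure M (U \<inter> V) + emeasure N (U \<inter> V)" by (rule em) (use U V in auto)
        also have "\<dots> \<le> emeasure M U + emeasure N V"
          by (intro add_mono emeasure_mono) (use U V sM sN in auto)
        also have "\<dots> \<le> (emeasure M B + ennreal (e/2)) + (emeasure N B + ennreal (e/2))"
          using U V by (intro add_mono) auto
        also have "\<dots> = emeasure (sum_measure M N) B + ennreal e"
        proof -
          have "ennreal e = ennreal (e/2) + ennreal (e/2)" using e by (simp flip: ennreal_plus)
          then show ?thesis unfolding em[OF B] by (simp add: add_ac)
        qed
        finally show "(INF U\<in>{U. open U \<and> B \<subseteq> U}. emeasure (sum_measure M N) U) \<le> emeasure (sum_measure M N) B + ennreal e" .
      qed
    qed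
  next
    fix U :: "'a set" assume U: "open U"
    have iM: "emeasure M U = (SUP K\<in>{K. compact K \<and> K \<subseteq> U}. emeasure M K)"
      and iN: "emeasure N U = (SUP K\<in>{K. compact K \<and> K \<subseteq> U}. emeasure N K)"
      by (rule radon_inner[OF M U], rule radon_inner[OF N U])
    have "(SUP K\<in>{K. compact K \<and> K \<subseteq> U}. emeasure (sum_measure M N) K) =
        (SUP K\<in>{K. compact K \<and> K \<subseteq> U}. emeasure M K + emeasure N K)"
      by (intro SUP_cong refl em) (auto intro: cp)
    also have "\<dots> = emeasure M U + emeasure N U" unfolding iM iN
    proof (rule SUP_add_directed_ennreal)
      fix K L assume K: "K \<in> {K. compact K \<and> K \<subseteq> U}" and L: "L \<in> {K. compact K \<and> K \<subseteq> U}"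
      then have "compact (K \<union> L)" by (auto intro: compact_Un)
      then have "emeasure M K + emeasure N L \<le> emeasure M (K \<union> L) + emeasure N (K \<union> L)"
        by (intro add_mono emeasure_mono) (auto simp: sM sN intro: cp)
      then show "\<exists>k\<in>{K. compact K \<and> K \<subseteq> U}. emeasure M K + emeasure N L \<le> emeasure M k + emeasure N k"
        using K L by (intro bexI[of _ "K \<union> L"]) (auto intro: compact_Un)
    qed
    finally show "emeasure (sum_measure M N) U = (SUP K\<in>{K. compact K \<and> K \<subseteq> U}. emeasure (sum_measure M N) K)"
      by (simp add: em[OF op[OF U]])
  qed
qed

text \<open>Inner regularity beyond open sets: an open U around K - B of nearly the same measure
  leaves the compact set K - U inside B, and the loss lies in U - (K - B).\<close>

lemma radon_inner_compact:
  fixes \<sigma> :: "'a :: t2_space measure"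
  assumes \<sigma>: "radon_measure \<sigma>" and K: "compact K" and B: "B \<in> sets borel" "B \<subseteq> K" and e: "e > 0"
  obtains K' where "compact K'" "K' \<subseteq> B" "measure \<sigma> (B - K') \<le> e"
proof -
  have s: "sets \<sigma> = sets borel" by (rule radon_sets[OF \<sigma>])
  have Kb: "K \<in> sets borel" using K by (intro borel_closed compact_imp_closed)
  have D: "K - B \<in> sets borel" using Kb B(1) by (rule sets.Diff)
  have "emeasure \<sigma> (K - B) \<le> emeasure \<sigma> K" by (rule emeasure_mono) (auto simp: s Kb)
  then have fin: "emeasure \<sigma> (K - B) < top" using radon_compact[OF \<sigma> K] by (simp add: le_less_trans)
  then have "emeasure \<sigma> (K - B) < emeasure \<sigma> (K - B) + ennreal e"
    using e by (simp add: ennreal_add_left_cancel_less)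
  moreover have "emeasure \<sigma> (K - B) = (INF U\<in>{U. open U \<and> K - B \<subseteq> U}. emeasure \<sigma> U)"
    by (rule radon_outer[OF \<sigma> D])
  ultimately have "(INF U\<in>{U. open U \<and> K - B \<subseteq> U}. emeasure \<sigma> U) < emeasure \<sigma> (K - B) + ennreal e" by simp
  then obtain U where U: "open U" "K - B \<subseteq> U" "emeasure \<sigma> U < emeasure \<sigma> (K - B) + ennreal e"
    unfolding INF_less_iff by blast
  have Ub: "U \<in> sets borel" using U(1) by simp
  have "emeasure \<sigma> (B - (K - U)) \<le> emeasure \<sigma> (U - (K - B))"
    by (rule emeasure_mono) (use B Ub D s in auto)
  also have "\<dots> = emeasure \<sigma> U - emeasure \<sigma> (K - B)"
    by (rule emeasure_Diff) (use fin U(2) Ub D s in auto)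
  also have "\<dots> \<le> ennreal e" using U(3) fin by (intro ennreal_minus_le_iff[THEN iffD2]) (auto simp: less_imp_le add.commute)
  finally have "measure \<sigma> (B - (K - U)) \<le> e" unfolding measure_def using e by (intro enn2real_leI) auto
  moreover have "compact (K - U)" by (rule compact_diff[OF K U(1)])
  moreover have "K - U \<subseteq> B" using U(2) by blast
  ultimately show ?thesis by (intro that)
qed

lemma integrable_bounded_mult:
  fixes w f :: "'a \<Rightarrow> real"
  assumes "integrable M f" "w \<in> borel_measurable M" "\<And>x. \<bar>w x\<bar> \<le> c"
  shows "integrable M (\<lambda>x. w x * f x)"
proof (rule Bochner_Integration.integrable_bound)
  show "integrable M (\<lambda>x. c * f x)" using assms(1) by simp
  show "(\<lambda>x. w x * f x) \<in> borel_measurable M"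
    using assms(2) borel_measurable_integrable[OF assms(1)] by (rule borel_measurable_times)
  have "\<bar>w x\<bar> \<le> \<bar>c\<bar>" for x using assms(3)[of x] by linarith
  then show "AE x in M. norm (w x * f x) \<le> norm (c * f x)"
    by (intro AE_I2) (simp add: abs_mult mult_right_mono)
qed

text \<open>The sets \<open>{|F|\<^sup>2 > 1/(n+1)}\<close> are open with finite measure, so inner regularity applies to them
  although the space need not be \<open>\<sigma>\<close>-compact.\<close>

lemma radon_compact_tail:
  fixes F :: "'a :: t2_space \<Rightarrow> complex"
  assumes \<sigma>: "radon_measure \<sigma>" and F: "continuous_on UNIV F" "\<And>x. cmod (F x) \<le> B" "sq_integrable \<sigma> F" and e: "e > 0"
  obtains K where "compact K" "(\<integral>x. indicator (- K) x * (cmod (F x))\<^sup>2 \<partial>\<sigma>) \<le> e"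
proof -
  define g where "g x = (cmod (F x))\<^sup>2" for x
  have s: "sets \<sigma> = sets borel" by (rule radon_sets[OF \<sigma>])
  have sp: "space \<sigma> = UNIV" using sets_eq_imp_space_eq[OF s] by simp
  have g: "continuous_on UNIV g" unfolding g_def by (intro continuous_intros F)
  have gi: "integrable \<sigma> g" using F(3) unfolding sq_integrable_def g_def by simp
  have g0: "0 \<le> g x" for x unfolding g_def by simp
  have gB: "g x \<le> B\<^sup>2" for x unfolding g_def using F(2)[of x] by (intro power_mono) auto
  define W where "W n = {x. 1 / real (Suc n) < g x}" for n
  have oW: "open (W n)" for n unfolding W_def using g by (intro open_Collect_less continuous_intros)
  have Ws: "W n \<in> sets \<sigma>" for n using oW s by simp
  \<comment> \<open>The complements of the sets W n shrink to the zero set of g, so the integral of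
    g over them tends to 0.\<close>
  have "(\<lambda>n. \<integral>x. indicator (- W n) x * g x \<partial>\<sigma>) \<longlonglongrightarrow> (\<integral>x. 0 \<partial>\<sigma>)"
  proof (rule integral_dominated_convergence[where w = g])
    show "(\<lambda>x. indicator (- W n) x * g x) \<in> borel_measurable \<sigma>" for n
    proof -
      have "- W n \<in> sets \<sigma>" using sets.compl_sets[OF Ws[of n]] sp by (simp add: Compl_eq_Diff_UNIV)
      then show ?thesis using gi by measurable
    qed
    show "AE x in \<sigma>. (\<lambda>n. indicator (- W n) x * g x) \<longlonglongrightarrow> 0"
    proof (rule AE_I2)
      fix x
      show "(\<lambda>n. indicator (- W n) x * g x) \<longlonglongrightarrow> 0"
      proof (cases "g x = 0")
        case False
        then have "g x > 0" using g0[of x] by simp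
        then obtain N where N: "1 / real (Suc N) < g x"
          using reals_Archimedean by (auto simp: inverse_eq_divide)
        have "x \<in> W n" if "n \<ge> N" for n
        proof -
          have "1 / real (Suc n) \<le> 1 / real (Suc N)" using that by (simp add: frac_le)
          then show ?thesis using N unfolding W_def by simp
        qed
        then have "\<forall>\<^sub>F n in sequentially. indicator (- W n) x * g x = 0"
          unfolding eventually_sequentially by (intro exI[of _ N]) simp
        then show ?thesis by (rule tendsto_eventually)
      qed simp
    qed
    show "AE x in \<sigma>. norm (indicator (- W n) x * g x) \<le> g x" for n
      using g0 by (intro AE_I2) (auto simp: indicator_def)
  qed (use gi in auto)
  then have "(\<lambda>n. \<integral>x. indicator (- W n) x * g x \<partial>\<sigma>) \<longlonglongrightarrow> 0" by simp
  moreover have "e / 2 > 0" using e by simp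
  ultimately have "\<forall>\<^sub>F n in sequentially. (\<integral>x. indicator (- W n) x * g x \<partial>\<sigma>) < e / 2"
    by (rule order_tendstoD(2))
  then obtain n where n: "(\<integral>x. indicator (- W n) x * g x \<partial>\<sigma>) < e / 2"
    unfolding eventually_sequentially by blast
  \<comment> \<open>Markov's inequality: on W n the indicator is at most (n + 1) * g, so W n has
    finite measure.\<close>
  have "integrable \<sigma> (indicator (W n) :: 'a \<Rightarrow> real)"
  proof (rule Bochner_Integration.integrable_bound)
    show "integrable \<sigma> (\<lambda>x. real (Suc n) * g x)" using gi by simp
    show "(indicator (W n) :: 'a \<Rightarrow> real) \<in> borel_measurable \<sigma>" using Ws by measurable
    show "AE x in \<sigma>. norm (indicator (W n) x :: real) \<le> norm (real (Suc n) * g x)"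
    proof (rule AE_I2)
      fix x
      have "1 \<le> real (Suc n) * g x" if "x \<in> W n"
        using that unfolding W_def by (simp add: field_simps)
      then show "norm (indicator (W n) x :: real) \<le> norm (real (Suc n) * g x)"
        using g0[of x] by (cases "x \<in> W n") auto
    qed
  qed
  then have fin: "emeasure \<sigma> (W n) < top" unfolding integrable_indicator_iff using sp by simp
  \<comment> \<open>g is at most the square of B, so discarding a set of measure d from W n costs at
    most e / 2.\<close>
  define d where "d = e / (2 * (B\<^sup>2 + 1))"
  have d: "d > 0" "B\<^sup>2 * d \<le> e / 2" unfolding d_def using e by (auto simp: field_simps add_pos_nonneg intro!: divide_pos_pos)
  have "\<exists>K. compact K \<and> K \<subseteq> W n \<and> emeasure \<sigma> (W n) \<le> emeasure \<sigma> K + ennreal d"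
  proof (cases "emeasure \<sigma> (W n) \<le> ennreal d")
    case True
    then show ?thesis by (intro exI[of _ "{}"]) simp
  next
    case False
    then have "emeasure \<sigma> (W n) - ennreal d < emeasure \<sigma> (W n)"
      using fin d by (intro ennreal_between) (auto simp: not_le intro: le_less_trans)
    also have "\<dots> = (SUP K\<in>{K. compact K \<and> K \<subseteq> W n}. emeasure \<sigma> K)"
      by (rule radon_inner[OF \<sigma> oW])
    finally obtain K where "compact K" "K \<subseteq> W n" "emeasure \<sigma> (W n) - ennreal d < emeasure \<sigma> K"
      unfolding less_SUP_iff by blast
    moreover from this have "emeasure \<sigma> (W n) \<le> ennreal d + emeasure \<sigma> K"
      using ennreal_minus_le_iff[of "emeasure \<sigma> (W n)" "ennreal d" "emeasure \<sigma> K"] by (simp add: less_imp_le)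
    ultimately show ?thesis by (intro exI[of _ K]) (simp add: add.commute)
  qed
  then obtain K where K: "compact K" "K \<subseteq> W n" "emeasure \<sigma> (W n) \<le> emeasure \<sigma> K + ennreal d" by blast
  have Ks: "K \<in> sets \<sigma>" using K(1) s by (auto intro: borel_closed compact_imp_closed)
  have "emeasure \<sigma> (W n - K) = emeasure \<sigma> (W n) - emeasure \<sigma> K"
    by (rule emeasure_Diff) (use radon_compact[OF \<sigma> K(1)] K(2) Ws Ks in auto)
  also have "\<dots> \<le> ennreal d" using K(3) radon_compact[OF \<sigma> K(1)] by (intro ennreal_minus_le_iff[THEN iffD2]) auto
  finally have WK: "emeasure \<sigma> (W n - K) \<le> ennreal d" .
  have D: "W n - K \<in> sets \<sigma>" using Ws Ks by (rule sets.Diff)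
  have Di: "integrable \<sigma> (indicator (W n - K) :: 'a \<Rightarrow> real)"
    unfolding integrable_indicator_iff using D WK sp by (simp add: le_less_trans)
  have mi: "integrable \<sigma> (\<lambda>x. indicator S x * g x)" if "S \<in> sets \<sigma>" for S
    by (rule integrable_bounded_mult[OF gi borel_measurable_indicator[OF that], of 1]) (simp add: indicator_def)
  have c1: "- K \<in> sets \<sigma>" using sets.compl_sets[OF Ks] sp by (simp add: Compl_eq_Diff_UNIV)
  have c2: "- W n \<in> sets \<sigma>" using sets.compl_sets[OF Ws[of n]] sp by (simp add: Compl_eq_Diff_UNIV)
  have "(\<integral>x. indicator (- K) x * g x \<partial>\<sigma>) \<le> (\<integral>x. indicator (- W n) x * g x + B\<^sup>2 * indicator (W n - K) x \<partial>\<sigma>)"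
  proof (rule Bochner_Integration.integral_mono)
    show "integrable \<sigma> (\<lambda>x. indicator (- W n) x * g x + B\<^sup>2 * indicator (W n - K) x)"
      using mi[OF c2] Di by simp
    show "indicator (- K) x * g x \<le> indicator (- W n) x * g x + B\<^sup>2 * indicator (W n - K) x" for x
      using gB[of x] g0[of x] K(2) by (auto simp: indicator_def)
  qed (rule mi[OF c1])
  also have "\<dots> = (\<integral>x. indicator (- W n) x * g x \<partial>\<sigma>) + B\<^sup>2 * measure \<sigma> (W n - K)"
    using mi[OF c2] Di sp by simp
  also have "\<dots> \<le> e / 2 + e / 2"
  proof (rule add_mono)
    have "measure \<sigma> (W n - K) \<le> d" unfolding measure_def using WK d(1) by (intro enn2real_leI) auto
    then have "B\<^sup>2 * measure \<sigma> (W n - K) \<le> B\<^sup>2 * d" by (intro mult_left_mono) auto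
    then show "B\<^sup>2 * measure \<sigma> (W n - K) \<le> e / 2" using d(2) by linarith
  qed (use n in simp)
  finally show ?thesis using K(1) unfolding g_def by (intro that[of K]) simp_all
qed

text \<open>Density of trigonometric polynomials in a weighted L^2 space, for indicators. A compact
  K carries almost all of the weight, compact sets exhaust S and its complement within K up to
  measure d, and the polynomial is close to 1 and to 0 on them. On the small remainder its global
  bound suffices.\<close>

lemma trig_approx_indicator:
  fixes F :: "'a :: topological_ab_group_add dual \<Rightarrow> complex"
  assumes \<sigma>: "radon_measure \<sigma>" and F: "continuous_on UNIV F" "\<And>x. cmod (F x) \<le> B" "sq_integrable \<sigma> F"
    and S: "S \<in> sets borel" and e: "e > 0"
  obtains f where "f \<in> real_trig" "\<And>\<xi>. \<bar>f \<xi>\<bar> \<le> 2" "(\<integral>\<xi>. (f \<xi> - indicator S \<xi>)\<^sup>2 * (cmod (F \<xi>))\<^sup>2 \<partial>\<sigma>) \<le> e"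
proof -
  define g where "g \<xi> = (cmod (F \<xi>))\<^sup>2" for \<xi>
  define G where "G = (\<integral>\<xi>. g \<xi> \<partial>\<sigma>)"
  have s: "sets \<sigma> = sets borel" by (rule radon_sets[OF \<sigma>])
  have sp: "space \<sigma> = UNIV" using sets_eq_imp_space_eq[OF s] by simp
  have gi: "integrable \<sigma> g" using F(3) unfolding sq_integrable_def g_def by simp
  have g0: "0 \<le> g \<xi>" and gB: "g \<xi> \<le> B\<^sup>2" for \<xi> unfolding g_def using F(2)[of \<xi>] by (auto intro!: power_mono)
  have G: "G \<ge> 0" unfolding G_def using g0 by (intro Bochner_Integration.integral_nonneg) auto
  \<comment> \<open>As |f| is at most 2, the squared difference is at most 9 everywhere. The tail
    outside K costs 9 * d, and each of the two leftover sets costs 9 * d times the square of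
    B.\<close>
  define c where "c = 9 + 18 * B\<^sup>2"
  have c: "c > 0" unfolding c_def by (intro add_pos_nonneg) auto
  define d where "d = e / (2 * c)"
  have d: "d > 0" "c * d = e / 2" unfolding d_def using e c by auto
  \<comment> \<open>Tolerance on K1 and K2. The cap at 1 is required by
    \<open>real_trig_separation\<close> and lets r^2 be bounded by r.\<close>
  define r where "r = min 1 (e / (2 * (G + 1)))"
  have r: "0 < r" "r \<le> 1" unfolding r_def using e G by auto
  have rG: "r\<^sup>2 * G \<le> e / 2"
  proof -
    have "r\<^sup>2 * G \<le> r * G" using r G by (intro mult_right_mono) (auto simp: power2_eq_square mult_left_le_one_le)
    also have "\<dots> \<le> e / (2 * (G + 1)) * G" using G unfolding r_def by (intro mult_right_mono) auto
    also have "\<dots> \<le> e / 2" using e G by (simp add: field_simps)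
    finally show ?thesis .
  qed
  obtain K where K: "compact K" "(\<integral>\<xi>. indicator (- K) \<xi> * g \<xi> \<partial>\<sigma>) \<le> d"
    unfolding g_def by (rule radon_compact_tail[OF \<sigma> F d(1)])
  have Kb: "K \<in> sets borel" using K(1) by (intro borel_closed compact_imp_closed)
  obtain K1 where K1: "compact K1" "K1 \<subseteq> S \<inter> K" "measure \<sigma> (S \<inter> K - K1) \<le> d"
    by (rule radon_inner_compact[OF \<sigma> K(1) _ _ d(1), of "S \<inter> K"]) (use S Kb in auto)
  obtain K2 where K2: "compact K2" "K2 \<subseteq> K - S" "measure \<sigma> (K - S - K2) \<le> d"
    by (rule radon_inner_compact[OF \<sigma> K(1) _ _ d(1), of "K - S"]) (use S Kb in auto)
  have "K1 \<inter> K2 = {}" using K1(2) K2(2) by blast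
  then obtain f where f: "f \<in> real_trig" "\<And>\<xi>. \<bar>f \<xi>\<bar> \<le> 2" "\<And>\<xi>. \<xi> \<in> K1 \<Longrightarrow> \<bar>f \<xi> - 1\<bar> \<le> r" "\<And>\<xi>. \<xi> \<in> K2 \<Longrightarrow> \<bar>f \<xi>\<bar> \<le> r"
    using r by (rule real_trig_separation[OF K1(1) K2(1)]) blast
  have b: "K1 \<in> sets borel" "K2 \<in> sets borel" using K1(1) K2(1) by (auto intro: borel_closed compact_imp_closed)
  have ss: "S \<in> sets \<sigma>" "- K \<in> sets \<sigma>" "S \<inter> K - K1 \<in> sets \<sigma>" "K - S - K2 \<in> sets \<sigma>"
    unfolding s using S Kb b borel_comp[OF Kb] by auto
  have fin: "emeasure \<sigma> T < top" if "T \<subseteq> K" "T \<in> sets \<sigma>" for T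
    using emeasure_mono[of T K \<sigma>] radon_compact[OF \<sigma> K(1)] that Kb s by (simp add: le_less_trans)
  have Ti: "integrable \<sigma> (indicator (S \<inter> K - K1) :: _ \<Rightarrow> real)" "integrable \<sigma> (indicator (K - S - K2) :: _ \<Rightarrow> real)"
    unfolding integrable_indicator_iff using ss(3,4) sp fin[OF _ ss(3)] fin[OF _ ss(4)] by auto
  have fm: "f \<in> borel_measurable \<sigma>" by (rule radon_continuous_measurable[OF \<sigma> real_trig_continuous[OF f(1)]])
  have Ki: "integrable \<sigma> (\<lambda>\<xi>. indicator (- K) \<xi> * g \<xi>)"
    by (rule integrable_bounded_mult[OF gi borel_measurable_indicator[OF ss(2)], of 1]) (simp add: indicator_def)
  have nine: "(f \<xi> - indicator S \<xi>)\<^sup>2 \<le> 9" for \<xi>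
  proof -
    have "\<bar>f \<xi> - indicator S \<xi>\<bar> \<le> 3" using f(2)[of \<xi>] by (cases "\<xi> \<in> S") auto
    then have "\<bar>f \<xi> - indicator S \<xi>\<bar>\<^sup>2 \<le> 3\<^sup>2" by (intro power_mono) auto
    then show ?thesis by simp
  qed
  have "(\<integral>\<xi>. (f \<xi> - indicator S \<xi>)\<^sup>2 * g \<xi> \<partial>\<sigma>) \<le>
      (\<integral>\<xi>. (9 * (indicator (- K) \<xi> * g \<xi>) + r\<^sup>2 * g \<xi>) + (9 * B\<^sup>2 * indicator (S \<inter> K - K1) \<xi> + 9 * B\<^sup>2 * indicator (K - S - K2) \<xi>) \<partial>\<sigma>)"
  proof (rule Bochner_Integration.integral_mono)
    show "integrable \<sigma> (\<lambda>\<xi>. (f \<xi> - indicator S \<xi>)\<^sup>2 * g \<xi>)"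
      by (rule integrable_bounded_mult[OF gi, of _ 9]) (use fm ss(1) nine in auto)
    show "integrable \<sigma> (\<lambda>\<xi>. (9 * (indicator (- K) \<xi> * g \<xi>) + r\<^sup>2 * g \<xi>) + (9 * B\<^sup>2 * indicator (S \<inter> K - K1) \<xi> + 9 * B\<^sup>2 * indicator (K - S - K2) \<xi>))"
      using Ki gi Ti by (intro Bochner_Integration.integrable_add integrable_mult_right)
    fix \<xi>
    have n9: "(f \<xi> - indicator S \<xi>)\<^sup>2 * g \<xi> \<le> 9 * g \<xi>" using nine[of \<xi>] g0[of \<xi>] by (rule mult_right_mono)
    consider "\<xi> \<notin> K" | "\<xi> \<in> S \<inter> K - K1" | "\<xi> \<in> K - S - K2" | "\<xi> \<in> K1" | "\<xi> \<in> K2" by blast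
    then show "(f \<xi> - indicator S \<xi>)\<^sup>2 * g \<xi> \<le>
      (9 * (indicator (- K) \<xi> * g \<xi>) + r\<^sup>2 * g \<xi>) + (9 * B\<^sup>2 * indicator (S \<inter> K - K1) \<xi> + 9 * B\<^sup>2 * indicator (K - S - K2) \<xi>)"
    proof cases
      case 1
      then show ?thesis using n9 g0[of \<xi>] by (simp add: add_increasing2)
    next
      case 2
      then show ?thesis using n9 gB[of \<xi>] g0[of \<xi>] by (simp add: add_nonneg_nonneg add_increasing)
    next
      case 3
      then show ?thesis using n9 gB[of \<xi>] g0[of \<xi>] by (simp add: add_nonneg_nonneg add_increasing)
    next
      case 4
      have "\<bar>f \<xi> - indicator S \<xi>\<bar>\<^sup>2 \<le> r\<^sup>2" using f(3)[OF 4] K1(2) 4 by (intro power_mono) (auto simp: indicator_def)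
      then have "(f \<xi> - indicator S \<xi>)\<^sup>2 * g \<xi> \<le> r\<^sup>2 * g \<xi>" using g0[of \<xi>] by (intro mult_right_mono) auto
      then show ?thesis using g0[of \<xi>] by (simp add: add_increasing add_increasing2)
    next
      case 5
      have "\<bar>f \<xi> - indicator S \<xi>\<bar>\<^sup>2 \<le> r\<^sup>2" using f(4)[OF 5] K2(2) 5 by (intro power_mono) (auto simp: indicator_def)
      then have "(f \<xi> - indicator S \<xi>)\<^sup>2 * g \<xi> \<le> r\<^sup>2 * g \<xi>" using g0[of \<xi>] by (intro mult_right_mono) auto
      then show ?thesis using g0[of \<xi>] by (simp add: add_increasing add_increasing2)
    qed
  qed
  also have "\<dots> = (9 * (\<integral>\<xi>. indicator (- K) \<xi> * g \<xi> \<partial>\<sigma>) + r\<^sup>2 * G) + (9 * B\<^sup>2 * measure \<sigma> (S \<inter> K - K1) + 9 * B\<^sup>2 * measure \<sigma> (K - S - K2))"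
    using Ki gi Ti sp unfolding G_def by simp
  also have "\<dots> \<le> (9 * d + r\<^sup>2 * G) + (9 * B\<^sup>2 * d + 9 * B\<^sup>2 * d)"
    using K(2) K1(3) K2(3) by (intro add_mono mult_left_mono) auto
  also have "\<dots> = c * d + r\<^sup>2 * G" unfolding c_def by (simp add: algebra_simps)
  also have "\<dots> \<le> e" unfolding d(2) using rG by simp
  finally show ?thesis using f(1,2) unfolding g_def by (intro that)
qed

lemma sum_measure3:
  fixes F :: "'a :: t2_space \<Rightarrow> complex"
  assumes r: "radon_measure \<rho>1" "radon_measure \<rho>2" "radon_measure \<rho>3" and F: "continuous_on UNIV F"
    and sq: "sq_integrable \<rho>1 F" "sq_integrable \<rho>2 F" "sq_integrable \<rho>3 F"
  shows "sq_integrable (sum_measure (sum_measure \<rho>1 \<rho>2) \<rho>3) F"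
    and "(\<integral>x. (cmod (F x))\<^sup>2 \<partial>sum_measure (sum_measure \<rho>1 \<rho>2) \<rho>3) =
      (\<integral>x. (cmod (F x))\<^sup>2 \<partial>\<rho>1) + (\<integral>x. (cmod (F x))\<^sup>2 \<partial>\<rho>2) + (\<integral>x. (cmod (F x))\<^sup>2 \<partial>\<rho>3)"
proof -
  have r12: "radon_measure (sum_measure \<rho>1 \<rho>2)" by (rule radon_sum_measure[OF r(1,2)])
  have s: "sets \<rho>2 = sets \<rho>1" "sets \<rho>3 = sets (sum_measure \<rho>1 \<rho>2)" using r by (simp_all add: radon_sets)
  define g where "g x = (cmod (F x))\<^sup>2" for x
  have gc: "continuous_on UNIV g" unfolding g_def by (intro continuous_intros F)
  have gi: "integrable \<rho>1 g" "integrable \<rho>2 g" "integrable \<rho>3 g" using sq unfolding sq_integrable_def g_def by simp_all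
  have g0: "0 \<le> g x" for x unfolding g_def by simp
  note m1 = radon_continuous_measurable[OF r(1) gc] and m12 = radon_continuous_measurable[OF r12 gc]
  have i12: "integrable (sum_measure \<rho>1 \<rho>2) g" using gi integrable_sum_measure(1)[OF s(1) m1 g0] by blast
  have "integrable (sum_measure (sum_measure \<rho>1 \<rho>2) \<rho>3) g"
    using gi(3) i12 integrable_sum_measure(1)[OF s(2) m12 g0] by blast
  then show "sq_integrable (sum_measure (sum_measure \<rho>1 \<rho>2) \<rho>3) F"
    unfolding sq_integrable_def g_def using radon_continuous_measurable[OF radon_sum_measure[OF r12 r(3)] F] by blast
  show "(\<integral>x. (cmod (F x))\<^sup>2 \<partial>sum_measure (sum_measure \<rho>1 \<rho>2) \<rho>3) =
      (\<integral>x. (cmod (F x))\<^sup>2 \<partial>\<rho>1) + (\<integral>x. (cmod (F x))\<^sup>2 \<partial>\<rho>2) + (\<integral>x. (cmod (F x))\<^sup>2 \<partial>\<rho>3)"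
    using integrable_sum_measure(2)[OF s(2) m12 g0 i12 gi(3)] integrable_sum_measure(2)[OF s(1) m1 g0 gi(1,2)]
    unfolding g_def by simp
qed

section \<open>Translation-invariant forms over a discrete dual group\<close>

text \<open>The index set may be uncountable. If the finite sums are bounded, each set where f
  exceeds 1 / (n + 1) is finite, and monotone convergence along these sets reduces the integral to
  finite sums.\<close>

lemma nn_integral_count_space_SUP:
  fixes f :: "'a \<Rightarrow> ennreal"
  shows "(\<integral>\<^sup>+x. f x \<partial>count_space UNIV) = (SUP F\<in>{F. finite F}. \<Sum>x\<in>F. f x)"
proof (rule antisym)
  define M where "M = (SUP F\<in>{F. finite F}. \<Sum>x\<in>F. f x)"
  have fs: "(\<integral>\<^sup>+x. f x * indicator F x \<partial>count_space UNIV) = (\<Sum>x\<in>F. f x)" if "finite F" for F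
    using nn_integral_indicator_finite[OF that, of "count_space UNIV" f] by simp
  show "(\<integral>\<^sup>+x. f x \<partial>count_space UNIV) \<le> (SUP F\<in>{F. finite F}. \<Sum>x\<in>F. f x)"
  proof (cases "M = top")
    case True
    then show ?thesis unfolding M_def[symmetric] by simp
  next
    case False
    then obtain m where m: "M = ennreal m" "m \<ge> 0" by (metis ennreal_cases)
    define E where "E n = {x. ennreal (1 / real (Suc n)) < f x}" for n
    have card: "real (card F) \<le> m * real (Suc n)" if F: "finite F" "F \<subseteq> E n" for F n
    proof -
      have "ennreal (real (card F) * (1 / real (Suc n))) = (\<Sum>x\<in>F. ennreal (1 / real (Suc n)))"
        by (subst sum_ennreal) (simp_all del: of_nat_Suc)
      also have "\<dots> \<le> (\<Sum>x\<in>F. f x)" using F(2) unfolding E_def by (intro sum_mono) (auto intro: less_imp_le)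
      also have "\<dots> \<le> M" unfolding M_def using F(1) by (intro SUP_upper) simp
      finally have "real (card F) * (1 / real (Suc n)) \<le> m" unfolding m using m(2) by (simp add: ennreal_le_iff)
      then show ?thesis by (simp add: field_simps)
    qed
    have finE: "finite (E n)" for n
    proof (rule ccontr)
      assume "infinite (E n)"
      then obtain F where F: "finite F" "F \<subseteq> E n" "card F = Suc (nat \<lceil>m * real (Suc n)\<rceil>)"
        using infinite_arbitrarily_large by blast
      from card[OF F(1,2)] show False unfolding F(3) by linarith
    qed
    have inc: "incseq (\<lambda>n x. f x * indicator (E n) x)"
    proof (rule incseq_SucI, rule le_funI)
      fix n x
      have "ennreal (1 / real (Suc (Suc n))) \<le> ennreal (1 / real (Suc n))" by (intro ennreal_leI) (simp add: frac_le)
      then have "E n \<subseteq> E (Suc n)" unfolding E_def by (intro subsetI) (simp only: mem_Collect_eq le_less_trans)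
      then show "f x * indicator (E n) x \<le> f x * indicator (E (Suc n)) x"
        by (auto simp: indicator_def)
    qed
    have lim: "(SUP n. f x * indicator (E n) x) = f x" for x
    proof (cases "f x = 0")
      case False
      have "\<exists>n. ennreal (1 / real (Suc n)) < f x"
      proof (cases "f x" rule: ennreal_cases)
        case (real r)
        then have "r > 0" using False by (cases "r = 0") auto
        then obtain n where "1 / real (Suc n) < r" using reals_Archimedean by (auto simp: inverse_eq_divide)
        then show ?thesis using real by (intro exI[of _ n]) (simp add: ennreal_less_iff)
      qed simp
      then obtain n where "ennreal (1 / real (Suc n)) < f x" ..
      then have "f x = f x * indicator (E n) x" unfolding E_def by simp
      then have "f x \<le> (SUP n. f x * indicator (E n) x)" by (metis SUP_upper UNIV_I)
      moreover have "(SUP n. f x * indicator (E n) x) \<le> f x"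
        by (intro SUP_least) (auto simp: indicator_def)
      ultimately show ?thesis by (rule antisym[rotated])
    qed simp
    have "(\<integral>\<^sup>+x. f x \<partial>count_space UNIV) = (\<integral>\<^sup>+x. (SUP n. f x * indicator (E n) x) \<partial>count_space UNIV)"
      unfolding lim ..
    also have "\<dots> = (SUP n. (\<integral>\<^sup>+x. f x * indicator (E n) x \<partial>count_space UNIV))"
      by (rule nn_integral_monotone_convergence_SUP[OF inc]) simp
    also have "\<dots> \<le> M" unfolding fs[OF finE] M_def using finE by (intro SUP_least SUP_upper) simp
    finally show ?thesis unfolding M_def .
  qed
  show "(SUP F\<in>{F. finite F}. \<Sum>x\<in>F. f x) \<le> (\<integral>\<^sup>+x. f x \<partial>count_space UNIV)"
  proof (rule SUP_least)
    fix F :: "'a set" assume "F \<in> {F. finite F}"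
    then have "(\<Sum>x\<in>F. f x) = (\<integral>\<^sup>+x. f x * indicator F x \<partial>count_space UNIV)" using fs by simp
    also have "\<dots> \<le> (\<integral>\<^sup>+x. f x \<partial>count_space UNIV)" by (intro nn_integral_mono) (auto simp: indicator_def)
    finally show "(\<Sum>x\<in>F. f x) \<le> (\<integral>\<^sup>+x. f x \<partial>count_space UNIV)" .
  qed
qed

lemma discrete_open: "(\<And>x :: 'a :: topological_space. open {x}) \<Longrightarrow> open (S :: 'a set)"
  using open_UN[of S "\<lambda>x. {x}"] by simp

lemma discrete_sets_borel:
  assumes "\<And>x :: 'a :: topological_space. open {x}" shows "sets (borel :: 'a measure) = UNIV"
  using discrete_open[OF assms] by (auto intro: borel_open)

lemma discrete_compact_finite:
  fixes K :: "'a :: topological_space set"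
  assumes "\<And>x :: 'a. open {x}" "compact K" shows "finite K"
proof -
  have "K \<subseteq> (\<Union>x\<in>K. {x})" by simp
  then obtain C where "C \<subseteq> K" "finite C" "K \<subseteq> (\<Union>x\<in>C. {x})"
    by (rule compactE_image[OF assms(2) assms(1)])
  then show ?thesis using finite_subset by simp
qed

text \<open>All subsets are open and the compact ones are finite, so outer regularity is trivial and
  inner regularity is the formula \<open>em\<close>: the mass of a set is the supremum over its
  finite subsets.\<close>

lemma radon_discrete:
  fixes w :: "'a :: t2_space \<Rightarrow> real"
  assumes disc: "\<And>x :: 'a. open {x}"
  shows "radon_measure (density (count_space UNIV) (\<lambda>x. ennreal (w x)))" (is "radon_measure ?\<rho>")
proof -
  have em: "emeasure ?\<rho> S = (SUP F\<in>{F. finite F \<and> F \<subseteq> S}. \<Sum>x\<in>F. ennreal (w x))" for S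
  proof -
    have "emeasure ?\<rho> S = (\<integral>\<^sup>+x. ennreal (w x) * indicator S x \<partial>count_space UNIV)"
      by (rule emeasure_density) simp_all
    also have "\<dots> = (SUP F\<in>{F. finite F}. \<Sum>x\<in>F. ennreal (w x) * indicator S x)"
      by (rule nn_integral_count_space_SUP)
    also have "\<dots> = (SUP F\<in>{F. finite F \<and> F \<subseteq> S}. \<Sum>x\<in>F. ennreal (w x))"
    proof (rule antisym; rule SUP_least)
      fix F :: "'a set" assume F: "F \<in> {F. finite F}"
      have "(\<Sum>x\<in>F. ennreal (w x) * indicator S x) = (\<Sum>x\<in>F \<inter> S. ennreal (w x))"
        using F by (simp add: sum.inter_restrict indicator_def if_distrib cong: if_cong) 
      also have "\<dots> \<le> (SUP F\<in>{F. finite F \<and> F \<subseteq> S}. \<Sum>x\<in>F. ennreal (w x))" using F by (intro SUP_upper) simp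
      finally show "(\<Sum>x\<in>F. ennreal (w x) * indicator S x) \<le> (SUP F\<in>{F. finite F \<and> F \<subseteq> S}. \<Sum>x\<in>F. ennreal (w x))" .
    next
      fix F assume F: "F \<in> {F. finite F \<and> F \<subseteq> S}"
      then have "(\<Sum>x\<in>F. ennreal (w x)) = (\<Sum>x\<in>F. ennreal (w x) * indicator S x)" by (intro sum.cong) auto
      also have "\<dots> \<le> (SUP F\<in>{F. finite F}. \<Sum>x\<in>F. ennreal (w x) * indicator S x)" using F by (intro SUP_upper) simp
      finally show "(\<Sum>x\<in>F. ennreal (w x)) \<le> (SUP F\<in>{F. finite F}. \<Sum>x\<in>F. ennreal (w x) * indicator S x)" .
    qed
    finally show ?thesis .
  qed
  have fin: "emeasure ?\<rho> F = (\<Sum>x\<in>F. ennreal (w x))" if "finite F" for F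
    unfolding em
  proof (rule antisym)
    show "(SUP E\<in>{E. finite E \<and> E \<subseteq> F}. \<Sum>x\<in>E. ennreal (w x)) \<le> (\<Sum>x\<in>F. ennreal (w x))"
      using that by (intro SUP_least sum_mono2) auto
    show "(\<Sum>x\<in>F. ennreal (w x)) \<le> (SUP E\<in>{E. finite E \<and> E \<subseteq> F}. \<Sum>x\<in>E. ennreal (w x))"
      using that by (intro SUP_upper) auto
  qed
  show ?thesis unfolding radon_measure_def
  proof (intro conjI allI impI ballI)
    show "sets ?\<rho> = sets borel" by (simp add: discrete_sets_borel[OF disc])
  next
    fix K :: "'a set" assume "compact K"
    then have "finite K" by (rule discrete_compact_finite[OF disc])
    then show "emeasure ?\<rho> K < \<infinity>" unfolding fin[OF \<open>finite K\<close>] by simp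
  next
    fix B :: "'a set"
    show "emeasure ?\<rho> B = (INF U\<in>{U. open U \<and> B \<subseteq> U}. emeasure ?\<rho> U)"
    proof (rule antisym)
      show "emeasure ?\<rho> B \<le> (INF U\<in>{U. open U \<and> B \<subseteq> U}. emeasure ?\<rho> U)"
        by (rule INF_greatest, rule emeasure_mono) auto
      show "(INF U\<in>{U. open U \<and> B \<subseteq> U}. emeasure ?\<rho> U) \<le> emeasure ?\<rho> B"
        by (rule INF_lower) (simp add: discrete_open[OF disc])
    qed
  next
    fix U :: "'a set"
    show "emeasure ?\<rho> U = (SUP K\<in>{K. compact K \<and> K \<subseteq> U}. emeasure ?\<rho> K)"
    proof (rule antisym)
      show "(SUP K\<in>{K. compact K \<and> K \<subseteq> U}. emeasure ?\<rho> K) \<le> emeasure ?\<rho> U"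
        by (rule SUP_least, rule emeasure_mono) auto
      show "emeasure ?\<rho> U \<le> (SUP K\<in>{K. compact K \<and> K \<subseteq> U}. emeasure ?\<rho> K)"
      proof (subst em, rule SUP_least)
        fix F assume "F \<in> {F. finite F \<and> F \<subseteq> U}"
        then have F: "finite F" "F \<subseteq> U" by auto
        have "(\<Sum>x\<in>F. ennreal (w x)) = emeasure ?\<rho> F" by (rule fin[OF F(1), symmetric])
        also have "\<dots> \<le> (SUP K\<in>{K. compact K \<and> K \<subseteq> U}. emeasure ?\<rho> K)"
          using F by (intro SUP_upper) (simp add: finite_imp_compact)
        finally show "(\<Sum>x\<in>F. ennreal (w x)) \<le> (SUP K\<in>{K. compact K \<and> K \<subseteq> U}. emeasure ?\<rho> K)" .
      qed
    qed
  qed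
qed

text \<open>The bound concerns w only where f is nonzero, so a polynomial that is small just on a
  finite set can be used against functions living there.\<close>

lemma L2norm_mult_le:
  assumes f: "sq_integrable M f" and w: "w \<in> borel_measurable M" and le: "\<And>x. cmod (w x * f x) \<le> c * cmod (f x)" and c: "0 \<le> c"
  shows "sq_integrable M (\<lambda>x. w x * f x)" "L2norm M (\<lambda>x. w x * f x) \<le> c * L2norm M f"
proof -
  have fm: "f \<in> borel_measurable M" and fi: "integrable M (\<lambda>x. (cmod (f x))\<^sup>2)" using f unfolding sq_integrable_def by auto
  have sq: "(cmod (w x * f x))\<^sup>2 \<le> c\<^sup>2 * (cmod (f x))\<^sup>2" for x
    using power_mono[OF le[of x] norm_ge_zero, of 2] by (simp add: power_mult_distrib)
  have wf: "(\<lambda>x. w x * f x) \<in> borel_measurable M" using w fm by (rule borel_measurable_times)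
  have i: "integrable M (\<lambda>x. (cmod (w x * f x))\<^sup>2)"
  proof (rule Bochner_Integration.integrable_bound)
    show "integrable M (\<lambda>x. c\<^sup>2 * (cmod (f x))\<^sup>2)" using fi by (rule integrable_mult_right)
    show "(\<lambda>x. (cmod (w x * f x))\<^sup>2) \<in> borel_measurable M"
      by (rule borel_measurable_power[OF measurable_compose[OF wf borel_measurable_norm]])
    show "AE x in M. norm ((cmod (w x * f x))\<^sup>2) \<le> norm (c\<^sup>2 * (cmod (f x))\<^sup>2)" using sq by simp
  qed
  with wf show "sq_integrable M (\<lambda>x. w x * f x)" unfolding sq_integrable_def by blast
  have "(\<integral>x. (cmod (w x * f x))\<^sup>2 \<partial>M) \<le> (\<integral>x. c\<^sup>2 * (cmod (f x))\<^sup>2 \<partial>M)"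
    by (rule Bochner_Integration.integral_mono[OF i integrable_mult_right[OF fi]]) (rule sq)
  also have "\<dots> = c\<^sup>2 * (\<integral>x. (cmod (f x))\<^sup>2 \<partial>M)" by (rule integral_mult_right_zero)
  finally have "sqrt (\<integral>x. (cmod (w x * f x))\<^sup>2 \<partial>M) \<le> sqrt (c\<^sup>2 * (\<integral>x. (cmod (f x))\<^sup>2 \<partial>M))" by (rule real_sqrt_le_mono)
  then show "L2norm M (\<lambda>x. w x * f x) \<le> c * L2norm M f" unfolding L2norm_def using c by (simp add: real_sqrt_mult)
qed

lemma L2norm_diff_triangle:
  assumes "sq_integrable M f" "sq_integrable M g" "sq_integrable M k"
  shows "L2norm M (\<lambda>x. f x - k x) \<le> L2norm M (\<lambda>x. f x - g x) + L2norm M (\<lambda>x. g x - k x)"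
  using L2norm_triangle[OF sq_integrable_diff[OF assms(1,2)] sq_integrable_diff[OF assms(2,3)]] by simp

lemma L2norm_diff_commute: "L2norm M (\<lambda>x. f x - g x) = L2norm M (\<lambda>x. g x - f x)"
  unfolding L2norm_def by (simp add: norm_minus_commute)

context
  fixes h :: "'a :: lca_group measure" and \<sigma> :: "'a dual measure"
    and B :: "('a \<Rightarrow> complex) \<Rightarrow> ('a \<Rightarrow> complex) \<Rightarrow> complex" and Q :: "('a \<Rightarrow> complex) \<Rightarrow> real" and C :: real
  assumes h: "haar_measure h" and \<sigma>: "radon_measure \<sigma>"
    and fsq: "\<And>\<phi>. \<phi> \<in> Cc \<Longrightarrow> sq_integrable \<sigma> (fourier_fun h \<phi>)"
    and disc: "\<And>\<xi> :: 'a dual. open {\<xi>}"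
    and B_add: "\<And>\<phi> \<psi> \<psi>'. \<phi> \<in> Cc \<Longrightarrow> \<psi> \<in> Cc \<Longrightarrow> \<psi>' \<in> Cc \<Longrightarrow> B \<phi> (\<lambda>x. \<psi> x + \<psi>' x) = B \<phi> \<psi> + B \<phi> \<psi>'"
    and B_adj: "\<And>\<phi> \<psi> xs. \<phi> \<in> Cc \<Longrightarrow> \<psi> \<in> Cc \<Longrightarrow> B \<phi> (trig_op (trig_adj xs) \<psi>) = B (trig_op xs \<phi>) \<psi>"
    and B_bound: "\<And>\<phi> \<psi>. \<phi> \<in> Cc \<Longrightarrow> \<psi> \<in> Cc \<Longrightarrow> cmod (B \<phi> \<psi>) \<le> C * (L2norm \<sigma> (fourier_fun h \<phi>) * L2norm \<sigma> (fourier_fun h \<psi>))"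
    and C: "C > 0"
    and Q_add: "\<And>\<phi> \<psi>. \<phi> \<in> Cc \<Longrightarrow> \<psi> \<in> Cc \<Longrightarrow> Q (\<lambda>x. \<phi> x + \<psi> x) = Q \<phi> + Q \<psi> + 2 * Re (B \<phi> \<psi>)"
    and Q_cmult: "\<And>\<phi> c. \<phi> \<in> Cc \<Longrightarrow> Q (\<lambda>x. c * \<phi> x) = (cmod c)\<^sup>2 * Q \<phi>"
    and Q_nonneg: "\<And>\<phi>. \<phi> \<in> Cc \<Longrightarrow> 0 \<le> Q \<phi>"
    and Q_bound: "\<And>\<phi>. \<phi> \<in> Cc \<Longrightarrow> Q \<phi> \<le> C * (L2norm \<sigma> (fourier_fun h \<phi>))\<^sup>2"
begin

lemma discrete_measurable: "f \<in> borel_measurable \<sigma>"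
  using radon_sets[OF \<sigma>] discrete_sets_borel[OF disc] by (auto intro!: measurableI)

text \<open>Here Q and B stand for the limits of squared means and of their polarisation, and
  \<sigma> for the measure that dominates them. The bound shows that Q depends only on the Fourier
  transform as an element of L^2(\<sigma>), and continuously, so Q can be followed along
  approximations of indicators.\<close>

lemma Q_diff_bound:
  assumes \<phi>: "\<phi> \<in> Cc" and \<psi>: "\<psi> \<in> Cc"
    and D: "L2norm \<sigma> (\<lambda>\<xi>. fourier_fun h \<phi> \<xi> - fourier_fun h \<psi> \<xi>) \<le> D"
  shows "\<bar>Q \<phi> - Q \<psi>\<bar> \<le> C * (D * (D + 2 * L2norm \<sigma> (fourier_fun h \<psi>)))"
proof -
  define \<delta> where "\<delta> = (\<lambda>x. \<phi> x + (- 1) * \<psi> x)"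
  have \<delta>: "\<delta> \<in> Cc" unfolding \<delta>_def by (rule Cc_add[OF \<phi> Cc_cmult[OF \<psi>]])
  have "fourier_fun h \<delta> \<xi> = fourier_fun h \<phi> \<xi> - fourier_fun h \<psi> \<xi>" for \<xi>
    unfolding \<delta>_def fourier_add[OF h \<phi> Cc_cmult[OF \<psi>]] fourier_cmult[OF h, of "- 1" \<psi>] by simp
  then have n\<delta>: "L2norm \<sigma> (fourier_fun h \<delta>) \<le> D" using D by (simp add: L2norm_def)
  have "\<phi> = (\<lambda>x. \<psi> x + \<delta> x)" unfolding \<delta>_def by simp
  then have "Q \<phi> - Q \<psi> = Q \<delta> + 2 * Re (B \<psi> \<delta>)" using Q_add[OF \<psi> \<delta>] by simp
  then have "\<bar>Q \<phi> - Q \<psi>\<bar> \<le> Q \<delta> + 2 * cmod (B \<psi> \<delta>)"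
    using Q_nonneg[OF \<delta>] abs_Re_le_cmod[of "B \<psi> \<delta>"] by linarith
  also have "\<dots> \<le> C * (L2norm \<sigma> (fourier_fun h \<delta>))\<^sup>2 + 2 * (C * (L2norm \<sigma> (fourier_fun h \<psi>) * L2norm \<sigma> (fourier_fun h \<delta>)))"
    by (intro add_mono mult_left_mono Q_bound B_bound \<delta> \<psi>) simp
  also have "\<dots> \<le> C * D\<^sup>2 + 2 * (C * (L2norm \<sigma> (fourier_fun h \<psi>) * D))"
    using C n\<delta> by (intro add_mono mult_left_mono power_mono L2norm_nonneg) auto
  also have "\<dots> = C * (D * (D + 2 * L2norm \<sigma> (fourier_fun h \<psi>)))"
    by (simp add: power2_eq_square algebra_simps)
  finally show ?thesis .
qed

text \<open>A real trigonometric polynomial that is close to \<open>1\<close> at \<open>\<xi>\<close> and close to \<open>0\<close> on \<open>F\<close> can be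
  inserted in one argument of \<open>B\<close> and moved to the other.\<close>

lemma B_orthogonal:
  assumes \<phi>: "\<And>n. \<phi> n \<in> Cc" and \<psi>: "\<And>n. \<psi> n \<in> Cc" and \<Phi>: "sq_integrable \<sigma> \<Phi>" and \<Psi>: "sq_integrable \<sigma> \<Psi>"
    and l\<phi>: "(\<lambda>n. L2norm \<sigma> (\<lambda>\<xi>. fourier_fun h (\<phi> n) \<xi> - \<Phi> \<xi>)) \<longlonglongrightarrow> 0"
    and l\<psi>: "(\<lambda>n. L2norm \<sigma> (\<lambda>\<xi>. fourier_fun h (\<psi> n) \<xi> - \<Psi> \<xi>)) \<longlonglongrightarrow> 0"
    and F: "finite F" "\<And>\<eta>. \<eta> \<notin> F \<Longrightarrow> \<Phi> \<eta> = 0" and \<xi>: "\<xi> \<notin> F" "\<And>\<eta>. \<eta> \<noteq> \<xi> \<Longrightarrow> \<Psi> \<eta> = 0"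
  shows "(\<lambda>n. B (\<phi> n) (\<psi> n)) \<longlonglongrightarrow> 0"
proof (rule tendstoI)
  fix e :: real assume e: "e > 0"
  define X where "X = L2norm \<sigma> \<Phi>"
  define Y where "Y = L2norm \<sigma> \<Psi>"
  have XY: "0 \<le> X" "0 \<le> Y" unfolding X_def Y_def by (rule L2norm_nonneg)+
  define q where "q = C * (2 * X * Y)"
  have q: "0 \<le> q" unfolding q_def using C XY by simp
  \<comment> \<open>In the limit only r * q survives of the bound below, and this r makes it smaller
    than e.\<close>
  define r where "r = min 1 (e / (2 * (q + 1)))"
  have r: "0 < r" "r \<le> 1" unfolding r_def using e q by auto
  have "r * q \<le> e / (2 * (q + 1)) * q" using q unfolding r_def by (intro mult_right_mono) auto
  also have "\<dots> < e" using e q by (simp add: field_simps add_nonneg_pos)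
  finally have re: "r * (C * (2 * X * Y)) < e" unfolding q_def .
  have sep: "compact {\<xi>}" "compact F" "{\<xi>} \<inter> F = {}" using F(1) \<xi>(1) by (simp_all add: finite_imp_compact)
  obtain f where f: "f \<in> real_trig" "\<And>\<eta>. \<bar>f \<eta>\<bar> \<le> 2" "\<And>\<eta>. \<eta> \<in> {\<xi>} \<Longrightarrow> \<bar>f \<eta> - 1\<bar> \<le> r" "\<And>\<eta>. \<eta> \<in> F \<Longrightarrow> \<bar>f \<eta>\<bar> \<le> r"
    by (rule real_trig_separation[OF sep r]) blast
  obtain xs where xs: "\<And>\<eta>. trig_sym xs \<eta> = complex_of_real (f \<eta>)" using f(1) unfolding real_trig_def by blast
  define a where "a n = L2norm \<sigma> (\<lambda>\<eta>. fourier_fun h (\<phi> n) \<eta> - \<Phi> \<eta>)" for n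
  define b where "b n = L2norm \<sigma> (\<lambda>\<eta>. fourier_fun h (\<psi> n) \<eta> - \<Psi> \<eta>)" for n
  have bound: "cmod (B (\<phi> n) (\<psi> n)) \<le> C * ((a n + X) * (3 * b n + r * Y)) + C * ((2 * a n + r * X) * (b n + Y))" for n
  proof -
    define c where "c = trig_op (trig_adj xs) (\<psi> n)"
    define d where "d = (\<lambda>x. \<psi> n x + (- 1) * c x)"
    define k where "k = trig_op xs (\<phi> n)"
    have c: "c \<in> Cc" and k: "k \<in> Cc" unfolding c_def k_def by (rule trig_op_Cc[OF \<psi>], rule trig_op_Cc[OF \<phi>])
    have d: "d \<in> Cc" unfolding d_def by (rule Cc_add[OF \<psi> Cc_cmult[OF c]])
    have s\<phi>: "sq_integrable \<sigma> (\<lambda>\<eta>. fourier_fun h (\<phi> n) \<eta> - \<Phi> \<eta>)" by (rule sq_integrable_diff[OF fsq[OF \<phi>] \<Phi>])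
    have s\<psi>: "sq_integrable \<sigma> (\<lambda>\<eta>. fourier_fun h (\<psi> n) \<eta> - \<Psi> \<eta>)" by (rule sq_integrable_diff[OF fsq[OF \<psi>] \<Psi>])
    have n\<phi>: "L2norm \<sigma> (fourier_fun h (\<phi> n)) \<le> a n + X"
      using L2norm_triangle[OF s\<phi> \<Phi>] unfolding a_def X_def by simp
    have n\<psi>: "L2norm \<sigma> (fourier_fun h (\<psi> n)) \<le> b n + Y"
      using L2norm_triangle[OF s\<psi> \<Psi>] unfolding b_def Y_def by simp
    have kF: "fourier_fun h k = (\<lambda>\<eta>. complex_of_real (f \<eta>) * (fourier_fun h (\<phi> n) \<eta> - \<Phi> \<eta>) + complex_of_real (f \<eta>) * \<Phi> \<eta>)"
      unfolding k_def fourier_trig_op[OF h \<phi>] xs by (simp add: algebra_simps)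
    have cF: "fourier_fun h c \<eta> = complex_of_real (f \<eta>) * fourier_fun h (\<psi> n) \<eta>" for \<eta>
      unfolding c_def fourier_trig_op[OF h \<psi>] trig_sym_adj xs by simp
    have dF: "fourier_fun h d = (\<lambda>\<eta>. complex_of_real (1 - f \<eta>) * (fourier_fun h (\<psi> n) \<eta> - \<Psi> \<eta>) + complex_of_real (1 - f \<eta>) * \<Psi> \<eta>)"
      unfolding d_def fourier_add[OF h \<psi> Cc_cmult[OF c]] fourier_cmult[OF h, of "- 1" c] cF by (simp add: algebra_simps)
    have f2: "cmod (complex_of_real (f \<eta>) * z) \<le> 2 * cmod z" for \<eta> z
      unfolding norm_mult norm_of_real using f(2)[of \<eta>] by (rule mult_right_mono) simp
    have f3: "cmod (complex_of_real (1 - f \<eta>) * z) \<le> 3 * cmod z" for \<eta> z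
    proof -
      have "\<bar>1 - f \<eta>\<bar> \<le> 3" using f(2)[of \<eta>] by linarith
      then show ?thesis unfolding norm_mult norm_of_real by (rule mult_right_mono) simp
    qed
    have fF: "cmod (complex_of_real (f \<eta>) * \<Phi> \<eta>) \<le> r * cmod (\<Phi> \<eta>)" for \<eta>
    proof (cases "\<eta> \<in> F")
      case True
      then show ?thesis unfolding norm_mult norm_of_real by (intro mult_right_mono f(4)) simp_all
    next
      case False
      then show ?thesis using F(2) by simp
    qed
    have fX: "cmod (complex_of_real (1 - f \<eta>) * \<Psi> \<eta>) \<le> r * cmod (\<Psi> \<eta>)" for \<eta>
    proof (cases "\<eta> = \<xi>")
      case True
      then have "\<bar>1 - f \<eta>\<bar> \<le> r" using f(3)[of \<eta>] by (simp add: abs_minus_commute)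
      then show ?thesis unfolding norm_mult norm_of_real by (rule mult_right_mono) simp
    next
      case False
      then show ?thesis using \<xi>(2) by simp
    qed
    note m = discrete_measurable
    have nk: "L2norm \<sigma> (fourier_fun h k) \<le> 2 * a n + r * X"
      unfolding kF a_def X_def
      using L2norm_triangle[OF L2norm_mult_le(1)[where w = "\<lambda>\<eta>. complex_of_real (f \<eta>)", OF s\<phi> m f2] L2norm_mult_le(1)[where w = "\<lambda>\<eta>. complex_of_real (f \<eta>)", OF \<Phi> m fF]]
        L2norm_mult_le(2)[where w = "\<lambda>\<eta>. complex_of_real (f \<eta>)", OF s\<phi> m f2] L2norm_mult_le(2)[where w = "\<lambda>\<eta>. complex_of_real (f \<eta>)", OF \<Phi> m fF] r(1) by simp
    have nd: "L2norm \<sigma> (fourier_fun h d) \<le> 3 * b n + r * Y"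
      unfolding dF b_def Y_def
      using L2norm_triangle[OF L2norm_mult_le(1)[where w = "\<lambda>\<eta>. complex_of_real (1 - f \<eta>)", OF s\<psi> m f3] L2norm_mult_le(1)[where w = "\<lambda>\<eta>. complex_of_real (1 - f \<eta>)", OF \<Psi> m fX]]
        L2norm_mult_le(2)[where w = "\<lambda>\<eta>. complex_of_real (1 - f \<eta>)", OF s\<psi> m f3] L2norm_mult_le(2)[where w = "\<lambda>\<eta>. complex_of_real (1 - f \<eta>)", OF \<Psi> m fX] r(1) by simp
    \<comment> \<open>On the Fourier side d carries 1 - f and c carries f. The factor 1 - f is small
      at \<xi>, where \<Psi> lives; f moves to the other argument and is small on F, where \<Phi>
      lives.\<close>
    have "\<psi> n = (\<lambda>x. d x + c x)" unfolding d_def by simp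
    then have "B (\<phi> n) (\<psi> n) = B (\<phi> n) d + B (\<phi> n) c" using B_add[OF \<phi> d c, of n] by simp
    also have "B (\<phi> n) c = B k (\<psi> n)" unfolding c_def k_def by (rule B_adj[OF \<phi> \<psi>])
    finally have "cmod (B (\<phi> n) (\<psi> n)) \<le> cmod (B (\<phi> n) d) + cmod (B k (\<psi> n))" by (simp add: norm_triangle_ineq)
    also have "\<dots> \<le> C * (L2norm \<sigma> (fourier_fun h (\<phi> n)) * L2norm \<sigma> (fourier_fun h d)) + C * (L2norm \<sigma> (fourier_fun h k) * L2norm \<sigma> (fourier_fun h (\<psi> n)))"
      by (intro add_mono B_bound \<phi> \<psi> d k)
    also have "\<dots> \<le> C * ((a n + X) * (3 * b n + r * Y)) + C * ((2 * a n + r * X) * (b n + Y))"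
    proof -
      have "0 \<le> a n" "0 \<le> b n" unfolding a_def b_def by (rule L2norm_nonneg)+
      then show ?thesis
        using C n\<phi> n\<psi> nk nd XY r(1) by (intro add_mono mult_left_mono mult_mono L2norm_nonneg) auto
    qed
    finally show ?thesis .
  qed
  have "(\<lambda>n. C * ((a n + X) * (3 * b n + r * Y)) + C * ((2 * a n + r * X) * (b n + Y))) \<longlonglongrightarrow>
      C * ((0 + X) * (3 * 0 + r * Y)) + C * ((2 * 0 + r * X) * (0 + Y))"
    by (intro tendsto_intros l\<phi>[folded a_def] l\<psi>[folded b_def])
  moreover have "C * ((0 + X) * (3 * 0 + r * Y)) + C * ((2 * 0 + r * X) * (0 + Y)) < e"
    using re by (simp add: algebra_simps)
  ultimately have "\<forall>\<^sub>F n in sequentially. C * ((a n + X) * (3 * b n + r * Y)) + C * ((2 * a n + r * X) * (b n + Y)) < e"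
    by (rule order_tendstoD(2))
  then show "\<forall>\<^sub>F n in sequentially. dist (B (\<phi> n) (\<psi> n)) 0 < e"
    by eventually_elim (use bound in \<open>auto intro: le_less_trans\<close>)
qed

lemma indicator_sq_integrable: "sq_integrable \<sigma> (\<lambda>\<eta>. c * indicator {\<xi>} \<eta>)"
proof (rule sq_integrable_cmult)
  have "emeasure \<sigma> {\<xi>} < \<infinity>" by (rule radon_compact[OF \<sigma>]) simp
  then have "integrable \<sigma> (indicator {\<xi>} :: 'a dual \<Rightarrow> real)"
    using radon_sets[OF \<sigma>] discrete_sets_borel[OF disc] by (simp add: integrable_indicator_iff le_less_trans[OF emeasure_mono])
  moreover have "(cmod (indicator {\<xi>} \<eta>))\<^sup>2 = (indicator {\<xi>} \<eta> :: real)" for \<eta> by (simp add: indicator_def)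
  ultimately show "sq_integrable \<sigma> (indicator {\<xi>})" unfolding sq_integrable_def using discrete_measurable by simp
qed

text \<open>A test function whose transform is nonzero at \<xi> is multiplied, on the Fourier side,
  by a polynomial close to the indicator of \<xi> in the weighted space, and normalised by the value
  z of the transform at \<xi>.\<close>

lemma approximate_atom:
  assumes \<phi>: "\<phi> \<in> Cc" and nz: "fourier_fun h \<phi> \<xi> \<noteq> 0"
  shows "\<exists>e. \<forall>n. e n \<in> Cc \<and> L2norm \<sigma> (\<lambda>\<eta>. fourier_fun h (e n) \<eta> - indicator {\<xi>} \<eta>) \<le> 1 / real (Suc n)"
proof -
  define z where "z = fourier_fun h \<phi> \<xi>"
  have "\<exists>\<psi>. \<psi> \<in> Cc \<and> L2norm \<sigma> (\<lambda>\<eta>. fourier_fun h \<psi> \<eta> - indicator {\<xi>} \<eta>) \<le> 1 / real (Suc n)" for n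
  proof -
    \<comment> \<open>Dividing by z turns the error t into 1 / (n + 1).\<close>
    define t where "t = cmod z / real (Suc n)"
    have t: "t > 0" unfolding t_def z_def using nz by simp
    have xb: "{\<xi>} \<in> sets borel" by simp
    have t2: "t\<^sup>2 > 0" using t by simp
    obtain f where f: "f \<in> real_trig" "(\<integral>\<eta>. (f \<eta> - indicator {\<xi>} \<eta>)\<^sup>2 * (cmod (fourier_fun h \<phi> \<eta>))\<^sup>2 \<partial>\<sigma>) \<le> t\<^sup>2"
      by (rule trig_approx_indicator[OF \<sigma> fourier_continuous[OF h \<phi>] fourier_bound[OF h \<phi>] fsq[OF \<phi>] xb t2]) blast
    obtain xs where xs: "\<And>\<eta>. trig_sym xs \<eta> = complex_of_real (f \<eta>)" using f(1) unfolding real_trig_def by blast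
    define \<psi> where "\<psi> = (\<lambda>x. (1 / z) * trig_op xs \<phi> x)"
    have \<psi>: "\<psi> \<in> Cc" unfolding \<psi>_def by (rule Cc_cmult[OF trig_op_Cc[OF \<phi>]])
    have "fourier_fun h \<psi> \<eta> - indicator {\<xi>} \<eta> = (1 / z) * (complex_of_real (f \<eta> - indicator {\<xi>} \<eta>) * fourier_fun h \<phi> \<eta>)" for \<eta>
    proof -
      have "fourier_fun h \<psi> \<eta> = (1 / z) * (complex_of_real (f \<eta>) * fourier_fun h \<phi> \<eta>)"
        unfolding \<psi>_def fourier_cmult[OF h, of "1 / z"] fourier_trig_op[OF h \<phi>] xs ..
      moreover have "(1 / z) * (indicator {\<xi>} \<eta> * fourier_fun h \<phi> \<eta>) = indicator {\<xi>} \<eta>"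
        using nz unfolding z_def by (cases "\<eta> = \<xi>") auto
      moreover have "complex_of_real (indicator {\<xi>} \<eta>) = indicator {\<xi>} \<eta>" by (simp add: indicator_def)
      ultimately show ?thesis by (simp add: left_diff_distrib right_diff_distrib del: times_divide_eq_left)
    qed
    then have "L2norm \<sigma> (\<lambda>\<eta>. fourier_fun h \<psi> \<eta> - indicator {\<xi>} \<eta>) = cmod (1 / z) * L2norm \<sigma> (\<lambda>\<eta>. complex_of_real (f \<eta> - indicator {\<xi>} \<eta>) * fourier_fun h \<phi> \<eta>)"
      by (simp only: L2norm_cmult)
    also have "L2norm \<sigma> (\<lambda>\<eta>. complex_of_real (f \<eta> - indicator {\<xi>} \<eta>) * fourier_fun h \<phi> \<eta>) \<le> t"
      unfolding L2norm_def norm_mult norm_of_real power_mult_distrib power2_abs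
      using f(2) t by (intro real_le_lsqrt) auto
    finally have "L2norm \<sigma> (\<lambda>\<eta>. fourier_fun h \<psi> \<eta> - indicator {\<xi>} \<eta>) \<le> cmod (1 / z) * t" by (simp add: mult_left_mono)
    also have "\<dots> = 1 / real (Suc n)" unfolding t_def using nz by (simp add: z_def norm_divide)
    finally show ?thesis using \<psi> by blast
  qed
  then show ?thesis by metis
qed

lemma Q_convergent:
  assumes e: "\<And>n. e n \<in> Cc" "\<And>n. L2norm \<sigma> (\<lambda>\<eta>. fourier_fun h (e n) \<eta> - \<Phi> \<eta>) \<le> 1 / real (Suc n)"
    and \<Phi>: "sq_integrable \<sigma> \<Phi>"
  shows "convergent (\<lambda>n. Q (e n))"
proof -
  \<comment> \<open>The distance D is at most 2 and the approximants have norm at most 1 +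
    \<open>L2norm \<sigma> \<Phi>\<close>, so the last factor in \<open>Q_diff_bound\<close> is at
    most 2 + 2 * (1 + \<open>L2norm \<sigma> \<Phi>\<close>).\<close>
  define K where "K = C * (4 + 2 * L2norm \<sigma> \<Phi>)"
  have K: "K > 0" unfolding K_def using C L2norm_nonneg[of \<sigma> \<Phi>] by simp
  have inv: "1 / real (Suc n) \<le> 1 / real (Suc M)" if "n \<ge> M" for n M using that by (simp add: frac_le)
  have close: "\<bar>Q (e m) - Q (e n)\<bar> \<le> K * (1 / real (Suc m) + 1 / real (Suc n))" for m n
  proof -
    define D where "D = 1 / real (Suc m) + 1 / real (Suc n)"
    have le1: "1 / real (Suc k) \<le> 1" for k by simp
    have "0 \<le> D" unfolding D_def by simp
    moreover have "D \<le> 2" unfolding D_def using le1[of m] le1[of n] by linarith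
    ultimately have D: "0 \<le> D" "D \<le> 2" .
    have "L2norm \<sigma> (\<lambda>\<eta>. fourier_fun h (e m) \<eta> - fourier_fun h (e n) \<eta>) \<le>
        L2norm \<sigma> (\<lambda>\<eta>. fourier_fun h (e m) \<eta> - \<Phi> \<eta>) + L2norm \<sigma> (\<lambda>\<eta>. \<Phi> \<eta> - fourier_fun h (e n) \<eta>)"
      by (rule L2norm_diff_triangle[OF fsq[OF e(1)] \<Phi> fsq[OF e(1)]])
    also have "\<dots> \<le> D"
      unfolding D_def L2norm_diff_commute[of \<sigma> \<Phi>] by (intro add_mono e(2))
    finally have "\<bar>Q (e m) - Q (e n)\<bar> \<le> C * (D * (D + 2 * L2norm \<sigma> (fourier_fun h (e n))))"
      by (rule Q_diff_bound[OF e(1) e(1)])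
    also have "\<dots> \<le> C * (D * (4 + 2 * L2norm \<sigma> \<Phi>))"
    proof -
      have "L2norm \<sigma> (fourier_fun h (e n)) \<le> L2norm \<sigma> (\<lambda>\<eta>. fourier_fun h (e n) \<eta> - \<Phi> \<eta>) + L2norm \<sigma> \<Phi>"
        using L2norm_triangle[OF sq_integrable_diff[OF fsq[OF e(1)[of n]] \<Phi>] \<Phi>] by simp
      then have "L2norm \<sigma> (fourier_fun h (e n)) \<le> 1 + L2norm \<sigma> \<Phi>"
        using e(2)[of n] le1[of n] by linarith
      then show ?thesis using C D by (intro mult_left_mono) auto
    qed
    finally show ?thesis unfolding K_def D_def by (simp only: mult_ac)
  qed
  have "Cauchy (\<lambda>n. Q (e n))"
  proof (rule metric_CauchyI)
    fix r :: real assume "r > 0"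
    then have "r / (2 * K) > 0" using K by simp
    then obtain M where M: "1 / real (Suc M) < r / (2 * K)"
      using reals_Archimedean by (auto simp: inverse_eq_divide)
    have "dist (Q (e m)) (Q (e n)) < r" if "m \<ge> M" "n \<ge> M" for m n
    proof -
      have "1 / real (Suc m) + 1 / real (Suc n) < r / K"
      proof -
        have "r / (2 * K) + r / (2 * K) = r / K" using K by (simp add: field_simps)
        then show ?thesis using inv[OF that(1)] inv[OF that(2)] M by linarith
      qed
      then have "K * (1 / real (Suc m) + 1 / real (Suc n)) < K * (r / K)"
        using K by (rule mult_strict_left_mono)
      then show ?thesis using close[of m n] K by (simp add: dist_real_def)
    qed
    then show "\<exists>M. \<forall>m\<ge>M. \<forall>n\<ge>M. dist (Q (e m)) (Q (e n)) < r" by blast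
  qed
  then show ?thesis by (rule Cauchy_convergent)
qed

text \<open>Induction over F: a further atom contributes its own square, and its cross term with the
  combination so far tends to 0 by \<open>B_orthogonal\<close>. Membership, square integrability and
  L^2 convergence are carried along because that lemma needs them at each step.\<close>

lemma combination_limits:
  fixes c w :: "'a dual \<Rightarrow> _"
  assumes e: "\<And>\<xi> n. \<xi> \<in> D \<Longrightarrow> e \<xi> n \<in> Cc"
    and l: "\<And>\<xi>. \<xi> \<in> D \<Longrightarrow> (\<lambda>n. L2norm \<sigma> (\<lambda>\<eta>. fourier_fun h (e \<xi> n) \<eta> - indicator {\<xi>} \<eta>)) \<longlonglongrightarrow> 0"
    and w: "\<And>\<xi>. \<xi> \<in> D \<Longrightarrow> (\<lambda>n. Q (e \<xi> n)) \<longlonglongrightarrow> w \<xi>"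
    and F: "finite F" "F \<subseteq> D"
  shows "(\<forall>n. (\<lambda>x. \<Sum>\<xi>\<in>F. c \<xi> * e \<xi> n x) \<in> Cc) \<and> sq_integrable \<sigma> (\<lambda>\<eta>. \<Sum>\<xi>\<in>F. c \<xi> * indicator {\<xi>} \<eta>) \<and>
    (\<lambda>n. L2norm \<sigma> (\<lambda>\<eta>. fourier_fun h (\<lambda>x. \<Sum>\<xi>\<in>F. c \<xi> * e \<xi> n x) \<eta> - (\<Sum>\<xi>\<in>F. c \<xi> * indicator {\<xi>} \<eta>))) \<longlonglongrightarrow> 0 \<and>
    (\<lambda>n. Q (\<lambda>x. \<Sum>\<xi>\<in>F. c \<xi> * e \<xi> n x)) \<longlonglongrightarrow> (\<Sum>\<xi>\<in>F. (cmod (c \<xi>))\<^sup>2 * w \<xi>)"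
  using F
proof (induction F rule: finite_induct)
  case empty
  have "Q (\<lambda>x. 0) = 0" using Q_cmult[OF Cc_zero, of 0] by simp
  moreover have "sq_integrable \<sigma> (\<lambda>\<eta>. 0)" unfolding sq_integrable_def by simp
  ultimately show ?case using Cc_zero by (simp add: fourier_fun_def L2norm_def)
next
  case (insert \<xi> F)
  define \<psi> where "\<psi> n = (\<lambda>x. \<Sum>\<xi>\<in>F. c \<xi> * e \<xi> n x)" for n
  define \<Psi> where "\<Psi> = (\<lambda>\<eta>. \<Sum>\<xi>\<in>F. c \<xi> * indicator {\<xi>} \<eta>)"
  define u where "u n = (\<lambda>x. c \<xi> * e \<xi> n x)" for n
  have \<xi>: "\<xi> \<in> D" using insert.prems by simp
  have IH: "\<And>n. \<psi> n \<in> Cc" "sq_integrable \<sigma> \<Psi>" "(\<lambda>n. L2norm \<sigma> (\<lambda>\<eta>. fourier_fun h (\<psi> n) \<eta> - \<Psi> \<eta>)) \<longlonglongrightarrow> 0"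
      "(\<lambda>n. Q (\<psi> n)) \<longlonglongrightarrow> (\<Sum>\<xi>\<in>F. (cmod (c \<xi>))\<^sup>2 * w \<xi>)"
    using insert.IH insert.prems unfolding \<psi>_def \<Psi>_def by simp_all
  have u: "u n \<in> Cc" for n unfolding u_def by (rule Cc_cmult[OF e[OF \<xi>]])
  have sum: "(\<lambda>x. \<Sum>\<xi>\<in>insert \<xi> F. c \<xi> * e \<xi> n x) = (\<lambda>x. \<psi> n x + u n x)" for n
    using insert.hyps unfolding \<psi>_def u_def by (simp add: add.commute)
  have Sum: "(\<Sum>\<xi>\<in>insert \<xi> F. c \<xi> * indicator {\<xi>} \<eta>) = \<Psi> \<eta> + c \<xi> * indicator {\<xi>} \<eta>" for \<eta>
    unfolding \<Psi>_def sum.insert[OF insert.hyps] by (rule add.commute)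
  have ufs: "fourier_fun h (u n) \<eta> - c \<xi> * indicator {\<xi>} \<eta> = c \<xi> * (fourier_fun h (e \<xi> n) \<eta> - indicator {\<xi>} \<eta>)" for n \<eta>
    unfolding u_def fourier_cmult[OF h, of "c \<xi>"] by (simp add: right_diff_distrib)
  have sqi: "sq_integrable \<sigma> (indicator {\<xi>})" using indicator_sq_integrable[of 1 \<xi>] by simp
  have lu: "(\<lambda>n. L2norm \<sigma> (\<lambda>\<eta>. fourier_fun h (u n) \<eta> - c \<xi> * indicator {\<xi>} \<eta>)) \<longlonglongrightarrow> 0"
    unfolding ufs L2norm_cmult using tendsto_mult_right_zero[OF l[OF \<xi>]] .
  have "(\<lambda>n. L2norm \<sigma> (\<lambda>\<eta>. fourier_fun h (\<lambda>x. \<psi> n x + u n x) \<eta> - (\<Psi> \<eta> + c \<xi> * indicator {\<xi>} \<eta>))) \<longlonglongrightarrow> 0"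
  proof (rule tendsto_sandwich[OF always_eventually[OF allI] always_eventually[OF allI] tendsto_const])
    show "0 \<le> L2norm \<sigma> (\<lambda>\<eta>. fourier_fun h (\<lambda>x. \<psi> n x + u n x) \<eta> - (\<Psi> \<eta> + c \<xi> * indicator {\<xi>} \<eta>))" for n
      by (rule L2norm_nonneg)
    show "L2norm \<sigma> (\<lambda>\<eta>. fourier_fun h (\<lambda>x. \<psi> n x + u n x) \<eta> - (\<Psi> \<eta> + c \<xi> * indicator {\<xi>} \<eta>)) \<le>
        L2norm \<sigma> (\<lambda>\<eta>. fourier_fun h (\<psi> n) \<eta> - \<Psi> \<eta>) + L2norm \<sigma> (\<lambda>\<eta>. fourier_fun h (u n) \<eta> - c \<xi> * indicator {\<xi>} \<eta>)" for n
      using L2norm_triangle[OF sq_integrable_diff[OF fsq[OF IH(1)] IH(2)] sq_integrable_diff[OF fsq[OF u] indicator_sq_integrable], of n n "c \<xi>" \<xi>]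
      unfolding fourier_add[OF h IH(1) u] by (simp add: algebra_simps)
    show "(\<lambda>n. L2norm \<sigma> (\<lambda>\<eta>. fourier_fun h (\<psi> n) \<eta> - \<Psi> \<eta>) + L2norm \<sigma> (\<lambda>\<eta>. fourier_fun h (u n) \<eta> - c \<xi> * indicator {\<xi>} \<eta>)) \<longlonglongrightarrow> 0"
      using tendsto_add[OF IH(3) lu] by simp
  qed
  moreover have "(\<lambda>n. Q (\<lambda>x. \<psi> n x + u n x)) \<longlonglongrightarrow> (\<Sum>\<xi>\<in>insert \<xi> F. (cmod (c \<xi>))\<^sup>2 * w \<xi>)"
  proof -
    have "(\<lambda>n. B (\<psi> n) (u n)) \<longlonglongrightarrow> 0"
    proof (rule B_orthogonal[OF IH(1) u IH(2) indicator_sq_integrable IH(3) lu insert.hyps(1) _ insert.hyps(2)])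
      show "\<Psi> \<eta> = 0" if "\<eta> \<notin> F" for \<eta>
        unfolding \<Psi>_def by (rule sum.neutral) (use that in \<open>auto simp: indicator_def\<close>)
      show "c \<xi> * indicator {\<xi>} \<eta> = 0" if "\<eta> \<noteq> \<xi>" for \<eta> using that by simp
    qed
    then have "(\<lambda>n. Q (\<psi> n) + (cmod (c \<xi>))\<^sup>2 * Q (e \<xi> n) + 2 * Re (B (\<psi> n) (u n))) \<longlonglongrightarrow>
        (\<Sum>\<xi>\<in>F. (cmod (c \<xi>))\<^sup>2 * w \<xi>) + (cmod (c \<xi>))\<^sup>2 * w \<xi> + 2 * Re 0"
      by (intro tendsto_add tendsto_mult tendsto_const tendsto_Re IH(4) w[OF \<xi>])
    moreover have "Q (u n) = (cmod (c \<xi>))\<^sup>2 * Q (e \<xi> n)" for n unfolding u_def by (rule Q_cmult[OF e[OF \<xi>]])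
    ultimately show ?thesis
      using insert.hyps unfolding Q_add[OF IH(1) u] by (simp add: add.commute)
  qed
  moreover have "sq_integrable \<sigma> (\<lambda>\<eta>. \<Psi> \<eta> + c \<xi> * indicator {\<xi>} \<eta>)"
    by (rule sq_integrable_add[OF IH(2) indicator_sq_integrable])
  ultimately show ?case unfolding sum Sum using Cc_add[OF IH(1) u] by blast
qed

text \<open>The mass at \<xi> is the limit of Q along functions whose transforms approach the
  indicator of \<xi>. Truncating the transform of \<phi> to a large finite F changes Q little and
  turns it into a sum over atoms, so Q \<phi> is the unordered sum of the masses times the squared
  transform.\<close>

lemma discrete_fourier_representation:
  "\<exists>\<rho>. radon_measure \<rho> \<and> (\<forall>\<phi>\<in>Cc. integrable \<rho> (\<lambda>\<xi>. (cmod (fourier_fun h \<phi> \<xi>))\<^sup>2) \<and>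
     (\<integral>\<xi>. (cmod (fourier_fun h \<phi> \<xi>))\<^sup>2 \<partial>\<rho>) = Q \<phi>)"
proof -
  \<comment> \<open>Outside D every transform vanishes; these points get mass 0 and contribute to no
    integral.\<close>
  define D where "D = {\<xi>. \<exists>\<phi>\<in>Cc. fourier_fun h \<phi> \<xi> \<noteq> 0}"
  have "\<forall>\<xi>\<in>D. \<exists>e. \<forall>n. e n \<in> Cc \<and> L2norm \<sigma> (\<lambda>\<eta>. fourier_fun h (e n) \<eta> - indicator {\<xi>} \<eta>) \<le> 1 / real (Suc n)"
  proof
    fix \<xi> assume "\<xi> \<in> D"
    then obtain \<phi> where "\<phi> \<in> Cc" "fourier_fun h \<phi> \<xi> \<noteq> 0" unfolding D_def by blast
    then show "\<exists>e. \<forall>n. e n \<in> Cc \<and> L2norm \<sigma> (\<lambda>\<eta>. fourier_fun h (e n) \<eta> - indicator {\<xi>} \<eta>) \<le> 1 / real (Suc n)"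
      by (rule approximate_atom)
  qed
  from bchoice[OF this] obtain e where
    "\<forall>\<xi>\<in>D. \<forall>n. e \<xi> n \<in> Cc \<and> L2norm \<sigma> (\<lambda>\<eta>. fourier_fun h (e \<xi> n) \<eta> - indicator {\<xi>} \<eta>) \<le> 1 / real (Suc n)" ..
  then have e: "\<And>\<xi> n. \<xi> \<in> D \<Longrightarrow> e \<xi> n \<in> Cc"
    and el: "\<And>\<xi> n. \<xi> \<in> D \<Longrightarrow> L2norm \<sigma> (\<lambda>\<eta>. fourier_fun h (e \<xi> n) \<eta> - indicator {\<xi>} \<eta>) \<le> 1 / real (Suc n)" by simp_all
  have l: "(\<lambda>n. L2norm \<sigma> (\<lambda>\<eta>. fourier_fun h (e \<xi> n) \<eta> - indicator {\<xi>} \<eta>)) \<longlonglongrightarrow> 0" if "\<xi> \<in> D" for \<xi>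
  proof (rule tendsto_sandwich[OF always_eventually[OF allI] always_eventually[OF allI] tendsto_const])
    show "(\<lambda>n. 1 / real (Suc n)) \<longlonglongrightarrow> 0" using LIMSEQ_inverse_real_of_nat by (simp add: inverse_eq_divide)
  qed (use L2norm_nonneg el[OF that] in auto)
  define w where "w \<xi> = (if \<xi> \<in> D then lim (\<lambda>n. Q (e \<xi> n)) else 0)" for \<xi>
  have w: "(\<lambda>n. Q (e \<xi> n)) \<longlonglongrightarrow> w \<xi>" if "\<xi> \<in> D" for \<xi>
  proof -
    have "sq_integrable \<sigma> (indicator {\<xi>})" using indicator_sq_integrable[of 1 \<xi>] by simp
    with e[OF that] el[OF that] have "convergent (\<lambda>n. Q (e \<xi> n))" by (rule Q_convergent)
    then show ?thesis using that unfolding w_def by (simp add: convergent_LIMSEQ_iff)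
  qed
  have w0: "0 \<le> w \<xi>" for \<xi>
  proof (cases "\<xi> \<in> D")
    case True
    show ?thesis by (rule LIMSEQ_le_const[OF w[OF True]]) (use Q_nonneg[OF e[OF True]] in blast)
  qed (simp add: w_def)
  define \<rho> where "\<rho> = density (count_space UNIV) (\<lambda>\<xi>. ennreal (w \<xi>))"
  have \<rho>: "radon_measure \<rho>" unfolding \<rho>_def by (rule radon_discrete[OF disc])
  have "integrable \<rho> (\<lambda>\<xi>. (cmod (fourier_fun h \<phi> \<xi>))\<^sup>2) \<and> (\<integral>\<xi>. (cmod (fourier_fun h \<phi> \<xi>))\<^sup>2 \<partial>\<rho>) = Q \<phi>"
    if \<phi>: "\<phi> \<in> Cc" for \<phi>
  proof -
    define g where "g \<xi> = (cmod (fourier_fun h \<phi> \<xi>))\<^sup>2 * w \<xi>" for \<xi>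
    define X where "X = L2norm \<sigma> (fourier_fun h \<phi>)"
    have X: "0 \<le> X" unfolding X_def by (rule L2norm_nonneg)
    have g0: "0 \<le> g \<xi>" for \<xi> unfolding g_def using w0 by simp
    \<comment> \<open>Convergence along the net of finite sets. Compact sets are finite here, so the
      tail estimate supplies K.\<close>
    have near: "\<exists>K. finite K \<and> (\<forall>F. finite F \<longrightarrow> K \<subseteq> F \<longrightarrow> \<bar>sum g F - Q \<phi>\<bar> \<le> \<epsilon>)" if \<epsilon>: "\<epsilon> > 0" for \<epsilon>
    proof -
      \<comment> \<open>By \<open>Q_diff_bound\<close> an L^2 error t then changes Q by at most
        \<epsilon>.\<close>
      define t where "t = min 1 (\<epsilon> / (C * (1 + 2 * X)))"
      have t: "0 < t" "t \<le> 1" unfolding t_def using \<epsilon> C X by auto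
      have "t * (C * (1 + 2 * X)) \<le> \<epsilon> / (C * (1 + 2 * X)) * (C * (1 + 2 * X))"
        using C X unfolding t_def by (intro mult_right_mono) auto
      also have "\<dots> = \<epsilon>" using C X by simp
      finally have "C * (t * (1 + 2 * X)) \<le> \<epsilon>" by (simp only: mult_ac)
      moreover have "C * (t * (t + 2 * X)) \<le> C * (t * (1 + 2 * X))" using C t by (intro mult_left_mono) auto
      ultimately have t\<epsilon>: "C * (t * (t + 2 * X)) \<le> \<epsilon>" by linarith
      have "t\<^sup>2 > 0" using t by simp
      then obtain K where K: "compact K" "(\<integral>\<xi>. indicator (- K) \<xi> * (cmod (fourier_fun h \<phi> \<xi>))\<^sup>2 \<partial>\<sigma>) \<le> t\<^sup>2"
        by (rule radon_compact_tail[OF \<sigma> fourier_continuous[OF h \<phi>] fourier_bound[OF h \<phi>] fsq[OF \<phi>]])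
      have "\<bar>sum g F - Q \<phi>\<bar> \<le> \<epsilon>" if F: "finite F" "K \<subseteq> F" for F
      proof -
        define c where "c = fourier_fun h \<phi>"
        define \<psi> where "\<psi> n = (\<lambda>x. \<Sum>\<xi>\<in>F \<inter> D. c \<xi> * e \<xi> n x)" for n
        define \<Psi> where "\<Psi> \<eta> = (\<Sum>\<xi>\<in>F \<inter> D. c \<xi> * indicator {\<xi>} \<eta>)" for \<eta>
        have "finite (F \<inter> D)" "F \<inter> D \<subseteq> D" using F(1) by auto
        from combination_limits[OF e l w this, of c]
        have lim: "\<And>n. \<psi> n \<in> Cc" "sq_integrable \<sigma> \<Psi>" "(\<lambda>n. L2norm \<sigma> (\<lambda>\<eta>. fourier_fun h (\<psi> n) \<eta> - \<Psi> \<eta>)) \<longlonglongrightarrow> 0"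
            "(\<lambda>n. Q (\<psi> n)) \<longlonglongrightarrow> (\<Sum>\<xi>\<in>F \<inter> D. (cmod (c \<xi>))\<^sup>2 * w \<xi>)"
          unfolding \<psi>_def \<Psi>_def by simp_all
        \<comment> \<open>\<Psi> truncates c to F: at points of F outside D nothing is lost, since c
          vanishes there.\<close>
        have rest: "\<Psi> \<eta> - c \<eta> = - (indicator (- F) \<eta> * c \<eta>)" for \<eta>
        proof -
          have "\<Psi> \<eta> = (\<Sum>\<xi>\<in>F \<inter> D. if \<xi> = \<eta> then c \<eta> else 0)"
            unfolding \<Psi>_def by (intro sum.cong) (auto simp: indicator_def)
          also have "\<dots> = (if \<eta> \<in> F \<inter> D then c \<eta> else 0)" using F(1) by simp
          finally show ?thesis using \<phi> unfolding c_def D_def by (auto simp: indicator_def)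
        qed
        have "L2norm \<sigma> (\<lambda>\<eta>. \<Psi> \<eta> - c \<eta>) \<le> t"
        proof -
          have "(\<integral>\<eta>. (cmod (\<Psi> \<eta> - c \<eta>))\<^sup>2 \<partial>\<sigma>) \<le> (\<integral>\<xi>. indicator (- K) \<xi> * (cmod (c \<xi>))\<^sup>2 \<partial>\<sigma>)"
          proof (rule Bochner_Integration.integral_mono)
            show "integrable \<sigma> (\<lambda>\<eta>. (cmod (\<Psi> \<eta> - c \<eta>))\<^sup>2)"
              using sq_integrable_diff[OF lim(2) fsq[OF \<phi>]] unfolding c_def sq_integrable_def by blast
            have ci: "integrable \<sigma> (\<lambda>\<xi>. (cmod (c \<xi>))\<^sup>2)" using fsq[OF \<phi>] unfolding c_def sq_integrable_def by blast
            show "integrable \<sigma> (\<lambda>\<xi>. indicator (- K) \<xi> * (cmod (c \<xi>))\<^sup>2)"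
              by (rule integrable_bounded_mult[OF ci discrete_measurable, of _ 1]) (simp add: indicator_def)
            show "(cmod (\<Psi> \<eta> - c \<eta>))\<^sup>2 \<le> indicator (- K) \<eta> * (cmod (c \<eta>))\<^sup>2" for \<eta>
              unfolding rest using F(2) by (auto simp: indicator_def)
          qed
          then show ?thesis using K(2) t(1) unfolding L2norm_def c_def by (intro real_le_lsqrt) auto
        qed
        then have "L2norm \<sigma> (\<lambda>\<eta>. fourier_fun h (\<psi> n) \<eta> - c \<eta>) \<le> L2norm \<sigma> (\<lambda>\<eta>. fourier_fun h (\<psi> n) \<eta> - \<Psi> \<eta>) + t" for n
          using L2norm_diff_triangle[OF fsq[OF lim(1)] lim(2) fsq[OF \<phi>], of n] unfolding c_def by linarith
        then have le: "\<bar>Q (\<psi> n) - Q \<phi>\<bar> \<le> C * ((L2norm \<sigma> (\<lambda>\<eta>. fourier_fun h (\<psi> n) \<eta> - \<Psi> \<eta>) + t) *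
            ((L2norm \<sigma> (\<lambda>\<eta>. fourier_fun h (\<psi> n) \<eta> - \<Psi> \<eta>) + t) + 2 * X))" for n
          unfolding c_def X_def by (rule Q_diff_bound[OF lim(1) \<phi>])
        have "\<bar>(\<Sum>\<xi>\<in>F \<inter> D. (cmod (c \<xi>))\<^sup>2 * w \<xi>) - Q \<phi>\<bar> \<le> C * ((0 + t) * ((0 + t) + 2 * X))"
          by (rule LIMSEQ_le[OF tendsto_rabs[OF tendsto_diff[OF lim(4) tendsto_const]]
                tendsto_mult[OF tendsto_const tendsto_mult[OF tendsto_add[OF lim(3) tendsto_const] tendsto_add[OF tendsto_add[OF lim(3) tendsto_const] tendsto_const]]]])
             (use le in blast)
        also have "\<dots> \<le> \<epsilon>" using t\<epsilon> by simp
        also have "(\<Sum>\<xi>\<in>F \<inter> D. (cmod (c \<xi>))\<^sup>2 * w \<xi>) = sum g F"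
          unfolding g_def c_def by (rule sum.mono_neutral_left) (use F(1) in \<open>auto simp: w_def\<close>)
        finally show ?thesis .
      qed
      then show ?thesis using discrete_compact_finite[OF disc K(1)] by blast
    qed
    \<comment> \<open>g is nonnegative, so F can be enlarged until \<open>near\<close>
      applies.\<close>
    have up: "sum g F \<le> Q \<phi>" if "finite F" for F
    proof (rule field_le_epsilon)
      fix \<epsilon> :: real assume "\<epsilon> > 0"
      from near[OF this] obtain K where K: "finite K" "\<And>F. finite F \<Longrightarrow> K \<subseteq> F \<Longrightarrow> \<bar>sum g F - Q \<phi>\<bar> \<le> \<epsilon>" by blast
      have "sum g F \<le> sum g (F \<union> K)" using that K(1) g0 by (intro sum_mono2) auto
      also have "\<dots> \<le> Q \<phi> + \<epsilon>" using K(2)[of "F \<union> K"] that K(1) by auto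
      finally show "sum g F \<le> Q \<phi> + \<epsilon>" .
    qed
    have "(\<integral>\<^sup>+\<xi>. ennreal ((cmod (fourier_fun h \<phi> \<xi>))\<^sup>2) \<partial>\<rho>) = (\<integral>\<^sup>+\<xi>. ennreal (w \<xi>) * ennreal ((cmod (fourier_fun h \<phi> \<xi>))\<^sup>2) \<partial>count_space UNIV)"
      unfolding \<rho>_def by (rule nn_integral_density) simp_all
    also have "\<dots> = (\<integral>\<^sup>+\<xi>. ennreal (g \<xi>) \<partial>count_space UNIV)"
      unfolding g_def using w0 by (simp add: ennreal_mult mult.commute)
    also have "\<dots> = (SUP F\<in>{F. finite F}. \<Sum>\<xi>\<in>F. ennreal (g \<xi>))" by (rule nn_integral_count_space_SUP)
    also have "\<dots> = (SUP F\<in>{F. finite F}. ennreal (sum g F))" using g0 by (simp add: sum_ennreal)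
    also have "\<dots> = ennreal (Q \<phi>)"
    proof (rule antisym)
      show "(SUP F\<in>{F. finite F}. ennreal (sum g F)) \<le> ennreal (Q \<phi>)"
        by (rule SUP_least) (auto intro: ennreal_leI up)
      show "ennreal (Q \<phi>) \<le> (SUP F\<in>{F. finite F}. ennreal (sum g F))"
      proof (rule ennreal_le_epsilon)
        fix \<epsilon> :: real assume "\<epsilon> > 0"
        from near[OF this] obtain K where K: "finite K" "\<bar>sum g K - Q \<phi>\<bar> \<le> \<epsilon>" by blast
        have "ennreal (Q \<phi>) \<le> ennreal (sum g K + \<epsilon>)" using K(2) by (intro ennreal_leI) linarith
        also have "\<dots> = ennreal (sum g K) + ennreal \<epsilon>" using g0 \<open>\<epsilon> > 0\<close> by (intro ennreal_plus sum_nonneg) auto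
        also have "\<dots> \<le> (SUP F\<in>{F. finite F}. ennreal (sum g F)) + ennreal \<epsilon>"
          using K(1) by (intro add_right_mono SUP_upper) simp
        finally show "ennreal (Q \<phi>) \<le> (SUP F\<in>{F. finite F}. ennreal (sum g F)) + ennreal \<epsilon>" .
      qed
    qed
    finally have "(\<integral>\<^sup>+\<xi>. ennreal ((cmod (fourier_fun h \<phi> \<xi>))\<^sup>2) \<partial>\<rho>) = ennreal (Q \<phi>)" .
    moreover have "(\<lambda>\<xi>. (cmod (fourier_fun h \<phi> \<xi>))\<^sup>2) \<in> borel_measurable \<rho>"
      by (rule radon_continuous_measurable[OF \<rho>]) (intro continuous_intros fourier_continuous[OF h \<phi>])
    ultimately show ?thesis
      using nn_integral_eq_integrable[of "\<lambda>\<xi>. (cmod (fourier_fun h \<phi> \<xi>))\<^sup>2" \<rho> "Q \<phi>"] Q_nonneg[OF \<phi>] by simp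
  qed
  with \<rho> show ?thesis by blast
qed

end

section \<open>Means along a van Hove net\<close>

lemma net_filter_le:
  assumes "i \<in> I" shows "net_filter I le \<le> principal {j \<in> I. le i j}"
  unfolding net_filter_def using assms by (rule INF_lower)

lemma eventually_net_filter_mem:
  assumes "directed_set I le" shows "\<forall>\<^sub>F i in net_filter I le. i \<in> I"
proof -
  obtain i where "i \<in> I" using assms unfolding directed_set_def by blast
  then show ?thesis using filter_leD[OF net_filter_le[of i I le]] by (simp add: eventually_principal)
qed

text \<open>Directedness makes the tails a base of nonempty sets. Uniqueness of limits and the
  passage of inequalities to the limit rest on this.\<close>

lemma net_filter_neq_bot:
  assumes d: "directed_set I le" shows "net_filter I le \<noteq> bot"
proof
  assume "net_filter I le = bot"
  then have "eventually (\<lambda>i. False) (INF i\<in>I. principal {j \<in> I. le i j})"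
    unfolding net_filter_def by (simp add: trivial_limit_def)
  moreover have "I \<noteq> {}" using d unfolding directed_set_def by blast
  moreover have "\<exists>k\<in>I. principal {l \<in> I. le k l} \<le> inf (principal {l \<in> I. le i l}) (principal {l \<in> I. le j l})"
    if "i \<in> I" "j \<in> I" for i j
  proof -
    have "\<forall>i\<in>I. \<forall>j\<in>I. \<exists>k\<in>I. le i k \<and> le j k" using d unfolding directed_set_def by (elim conjE)
    from bspec[OF bspec[OF this that(1)] that(2)] obtain k where k: "k \<in> I" "le i k" "le j k" by blast
    have "\<forall>i\<in>I. \<forall>j\<in>I. \<forall>k\<in>I. le i j \<longrightarrow> le j k \<longrightarrow> le i k" using d unfolding directed_set_def by (elim conjE)
    then have "{l \<in> I. le k l} \<subseteq> {l \<in> I. le i l} \<inter> {l \<in> I. le j l}"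
      using that k by blast
    then show ?thesis using k(1) by (intro bexI[of _ k]) simp_all
  qed
  ultimately obtain i where "i \<in> I" "eventually (\<lambda>i. False) (principal {j \<in> I. le i j})"
    by (subst (asm) eventually_INF_base) auto
  then have "{j \<in> I. le i j} = {}" by (simp add: eventually_principal)
  moreover have "le i i" using d \<open>i \<in> I\<close> unfolding directed_set_def by blast
  ultimately show False using \<open>i \<in> I\<close> by blast
qed

text \<open>A set S that carries \<rho> on K and is null for \<rho>' there is approximated with
  respect to the sum of both measures, so one polynomial is good for each. Singularity is given on
  compact sets, hence K is chosen before S.\<close>

lemma trig_split:
  fixes F :: "'a :: topological_ab_group_add dual \<Rightarrow> complex"
  assumes \<rho>: "radon_measure \<rho>" and \<rho>': "radon_measure \<rho>'"
    and F: "continuous_on UNIV F" "\<And>x. cmod (F x) \<le> B" "sq_integrable \<rho> F" "sq_integrable \<rho>' F"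
    and sing: "\<And>K. compact K \<Longrightarrow> \<exists>S\<in>sets borel. emeasure \<rho> (K - S) = 0 \<and> emeasure \<rho>' (K \<inter> S) = 0"
    and e: "e > 0"
  obtains f where "f \<in> real_trig" "(\<integral>\<xi>. (1 - f \<xi>)\<^sup>2 * (cmod (F \<xi>))\<^sup>2 \<partial>\<rho>) \<le> e" "(\<integral>\<xi>. (f \<xi>)\<^sup>2 * (cmod (F \<xi>))\<^sup>2 \<partial>\<rho>') \<le> e"
proof -
  define g where "g \<xi> = (cmod (F \<xi>))\<^sup>2" for \<xi>
  have s: "sets \<rho> = sets borel" and s': "sets \<rho>' = sets borel" and ss: "sets \<rho>' = sets \<rho>"
    using radon_sets[OF \<rho>] radon_sets[OF \<rho>'] by simp_all
  define \<sigma> where "\<sigma> = sum_measure \<rho> \<rho>'"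
  have \<sigma>: "radon_measure \<sigma>" unfolding \<sigma>_def by (rule radon_sum_measure[OF \<rho> \<rho>'])
  have gm: "g \<in> borel_measurable \<rho>"
    unfolding g_def by (rule radon_continuous_measurable[OF \<rho>]) (intro continuous_intros F)
  have g0: "0 \<le> g \<xi>" for \<xi> unfolding g_def by simp
  have gi: "integrable \<rho> g" and gi': "integrable \<rho>' g" using F(3,4) unfolding sq_integrable_def g_def by simp_all
  have "integrable \<sigma> g" unfolding \<sigma>_def integrable_sum_measure(1)[OF ss gm g0] using gi gi' by blast
  then have F\<sigma>: "sq_integrable \<sigma> F"
    unfolding sq_integrable_def g_def using radon_continuous_measurable[OF \<sigma> F(1)] by blast
  \<comment> \<open>The integral of (1 - f)^2 is estimated below by twice the approximation error
    plus twice the tail, each at most d.\<close>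
  define d where "d = e / 4"
  have d: "d > 0" unfolding d_def using e by simp
  have split: "(\<integral>\<xi>. w \<xi> * g \<xi> \<partial>\<rho>) \<le> d \<and> (\<integral>\<xi>. w \<xi> * g \<xi> \<partial>\<rho>') \<le> d"
    if w: "w \<in> borel_measurable \<rho>" "\<And>\<xi>. 0 \<le> w \<xi>" "\<And>\<xi>. w \<xi> \<le> c" and le: "(\<integral>\<xi>. w \<xi> * g \<xi> \<partial>\<sigma>) \<le> d" for w :: "'a dual \<Rightarrow> real" and c
  proof -
    have w': "w \<in> borel_measurable \<rho>'" using w(1) measurable_cong_sets[OF ss refl] by blast
    have wc: "\<bar>w \<xi>\<bar> \<le> c" for \<xi> using w(2,3)[of \<xi>] by simp
    have "(\<integral>\<xi>. w \<xi> * g \<xi> \<partial>\<sigma>) = (\<integral>\<xi>. w \<xi> * g \<xi> \<partial>\<rho>) + (\<integral>\<xi>. w \<xi> * g \<xi> \<partial>\<rho>')"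
      unfolding \<sigma>_def
      by (rule integrable_sum_measure(2)[OF ss borel_measurable_times[OF w(1) gm] _ integrable_bounded_mult[OF gi w(1) wc] integrable_bounded_mult[OF gi' w' wc]])
         (use w(2) g0 in simp)
    moreover have "0 \<le> (\<integral>\<xi>. w \<xi> * g \<xi> \<partial>\<rho>)" "0 \<le> (\<integral>\<xi>. w \<xi> * g \<xi> \<partial>\<rho>')"
      using w(2) g0 by (intro Bochner_Integration.integral_nonneg; simp)+
    ultimately show ?thesis using le by linarith
  qed
  obtain K where K: "compact K" "(\<integral>\<xi>. indicator (- K) \<xi> * (cmod (F \<xi>))\<^sup>2 \<partial>\<sigma>) \<le> d"
    by (rule radon_compact_tail[OF \<sigma> F(1,2) F\<sigma> d])
  obtain S where S: "S \<in> sets borel" "emeasure \<rho> (K - S) = 0" "emeasure \<rho>' (K \<inter> S) = 0" using sing[OF K(1)] by blast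
  have Kb: "K \<in> sets borel" using K(1) by (intro borel_closed compact_imp_closed)
  have KS: "K \<inter> S \<in> sets borel" using Kb S(1) by (rule sets.Int)
  obtain f where f: "f \<in> real_trig" "\<And>\<xi>. \<bar>f \<xi>\<bar> \<le> 2" "(\<integral>\<xi>. (f \<xi> - indicator (K \<inter> S) \<xi>)\<^sup>2 * (cmod (F \<xi>))\<^sup>2 \<partial>\<sigma>) \<le> d"
    by (rule trig_approx_indicator[OF \<sigma> F(1,2) F\<sigma> KS d]) blast
  have fm: "f \<in> borel_measurable \<rho>" and fm': "f \<in> borel_measurable \<rho>'"
    by (rule radon_continuous_measurable[OF \<rho> real_trig_continuous[OF f(1)]],
        rule radon_continuous_measurable[OF \<rho>' real_trig_continuous[OF f(1)]])
  have ind: "(indicator T :: 'a dual \<Rightarrow> real) \<in> borel_measurable \<rho>" "(indicator T :: 'a dual \<Rightarrow> real) \<in> borel_measurable \<rho>'"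
    if "T \<in> sets borel" for T using that s s' by (auto intro: borel_measurable_indicator)
  have nine: "\<bar>f \<xi> - indicator T \<xi>\<bar>\<^sup>2 \<le> 3\<^sup>2" for \<xi> T
    using f(2)[of \<xi>] by (intro power_mono) (auto simp: indicator_def)
  have tail: "(\<integral>\<xi>. indicator (- K) \<xi> * g \<xi> \<partial>\<rho>) \<le> d"
    using split[OF ind(1)[OF borel_comp[OF Kb]], of 1] K(2) unfolding g_def by (simp add: indicator_def)
  have appr: "(\<integral>\<xi>. (f \<xi> - indicator (K \<inter> S) \<xi>)\<^sup>2 * g \<xi> \<partial>\<rho>) \<le> d \<and> (\<integral>\<xi>. (f \<xi> - indicator (K \<inter> S) \<xi>)\<^sup>2 * g \<xi> \<partial>\<rho>') \<le> d"
  proof (rule split)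
    show "(\<lambda>\<xi>. (f \<xi> - indicator (K \<inter> S) \<xi>)\<^sup>2) \<in> borel_measurable \<rho>"
      by (intro borel_measurable_power borel_measurable_diff fm ind(1)[OF KS])
    show "(f \<xi> - indicator (K \<inter> S) \<xi>)\<^sup>2 \<le> 9" for \<xi> using nine[of \<xi> "K \<inter> S"] by simp
  qed (use f(3) in \<open>simp_all add: g_def\<close>)
  have fi: "integrable \<rho> (\<lambda>\<xi>. (f \<xi> - indicator T \<xi>)\<^sup>2 * g \<xi>)" "integrable \<rho>' (\<lambda>\<xi>. (f \<xi> - indicator T \<xi>)\<^sup>2 * g \<xi>)"
    if T: "T \<in> sets borel" for T
  proof -
    have b: "\<bar>(f \<xi> - indicator T \<xi>)\<^sup>2\<bar> \<le> 9" for \<xi> using nine[of \<xi> T] by simp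
    show "integrable \<rho> (\<lambda>\<xi>. (f \<xi> - indicator T \<xi>)\<^sup>2 * g \<xi>)"
      by (rule integrable_bounded_mult[OF gi borel_measurable_power[OF borel_measurable_diff[OF fm ind(1)[OF T]]] b])
    show "integrable \<rho>' (\<lambda>\<xi>. (f \<xi> - indicator T \<xi>)\<^sup>2 * g \<xi>)"
      by (rule integrable_bounded_mult[OF gi' borel_measurable_power[OF borel_measurable_diff[OF fm' ind(2)[OF T]]] b])
  qed
  have null: "AE \<xi> in \<rho>. \<xi> \<notin> K - S" "AE \<xi> in \<rho>'. \<xi> \<notin> K \<inter> S"
  proof -
    have "K - S \<in> null_sets \<rho>" "K \<inter> S \<in> null_sets \<rho>'"
      using S(2,3) sets.Diff[OF Kb S(1)] KS s s' by (simp_all add: null_sets_def)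
    from AE_not_in[OF this(1)] AE_not_in[OF this(2)]
    show "AE \<xi> in \<rho>. \<xi> \<notin> K - S" "AE \<xi> in \<rho>'. \<xi> \<notin> K \<inter> S" by simp_all
  qed
  have ti: "integrable \<rho> (\<lambda>\<xi>. indicator (- K) \<xi> * g \<xi>)"
    by (rule integrable_bounded_mult[OF gi ind(1)[OF borel_comp[OF Kb]], of 1]) (simp add: indicator_def)
  have "(\<integral>\<xi>. (1 - f \<xi>)\<^sup>2 * g \<xi> \<partial>\<rho>) \<le> (\<integral>\<xi>. 2 * ((f \<xi> - indicator (K \<inter> S) \<xi>)\<^sup>2 * g \<xi>) + 2 * (indicator (- K) \<xi> * g \<xi>) \<partial>\<rho>)"
  proof (rule integral_mono_AE)
    show "integrable \<rho> (\<lambda>\<xi>. (1 - f \<xi>)\<^sup>2 * g \<xi>)"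
    proof -
      \<comment> \<open>With T = UNIV the indicator becomes the constant 1.\<close>
      have "UNIV \<in> sets (borel :: 'a dual measure)" by simp
      from fi(1)[OF this] show ?thesis by (simp add: power2_commute)
    qed
    show "integrable \<rho> (\<lambda>\<xi>. 2 * ((f \<xi> - indicator (K \<inter> S) \<xi>)\<^sup>2 * g \<xi>) + 2 * (indicator (- K) \<xi> * g \<xi>))"
      by (intro Bochner_Integration.integrable_add integrable_mult_right fi(1)[OF KS] ti)
    show "AE \<xi> in \<rho>. (1 - f \<xi>)\<^sup>2 * g \<xi> \<le> 2 * ((f \<xi> - indicator (K \<inter> S) \<xi>)\<^sup>2 * g \<xi>) + 2 * (indicator (- K) \<xi> * g \<xi>)"
      using null(1)
    proof eventually_elim
      fix \<xi> assume n: "\<xi> \<notin> K - S"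
      have "(1 - f \<xi>)\<^sup>2 \<le> 2 * (f \<xi> - indicator (K \<inter> S) \<xi>)\<^sup>2 + 2 * indicator (- K) \<xi>"
      proof (cases "\<xi> \<in> K")
        case True
        then have "(1 - f \<xi>)\<^sup>2 = (f \<xi> - indicator (K \<inter> S) \<xi>)\<^sup>2" using n by (simp add: power2_commute)
        then show ?thesis using True by simp
      next
        case False
        have "0 \<le> (1 + f \<xi>)\<^sup>2" by simp
        then have "(1 - f \<xi>)\<^sup>2 \<le> 2 * (f \<xi>)\<^sup>2 + 2" by (simp add: power2_sum power2_diff)
        then show ?thesis using False by simp
      qed
      from mult_right_mono[OF this g0[of \<xi>]]
      show "(1 - f \<xi>)\<^sup>2 * g \<xi> \<le> 2 * ((f \<xi> - indicator (K \<inter> S) \<xi>)\<^sup>2 * g \<xi>) + 2 * (indicator (- K) \<xi> * g \<xi>)"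
        by (simp add: distrib_right)
    qed
  qed
  also have "\<dots> = 2 * (\<integral>\<xi>. (f \<xi> - indicator (K \<inter> S) \<xi>)\<^sup>2 * g \<xi> \<partial>\<rho>) + 2 * (\<integral>\<xi>. indicator (- K) \<xi> * g \<xi> \<partial>\<rho>)"
    by (simp only: Bochner_Integration.integral_add[OF integrable_mult_right[OF fi(1)[OF KS]] integrable_mult_right[OF ti]] integral_mult_right_zero)
  also have "\<dots> \<le> e" using appr tail unfolding d_def by linarith
  finally have 1: "(\<integral>\<xi>. (1 - f \<xi>)\<^sup>2 * g \<xi> \<partial>\<rho>) \<le> e" .
  have "(\<integral>\<xi>. (f \<xi>)\<^sup>2 * g \<xi> \<partial>\<rho>') = (\<integral>\<xi>. (f \<xi> - indicator (K \<inter> S) \<xi>)\<^sup>2 * g \<xi> \<partial>\<rho>')"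
  proof (rule integral_cong_AE)
    show "(\<lambda>\<xi>. (f \<xi>)\<^sup>2 * g \<xi>) \<in> borel_measurable \<rho>'"
      using borel_measurable_integrable[OF fi(2)[OF sets.empty_sets]] by simp
    show "(\<lambda>\<xi>. (f \<xi> - indicator (K \<inter> S) \<xi>)\<^sup>2 * g \<xi>) \<in> borel_measurable \<rho>'"
      by (rule borel_measurable_integrable[OF fi(2)[OF KS]])
    show "AE \<xi> in \<rho>'. (f \<xi>)\<^sup>2 * g \<xi> = (f \<xi> - indicator (K \<inter> S) \<xi>)\<^sup>2 * g \<xi>"
      using null(2) by eventually_elim simp
  qed
  also have "\<dots> \<le> e" using appr e unfolding d_def by linarith
  finally have 2: "(\<integral>\<xi>. (f \<xi>)\<^sup>2 * g \<xi> \<partial>\<rho>') \<le> e" .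
  show ?thesis by (rule that[OF f(1) 1[unfolded g_def] 2[unfolded g_def]])
qed

text \<open>The argument at which \<open>conv_cm_fun \<gamma> (conv_fun h \<phi> (tilde_fun \<phi>))
  0\<close> evaluates \<gamma>; hence the reflection \<open>0 - s\<close>.\<close>

definition autocorrelation_test :: "'a :: ab_group_add measure \<Rightarrow> ('a \<Rightarrow> complex) \<Rightarrow> 'a \<Rightarrow> complex" where
  "autocorrelation_test h \<phi> = (\<lambda>s. conv_fun h \<phi> (tilde_fun \<phi>) (0 - s))"

lemma autocorrelation_test_Cc:
  fixes h :: "'a :: lca_group measure"
  assumes "haar_measure h" "\<phi> \<in> Cc" shows "autocorrelation_test h \<phi> \<in> Cc"
  unfolding autocorrelation_test_def conv_fun_def
  by (rule Cc_minus_arg[OF Cc_conv[OF haar_radon[OF assms(1)] assms(2) Cc_tilde[OF assms(2)]]])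

lemma fourier_sq_integrable:
  fixes h :: "'a :: lca_group measure"
  assumes h: "haar_measure h" and FT: "has_fourier_transform h \<gamma> \<rho>" and \<phi>: "\<phi> \<in> Cc"
  shows "sq_integrable \<rho> (fourier_fun h \<phi>)"
proof -
  have r: "radon_measure \<rho>" using FT unfolding has_fourier_transform_def by blast
  have "\<forall>\<phi>\<in>Cc. integrable \<rho> (\<lambda>\<xi>. (cmod (fourier_fun h \<phi> \<xi>))\<^sup>2)" using FT unfolding has_fourier_transform_def by simp
  then show ?thesis
    unfolding sq_integrable_def using radon_continuous_measurable[OF r fourier_continuous[OF h \<phi>]] \<phi> by blast
qed

context
  fixes h :: "'a :: lca_group measure" and I :: "'i set" and le :: "'i \<Rightarrow> 'i \<Rightarrow> bool" and A :: "'i \<Rightarrow> 'a set"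
  assumes h: "haar_measure h" and vH: "van_hove_net h I le A"
begin

lemma vH_directed: "directed_set I le"
  and vH_open: "i \<in> I \<Longrightarrow> open (A i)"
  and vH_compact: "i \<in> I \<Longrightarrow> compact (closure (A i))"
  and vH_pos: "i \<in> I \<Longrightarrow> measure h (A i) > 0"
  using vH unfolding van_hove_net_def by auto

text \<open>The sesquilinear form whose diagonal is \<open>mean_sq\<close>. As
  \<open>restrict_conv\<close> is conjugate-linear in the test function, the form is
  conjugate-linear in \<phi> and linear in \<psi>.\<close>

definition mean_pair :: "(('a \<Rightarrow> complex) \<Rightarrow> complex) \<Rightarrow> (('a \<Rightarrow> complex) \<Rightarrow> complex) \<Rightarrow> ('a \<Rightarrow> complex) \<Rightarrow> ('a \<Rightarrow> complex) \<Rightarrow> 'i \<Rightarrow> complex" where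
  "mean_pair \<mu> \<nu> \<phi> \<psi> i = (\<integral>u. restrict_conv \<mu> (A i) \<phi> u * cnj (restrict_conv \<nu> (A i) \<psi> u) \<partial>h) / complex_of_real (measure h (A i))"

definition mean_sq :: "(('a \<Rightarrow> complex) \<Rightarrow> complex) \<Rightarrow> ('a \<Rightarrow> complex) \<Rightarrow> 'i \<Rightarrow> real" where
  "mean_sq \<mu> \<phi> i = (\<integral>u. (cmod (restrict_conv \<mu> (A i) \<phi> u))\<^sup>2 \<partial>h) / measure h (A i)"

lemma restrict_conv_sq_integrable:
  assumes "i \<in> I" "complex_measure \<mu>" "\<phi> \<in> Cc"
  shows "sq_integrable h (restrict_conv \<mu> (A i) \<phi>)"
  by (rule sq_integrable_Cc[OF haar_radon[OF h] restrict_conv_Cc[OF vH_open[OF assms(1)] vH_compact[OF assms(1)] assms(2,3)]])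

lemma mean_sq_nonneg: "0 \<le> mean_sq \<mu> \<phi> i"
  unfolding mean_sq_def by (intro divide_nonneg_nonneg Bochner_Integration.integral_nonneg) auto

lemma mean_pair_self: "mean_pair \<mu> \<mu> \<phi> \<phi> i = complex_of_real (mean_sq \<mu> \<phi> i)"
  unfolding mean_pair_def mean_sq_def complex_norm_square[symmetric] integral_complex_of_real by simp

lemma mean_pair_bound:
  assumes i: "i \<in> I" and \<mu>: "complex_measure \<mu>" and \<nu>: "complex_measure \<nu>" and \<phi>: "\<phi> \<in> Cc" and \<psi>: "\<psi> \<in> Cc"
  shows "cmod (mean_pair \<mu> \<nu> \<phi> \<psi> i) \<le> sqrt (mean_sq \<mu> \<phi> i) * sqrt (mean_sq \<nu> \<psi> i)"
proof -
  have m: "measure h (A i) > 0" by (rule vH_pos[OF i])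
  have "cmod (mean_pair \<mu> \<nu> \<phi> \<psi> i) = cmod (\<integral>u. restrict_conv \<mu> (A i) \<phi> u * cnj (restrict_conv \<nu> (A i) \<psi> u) \<partial>h) / measure h (A i)"
    unfolding mean_pair_def norm_divide norm_of_real using m by simp
  also have "\<dots> \<le> (L2norm h (restrict_conv \<mu> (A i) \<phi>) * L2norm h (restrict_conv \<nu> (A i) \<psi>)) / measure h (A i)"
    using m by (intro divide_right_mono integral_Cauchy_Schwarz restrict_conv_sq_integrable i \<mu> \<nu> \<phi> \<psi>) auto
  also have "\<dots> = sqrt (mean_sq \<mu> \<phi> i) * sqrt (mean_sq \<nu> \<psi> i)"
    unfolding L2norm_def mean_sq_def real_sqrt_divide using m real_sqrt_mult_self[of "measure h (A i)"] by simp
  finally show ?thesis .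
qed

lemma mean_pair_trig_adj:
  assumes i: "i \<in> I" and \<mu>: "complex_measure \<mu>" and \<nu>: "complex_measure \<nu>" and \<phi>: "\<phi> \<in> Cc" and \<psi>: "\<psi> \<in> Cc"
  shows "mean_pair \<mu> \<nu> (trig_op xs \<phi>) \<psi> i = mean_pair \<mu> \<nu> \<phi> (trig_op (trig_adj xs) \<psi>) i"
  unfolding mean_pair_def restrict_conv_trig_adj[OF h vH_open[OF i] vH_compact[OF i] \<mu> \<nu> \<phi> \<psi>] ..

lemma mean_pair_add_left:
  assumes i: "i \<in> I" and \<mu>: "complex_measure \<mu>" and \<nu>: "complex_measure \<nu>"
    and \<phi>: "\<phi> \<in> Cc" and \<phi>': "\<phi>' \<in> Cc" and \<psi>: "\<psi> \<in> Cc"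
  shows "mean_pair \<mu> \<nu> (\<lambda>x. \<phi> x + \<phi>' x) \<psi> i = mean_pair \<mu> \<nu> \<phi> \<psi> i + mean_pair \<mu> \<nu> \<phi>' \<psi> i"
proof -
  note int = integrable_mult_cnj[OF restrict_conv_sq_integrable[OF i \<mu>] restrict_conv_sq_integrable[OF i \<nu> \<psi>]]
  show ?thesis
    unfolding mean_pair_def restrict_conv_add[OF vH_open[OF i] vH_compact[OF i] \<mu> \<phi> \<phi>'] distrib_right
      Bochner_Integration.integral_add[OF int[OF \<phi>] int[OF \<phi>']] by (rule add_divide_distrib)
qed

lemma mean_pair_add_right:
  assumes i: "i \<in> I" and \<mu>: "complex_measure \<mu>" and \<nu>: "complex_measure \<nu>"
    and \<phi>: "\<phi> \<in> Cc" and \<psi>: "\<psi> \<in> Cc" and \<psi>': "\<psi>' \<in> Cc"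
  shows "mean_pair \<mu> \<nu> \<phi> (\<lambda>x. \<psi> x + \<psi>' x) i = mean_pair \<mu> \<nu> \<phi> \<psi> i + mean_pair \<mu> \<nu> \<phi> \<psi>' i"
proof -
  note int = integrable_mult_cnj[OF restrict_conv_sq_integrable[OF i \<mu> \<phi>] restrict_conv_sq_integrable[OF i \<nu>]]
  show ?thesis
    unfolding mean_pair_def restrict_conv_add[OF vH_open[OF i] vH_compact[OF i] \<nu> \<psi> \<psi>'] distrib_left complex_cnj_add
      Bochner_Integration.integral_add[OF int[OF \<psi>] int[OF \<psi>']] by (rule add_divide_distrib)
qed

text \<open>By \<open>conv_cm_restrict\<close> the squared mean is the approximant of the
  autocorrelation at the test function; that identity holds for indices in I, hence eventually along
  the filter.\<close>

lemma mean_sq_tendsto_complex: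
  assumes ac: "is_autocorrelation h I le A \<mu> \<gamma>" and \<mu>: "complex_measure \<mu>" and \<phi>: "\<phi> \<in> Cc"
  shows "((\<lambda>i. complex_of_real (mean_sq \<mu> \<phi> i)) \<longlongrightarrow> \<gamma> (autocorrelation_test h \<phi>)) (net_filter I le)"
proof (rule Lim_transform_eventually)
  show "((\<lambda>i. conv_cm (restrict_cm \<mu> (A i)) (tilde_cm (restrict_cm \<mu> (A i))) (autocorrelation_test h \<phi>)
      / complex_of_real (measure h (A i))) \<longlongrightarrow> \<gamma> (autocorrelation_test h \<phi>)) (net_filter I le)"
    using ac autocorrelation_test_Cc[OF h \<phi>] unfolding is_autocorrelation_def by simp
  show "\<forall>\<^sub>F i in net_filter I le. conv_cm (restrict_cm \<mu> (A i)) (tilde_cm (restrict_cm \<mu> (A i))) (autocorrelation_test h \<phi>)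
      / complex_of_real (measure h (A i)) = complex_of_real (mean_sq \<mu> \<phi> i)"
    using eventually_net_filter_mem[OF vH_directed]
  proof eventually_elim
    case (elim i)
    show ?case
      unfolding autocorrelation_test_def conv_cm_restrict[OF vH_open[OF elim] vH_compact[OF elim] h \<mu> \<phi>]
        mean_pair_self[symmetric] mean_pair_def ..
  qed
qed

lemma mean_sq_tendsto:
  assumes ac: "is_autocorrelation h I le A \<mu> \<gamma>" and \<mu>: "complex_measure \<mu>" and \<phi>: "\<phi> \<in> Cc"
  shows "((\<lambda>i. mean_sq \<mu> \<phi> i) \<longlongrightarrow> Re (\<gamma> (autocorrelation_test h \<phi>))) (net_filter I le)"
  using tendsto_Re[OF mean_sq_tendsto_complex[OF assms]] by simp

text \<open>A limit of real numbers, and limits along the net are unique. It is wanted because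
  \<open>has_fourier_transform\<close> asks for an equality of complex numbers, while the limits
  below are computed for real parts.\<close>

lemma autocorrelation_real:
  assumes ac: "is_autocorrelation h I le A \<mu> \<gamma>" and \<mu>: "complex_measure \<mu>" and \<phi>: "\<phi> \<in> Cc"
  shows "\<gamma> (autocorrelation_test h \<phi>) = complex_of_real (Re (\<gamma> (autocorrelation_test h \<phi>)))"
  using tendsto_unique[OF net_filter_neq_bot[OF vH_directed] mean_sq_tendsto_complex[OF assms]
      tendsto_of_real[OF mean_sq_tendsto[OF assms]]] .

lemma mean_sq_tendsto_fourier:
  assumes ac: "is_autocorrelation h I le A \<mu> \<gamma>" and \<mu>: "complex_measure \<mu>" and \<phi>: "\<phi> \<in> Cc"
    and FT: "has_fourier_transform h \<gamma> \<rho>"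
  shows "((\<lambda>i. mean_sq \<mu> \<phi> i) \<longlongrightarrow> (\<integral>\<xi>. (cmod (fourier_fun h \<phi> \<xi>))\<^sup>2 \<partial>\<rho>)) (net_filter I le)"
proof -
  have "\<gamma> (autocorrelation_test h \<phi>) = complex_of_real (\<integral>\<xi>. (cmod (fourier_fun h \<phi> \<xi>))\<^sup>2 \<partial>\<rho>)"
    using FT \<phi> unfolding has_fourier_transform_def conv_cm_fun_def autocorrelation_test_def by blast
  then show ?thesis using mean_sq_tendsto[OF ac \<mu> \<phi>] by simp
qed

text \<open>Multiplying one factor by a trigonometric polynomial close to \<open>1\<close> for \<open>\<rho>\<close> and close to \<open>0\<close> for
  \<open>\<rho>'\<close> and moving it to the other factor shows that the cross term is small.\<close>

lemma cross_term_vanishes: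
  assumes \<mu>: "complex_measure \<mu>" and \<nu>: "complex_measure \<nu>"
    and ac: "is_autocorrelation h I le A \<mu> \<gamma>" "is_autocorrelation h I le A \<nu> \<gamma>'"
    and FT: "has_fourier_transform h \<gamma> \<rho>" "has_fourier_transform h \<gamma>' \<rho>'"
    and sing: "\<And>K. compact K \<Longrightarrow> \<exists>S\<in>sets borel. emeasure \<rho> (K - S) = 0 \<and> emeasure \<rho>' (K \<inter> S) = 0"
    and \<phi>: "\<phi> \<in> Cc"
  shows "(mean_pair \<mu> \<nu> \<phi> \<phi> \<longlongrightarrow> 0) (net_filter I le)"
proof (rule tendstoI)
  fix e :: real assume e: "e > 0"
  have r: "radon_measure \<rho>" "radon_measure \<rho>'" using FT unfolding has_fourier_transform_def by blast+
  define F where "F = fourier_fun h \<phi>"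
  define X where "X = (\<integral>\<xi>. (cmod (F \<xi>))\<^sup>2 \<partial>\<rho>)"
  define Y where "Y = (\<integral>\<xi>. (cmod (F \<xi>))\<^sup>2 \<partial>\<rho>')"
  have XY: "0 \<le> X" "0 \<le> Y" unfolding X_def Y_def by (auto intro!: Bochner_Integration.integral_nonneg)
  \<comment> \<open>Both factors that carry the polynomial become at most t, so the bound is t *
    (sqrt X + sqrt Y); the 1 excludes a zero denominator.\<close>
  define t where "t = e / (2 * (sqrt X + sqrt Y + 1))"
  have t: "t > 0" "t * (sqrt X + sqrt Y) < e"
  proof -
    have "0 < sqrt X + sqrt Y + 1" using XY by (simp add: add_nonneg_pos)
    then show "t > 0" "t * (sqrt X + sqrt Y) < e" unfolding t_def using e XY by (auto simp: field_simps intro!: add_nonneg_pos)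
  qed
  then have t2: "t\<^sup>2 > 0" by simp
  obtain f where f: "f \<in> real_trig" "(\<integral>\<xi>. (1 - f \<xi>)\<^sup>2 * (cmod (F \<xi>))\<^sup>2 \<partial>\<rho>) \<le> t\<^sup>2" "(\<integral>\<xi>. (f \<xi>)\<^sup>2 * (cmod (F \<xi>))\<^sup>2 \<partial>\<rho>') \<le> t\<^sup>2"
    unfolding F_def
    by (rule trig_split[OF r fourier_continuous[OF h \<phi>] fourier_bound[OF h \<phi>] fourier_sq_integrable[OF h FT(1) \<phi>]
          fourier_sq_integrable[OF h FT(2) \<phi>] sing t2])
  obtain xs where xs: "\<And>\<xi>. trig_sym xs \<xi> = complex_of_real (f \<xi>)" using f(1) unfolding real_trig_def by blast
  define a where "a = trig_op xs \<phi>"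
  \<comment> \<open>b, with symbol 1 - f, stays in the first argument, where it is small for \<rho>;
    the rest, a, is moved as c to the second argument, where it is small for \<rho>'.\<close>
  define b where "b = (\<lambda>x. \<phi> x + (- 1) * a x)"
  define c where "c = trig_op (trig_adj xs) \<phi>"
  have a: "a \<in> Cc" and c: "c \<in> Cc" unfolding a_def c_def by (rule trig_op_Cc[OF \<phi>])+
  have b: "b \<in> Cc" unfolding b_def by (rule Cc_add[OF \<phi> Cc_cmult[OF a]])
  have aF: "fourier_fun h a \<xi> = complex_of_real (f \<xi>) * F \<xi>" for \<xi>
    unfolding a_def F_def fourier_trig_op[OF h \<phi>] xs ..
  have cF: "fourier_fun h c \<xi> = complex_of_real (f \<xi>) * F \<xi>" for \<xi>
    unfolding c_def F_def fourier_trig_op[OF h \<phi>] trig_sym_adj xs by simp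
  have bF: "fourier_fun h b \<xi> = complex_of_real (1 - f \<xi>) * F \<xi>" for \<xi>
    unfolding b_def fourier_add[OF h \<phi> Cc_cmult[OF a]] fourier_cmult[OF h, of "- 1" a] aF F_def by (simp add: algebra_simps)
  have sq: "(cmod (complex_of_real w * z))\<^sup>2 = w\<^sup>2 * (cmod z)\<^sup>2" for w z
    by (simp add: norm_mult power_mult_distrib)
  have lb: "((\<lambda>i. mean_sq \<mu> b i) \<longlongrightarrow> (\<integral>\<xi>. (1 - f \<xi>)\<^sup>2 * (cmod (F \<xi>))\<^sup>2 \<partial>\<rho>)) (net_filter I le)"
    using mean_sq_tendsto_fourier[OF ac(1) \<mu> b FT(1)] unfolding bF sq .
  have lc: "((\<lambda>i. mean_sq \<nu> c i) \<longlongrightarrow> (\<integral>\<xi>. (f \<xi>)\<^sup>2 * (cmod (F \<xi>))\<^sup>2 \<partial>\<rho>')) (net_filter I le)"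
    using mean_sq_tendsto_fourier[OF ac(2) \<nu> c FT(2)] unfolding cF sq .
  have lX: "((\<lambda>i. mean_sq \<mu> \<phi> i) \<longlongrightarrow> X) (net_filter I le)" and lY: "((\<lambda>i. mean_sq \<nu> \<phi> i) \<longlongrightarrow> Y) (net_filter I le)"
    unfolding X_def Y_def F_def
    by (rule mean_sq_tendsto_fourier[OF ac(1) \<mu> \<phi> FT(1)], rule mean_sq_tendsto_fourier[OF ac(2) \<nu> \<phi> FT(2)])
  let ?L = "sqrt (\<integral>\<xi>. (1 - f \<xi>)\<^sup>2 * (cmod (F \<xi>))\<^sup>2 \<partial>\<rho>) * sqrt Y + sqrt X * sqrt (\<integral>\<xi>. (f \<xi>)\<^sup>2 * (cmod (F \<xi>))\<^sup>2 \<partial>\<rho>')"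
  have lim: "((\<lambda>i. sqrt (mean_sq \<mu> b i) * sqrt (mean_sq \<nu> \<phi> i) + sqrt (mean_sq \<mu> \<phi> i) * sqrt (mean_sq \<nu> c i)) \<longlongrightarrow> ?L) (net_filter I le)"
    by (intro tendsto_add tendsto_mult tendsto_real_sqrt lb lc lX lY)
  have "sqrt (\<integral>\<xi>. (1 - f \<xi>)\<^sup>2 * (cmod (F \<xi>))\<^sup>2 \<partial>\<rho>) \<le> t" "sqrt (\<integral>\<xi>. (f \<xi>)\<^sup>2 * (cmod (F \<xi>))\<^sup>2 \<partial>\<rho>') \<le> t"
    using f(2,3) t(1) by (auto intro: real_le_lsqrt)
  then have "?L \<le> t * sqrt Y + sqrt X * t" using XY by (intro add_mono mult_right_mono mult_left_mono) auto
  also have "\<dots> < e" using t(2) by (simp add: algebra_simps)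
  finally have "\<forall>\<^sub>F i in net_filter I le. sqrt (mean_sq \<mu> b i) * sqrt (mean_sq \<nu> \<phi> i) + sqrt (mean_sq \<mu> \<phi> i) * sqrt (mean_sq \<nu> c i) < e"
    by (rule order_tendstoD(2)[OF lim])
  with eventually_net_filter_mem[OF vH_directed] show "\<forall>\<^sub>F i in net_filter I le. dist (mean_pair \<mu> \<nu> \<phi> \<phi> i) 0 < e"
  proof eventually_elim
    case (elim i)
    have "\<phi> = (\<lambda>x. b x + a x)" unfolding b_def by simp
    then have "mean_pair \<mu> \<nu> \<phi> \<phi> i = mean_pair \<mu> \<nu> (\<lambda>x. b x + a x) \<phi> i" by simp
    also have "\<dots> = mean_pair \<mu> \<nu> b \<phi> i + mean_pair \<mu> \<nu> a \<phi> i"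
      by (rule mean_pair_add_left[OF elim(1) \<mu> \<nu> b a \<phi>])
    also have "mean_pair \<mu> \<nu> a \<phi> i = mean_pair \<mu> \<nu> \<phi> c i"
      unfolding a_def c_def by (rule mean_pair_trig_adj[OF elim(1) \<mu> \<nu> \<phi> \<phi>])
    finally have "cmod (mean_pair \<mu> \<nu> \<phi> \<phi> i) \<le> cmod (mean_pair \<mu> \<nu> b \<phi> i) + cmod (mean_pair \<mu> \<nu> \<phi> c i)"
      by (simp add: norm_triangle_ineq)
    also have "\<dots> \<le> sqrt (mean_sq \<mu> b i) * sqrt (mean_sq \<nu> \<phi> i) + sqrt (mean_sq \<mu> \<phi> i) * sqrt (mean_sq \<nu> c i)"
      by (intro add_mono mean_pair_bound elim(1) \<mu> \<nu> \<phi> b c)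
    finally show ?case using elim(2) by simp
  qed
qed

lemma mean_sq_add3:
  assumes i: "i \<in> I" and c: "complex_measure \<omega>" "complex_measure \<omega>1" "complex_measure \<omega>2" "complex_measure \<omega>3"
    and sum: "\<And>\<phi>. \<phi> \<in> Cc \<Longrightarrow> \<omega> \<phi> = \<omega>1 \<phi> + \<omega>2 \<phi> + \<omega>3 \<phi>" and \<phi>: "\<phi> \<in> Cc"
  shows "mean_sq \<omega> \<phi> i = mean_sq \<omega>1 \<phi> i + mean_sq \<omega>2 \<phi> i + mean_sq \<omega>3 \<phi> i
    + 2 * Re (mean_pair \<omega>1 \<omega>2 \<phi> \<phi> i) + 2 * Re (mean_pair \<omega>1 \<omega>3 \<phi> \<phi> i) + 2 * Re (mean_pair \<omega>2 \<omega>3 \<phi> \<phi> i)"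
proof -
  define G where "G \<mu> = restrict_conv \<mu> (A i) \<phi>" for \<mu>
  note s = restrict_conv_sq_integrable[OF i _ \<phi>, folded G_def]
  have G: "G \<omega> u = (G \<omega>1 u + G \<omega>2 u) + G \<omega>3 u" for u
    unfolding G_def by (rule restrict_conv_add3[OF vH_open[OF i] vH_compact[OF i] c sum \<phi>])
  have "(\<integral>u. (cmod (G \<omega> u))\<^sup>2 \<partial>h) = (\<integral>u. (cmod (G \<omega>1 u))\<^sup>2 \<partial>h) + (\<integral>u. (cmod (G \<omega>2 u))\<^sup>2 \<partial>h) + (\<integral>u. (cmod (G \<omega>3 u))\<^sup>2 \<partial>h)
      + 2 * Re (\<integral>u. G \<omega>1 u * cnj (G \<omega>2 u) \<partial>h) + 2 * (Re (\<integral>u. G \<omega>1 u * cnj (G \<omega>3 u) \<partial>h) + Re (\<integral>u. G \<omega>2 u * cnj (G \<omega>3 u) \<partial>h))"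
    unfolding G integral_norm_sq_add[OF sq_integrable_add[OF s[OF c(2)] s[OF c(3)]] s[OF c(4)]]
      integral_norm_sq_add[OF s[OF c(2)] s[OF c(3)]] distrib_right
      Bochner_Integration.integral_add[OF integrable_mult_cnj[OF s[OF c(2)] s[OF c(4)]] integrable_mult_cnj[OF s[OF c(3)] s[OF c(4)]]]
    by simp
  then show ?thesis
    unfolding mean_sq_def mean_pair_def G_def by (simp add: add_divide_distrib Re_divide_of_real)
qed

text \<open>The limit is taken in the expansion of the square of a threefold sum: three squares
  converge to integrals, three cross terms to 0. Uniqueness of the limit identifies the result with
  the value of \<gamma>.\<close>

lemma fourier_transform_sum:
  assumes c: "complex_measure \<omega>" "complex_measure \<omega>1" "complex_measure \<omega>2" "complex_measure \<omega>3"
    and sum: "\<And>\<phi>. \<phi> \<in> Cc \<Longrightarrow> \<omega> \<phi> = \<omega>1 \<phi> + \<omega>2 \<phi> + \<omega>3 \<phi>"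
    and ac: "is_autocorrelation h I le A \<omega> \<gamma>" "is_autocorrelation h I le A \<omega>1 \<gamma>1"
      "is_autocorrelation h I le A \<omega>2 \<gamma>2" "is_autocorrelation h I le A \<omega>3 \<gamma>3"
    and FT: "has_fourier_transform h \<gamma>1 \<rho>1" "has_fourier_transform h \<gamma>2 \<rho>2" "has_fourier_transform h \<gamma>3 \<rho>3"
    and sing12: "\<And>K. compact K \<Longrightarrow> \<exists>S\<in>sets borel. emeasure \<rho>1 (K - S) = 0 \<and> emeasure \<rho>2 (K \<inter> S) = 0"
    and sing13: "\<And>K. compact K \<Longrightarrow> \<exists>S\<in>sets borel. emeasure \<rho>1 (K - S) = 0 \<and> emeasure \<rho>3 (K \<inter> S) = 0"
    and sing23: "\<And>K. compact K \<Longrightarrow> \<exists>S\<in>sets borel. emeasure \<rho>2 (K - S) = 0 \<and> emeasure \<rho>3 (K \<inter> S) = 0"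
  shows "has_fourier_transform h \<gamma> (sum_measure (sum_measure \<rho>1 \<rho>2) \<rho>3)"
proof -
  have r: "radon_measure \<rho>1" "radon_measure \<rho>2" "radon_measure \<rho>3" using FT unfolding has_fourier_transform_def by blast+
  have main: "integrable (sum_measure (sum_measure \<rho>1 \<rho>2) \<rho>3) (\<lambda>\<xi>. (cmod (fourier_fun h \<phi> \<xi>))\<^sup>2) \<and>
      conv_cm_fun \<gamma> (conv_fun h \<phi> (tilde_fun \<phi>)) 0 = complex_of_real (\<integral>\<xi>. (cmod (fourier_fun h \<phi> \<xi>))\<^sup>2 \<partial>sum_measure (sum_measure \<rho>1 \<rho>2) \<rho>3)"
    if \<phi>: "\<phi> \<in> Cc" for \<phi>
  proof -
    define g where "g \<xi> = (cmod (fourier_fun h \<phi> \<xi>))\<^sup>2" for \<xi>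
    note sum3 = sum_measure3[OF r fourier_continuous[OF h \<phi>] fourier_sq_integrable[OF h FT(1) \<phi>]
        fourier_sq_integrable[OF h FT(2) \<phi>] fourier_sq_integrable[OF h FT(3) \<phi>]]
    have "((\<lambda>i. mean_sq \<omega>1 \<phi> i + mean_sq \<omega>2 \<phi> i + mean_sq \<omega>3 \<phi> i + 2 * Re (mean_pair \<omega>1 \<omega>2 \<phi> \<phi> i)
        + 2 * Re (mean_pair \<omega>1 \<omega>3 \<phi> \<phi> i) + 2 * Re (mean_pair \<omega>2 \<omega>3 \<phi> \<phi> i)) \<longlongrightarrow>
        (\<integral>\<xi>. g \<xi> \<partial>\<rho>1) + (\<integral>\<xi>. g \<xi> \<partial>\<rho>2) + (\<integral>\<xi>. g \<xi> \<partial>\<rho>3) + 2 * Re 0 + 2 * Re 0 + 2 * Re 0) (net_filter I le)"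
      unfolding g_def
      by (intro tendsto_add tendsto_mult tendsto_const tendsto_Re
          mean_sq_tendsto_fourier[OF ac(2) c(2) \<phi> FT(1)] mean_sq_tendsto_fourier[OF ac(3) c(3) \<phi> FT(2)] mean_sq_tendsto_fourier[OF ac(4) c(4) \<phi> FT(3)]
          cross_term_vanishes[OF c(2,3) ac(2,3) FT(1,2) sing12 \<phi>] cross_term_vanishes[OF c(2,4) ac(2,4) FT(1,3) sing13 \<phi>]
          cross_term_vanishes[OF c(3,4) ac(3,4) FT(2,3) sing23 \<phi>])
    moreover have "\<forall>\<^sub>F i in net_filter I le. mean_sq \<omega>1 \<phi> i + mean_sq \<omega>2 \<phi> i + mean_sq \<omega>3 \<phi> i + 2 * Re (mean_pair \<omega>1 \<omega>2 \<phi> \<phi> i)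
        + 2 * Re (mean_pair \<omega>1 \<omega>3 \<phi> \<phi> i) + 2 * Re (mean_pair \<omega>2 \<omega>3 \<phi> \<phi> i) = mean_sq \<omega> \<phi> i"
      using eventually_net_filter_mem[OF vH_directed] by eventually_elim (rule mean_sq_add3[OF _ c sum \<phi>, symmetric])
    ultimately have "(mean_sq \<omega> \<phi> \<longlongrightarrow> (\<integral>\<xi>. g \<xi> \<partial>\<rho>1) + (\<integral>\<xi>. g \<xi> \<partial>\<rho>2) + (\<integral>\<xi>. g \<xi> \<partial>\<rho>3) + 2 * Re 0 + 2 * Re 0 + 2 * Re 0) (net_filter I le)"
      by (rule Lim_transform_eventually)
    from tendsto_unique[OF net_filter_neq_bot[OF vH_directed] mean_sq_tendsto[OF ac(1) c(1) \<phi>] this]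
    have "Re (\<gamma> (autocorrelation_test h \<phi>)) = (\<integral>\<xi>. g \<xi> \<partial>sum_measure (sum_measure \<rho>1 \<rho>2) \<rho>3)"
      unfolding g_def sum3(2) by simp
    then have "\<gamma> (autocorrelation_test h \<phi>) = complex_of_real (\<integral>\<xi>. g \<xi> \<partial>sum_measure (sum_measure \<rho>1 \<rho>2) \<rho>3)"
      using autocorrelation_real[OF ac(1) c(1) \<phi>] by simp
    then show ?thesis
      using sum3(1) unfolding conv_cm_fun_def autocorrelation_test_def g_def sq_integrable_def by blast
  qed
  then show ?thesis unfolding has_fourier_transform_def using radon_sum_measure[OF radon_sum_measure[OF r(1,2)] r(3)] by blast
qed

section \<open>Limit forms when the dual group is discrete\<close>

lemma mean_pair_cmult_right:
  assumes i: "i \<in> I" and \<nu>: "complex_measure \<nu>" and \<psi>: "\<psi> \<in> Cc"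
  shows "mean_pair \<mu> \<nu> \<phi> (\<lambda>x. c * \<psi> x) i = c * mean_pair \<mu> \<nu> \<phi> \<psi> i"
proof -
  have pointwise: "restrict_conv \<mu> (A i) \<phi> u * cnj (restrict_conv \<nu> (A i) (\<lambda>x. c * \<psi> x) u) =
      c * (restrict_conv \<mu> (A i) \<phi> u * cnj (restrict_conv \<nu> (A i) \<psi> u))" for u
    unfolding restrict_conv_cmult[OF vH_open[OF i] vH_compact[OF i] \<nu> \<psi>] by simp
  show ?thesis unfolding mean_pair_def pointwise integral_mult_right_zero by simp
qed

lemma mean_sq_cmult:
  assumes i: "i \<in> I" and \<nu>: "complex_measure \<nu>" and \<psi>: "\<psi> \<in> Cc"
  shows "mean_sq \<nu> (\<lambda>x. c * \<psi> x) i = (cmod c)\<^sup>2 * mean_sq \<nu> \<psi> i"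
  unfolding mean_sq_def restrict_conv_cmult[OF vH_open[OF i] vH_compact[OF i] \<nu> \<psi>]
  by (simp add: norm_mult power_mult_distrib)

lemma mean_sq_add:
  assumes i: "i \<in> I" and \<nu>: "complex_measure \<nu>" and \<phi>: "\<phi> \<in> Cc" and \<psi>: "\<psi> \<in> Cc"
  shows "mean_sq \<nu> (\<lambda>x. \<phi> x + \<psi> x) i = mean_sq \<nu> \<phi> i + mean_sq \<nu> \<psi> i + 2 * Re (mean_pair \<nu> \<nu> \<phi> \<psi> i)"
  unfolding mean_sq_def mean_pair_def restrict_conv_add[OF vH_open[OF i] vH_compact[OF i] \<nu> \<phi> \<psi>]
    integral_norm_sq_add[OF restrict_conv_sq_integrable[OF i \<nu> \<phi>] restrict_conv_sq_integrable[OF i \<nu> \<psi>]]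
  by (simp add: add_divide_distrib Re_divide_of_real)

text \<open>Twice the real part of a cross term is at most the sum of its two squares, and each
  square belongs to two cross terms besides its own occurrence; hence the constant 3.\<close>

lemma mean_sq_le3:
  assumes i: "i \<in> I" and c: "complex_measure \<omega>" "complex_measure \<omega>1" "complex_measure \<omega>2" "complex_measure \<omega>3"
    and sum: "\<And>\<phi>. \<phi> \<in> Cc \<Longrightarrow> \<omega> \<phi> = \<omega>1 \<phi> + \<omega>2 \<phi> + \<omega>3 \<phi>" and \<phi>: "\<phi> \<in> Cc"
  shows "mean_sq \<omega> \<phi> i \<le> 3 * (mean_sq \<omega>1 \<phi> i + mean_sq \<omega>2 \<phi> i + mean_sq \<omega>3 \<phi> i)"
proof -
  have cross: "2 * Re (mean_pair \<mu> \<nu> \<phi> \<phi> i) \<le> mean_sq \<mu> \<phi> i + mean_sq \<nu> \<phi> i"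
    if "complex_measure \<mu>" "complex_measure \<nu>" for \<mu> \<nu>
  proof -
    have "Re (mean_pair \<mu> \<nu> \<phi> \<phi> i) \<le> sqrt (mean_sq \<mu> \<phi> i) * sqrt (mean_sq \<nu> \<phi> i)"
      using mean_pair_bound[OF i that \<phi> \<phi>] complex_Re_le_cmod order_trans by blast
    moreover have "2 * sqrt x * sqrt y \<le> x + y" if "0 \<le> x" "0 \<le> y" for x y :: real
      using sum_squares_bound[of "sqrt x" "sqrt y"] that by simp
    ultimately show ?thesis
      using mean_sq_nonneg[of \<mu> \<phi> i] mean_sq_nonneg[of \<nu> \<phi> i] by fastforce
  qed
  have "mean_sq \<omega> \<phi> i = mean_sq \<omega>1 \<phi> i + mean_sq \<omega>2 \<phi> i + mean_sq \<omega>3 \<phi> i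
    + 2 * Re (mean_pair \<omega>1 \<omega>2 \<phi> \<phi> i) + 2 * Re (mean_pair \<omega>1 \<omega>3 \<phi> \<phi> i) + 2 * Re (mean_pair \<omega>2 \<omega>3 \<phi> \<phi> i)"
    by (rule mean_sq_add3[OF i c sum \<phi>])
  moreover have "x \<le> 3 * (a + b + c)" if "x = a + b + c + 2 * r + 2 * s + 2 * t" "2 * r \<le> a + b" "2 * s \<le> a + c" "2 * t \<le> b + c"
    for a b c r s t x :: real
    using that by (simp add: algebra_simps)
  ultimately show ?thesis using cross[OF c(2,3)] cross[OF c(2,4)] cross[OF c(3,4)] by blast
qed

text \<open>The invariance, additivity and bounds that
  \<open>discrete_fourier_representation\<close> asks for are established for the means and passed
  to the limit; \<open>mean_sq_le3\<close> supplies C = 3.\<close>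

lemma discrete_fourier_transform:
  assumes c: "complex_measure \<omega>" "complex_measure \<omega>1" "complex_measure \<omega>2" "complex_measure \<omega>3"
    and sum: "\<And>\<phi>. \<phi> \<in> Cc \<Longrightarrow> \<omega> \<phi> = \<omega>1 \<phi> + \<omega>2 \<phi> + \<omega>3 \<phi>"
    and ac: "is_autocorrelation h I le A \<omega> \<gamma>" "is_autocorrelation h I le A \<omega>1 \<gamma>1"
      "is_autocorrelation h I le A \<omega>2 \<gamma>2" "is_autocorrelation h I le A \<omega>3 \<gamma>3"
    and FT: "has_fourier_transform h \<gamma>1 \<rho>1" "has_fourier_transform h \<gamma>2 \<rho>2" "has_fourier_transform h \<gamma>3 \<rho>3"
    and disc: "\<And>\<xi> :: 'a dual. open {\<xi>}"
  shows "\<exists>\<rho>. has_fourier_transform h \<gamma> \<rho>"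
proof -
  let ?L = "net_filter I le"
  have nb: "?L \<noteq> bot" and ev: "\<forall>\<^sub>F i in ?L. i \<in> I"
    by (rule net_filter_neq_bot[OF vH_directed], rule eventually_net_filter_mem[OF vH_directed])
  define Q where "Q \<phi> = Re (\<gamma> (autocorrelation_test h \<phi>))" for \<phi>
  \<comment> \<open>Convergence is given for squared means only, so the pair form is recovered by
    polarisation. As it is linear in \<psi>, replacing \<psi> by \<i> * \<psi> makes the real part
    minus the imaginary part, which explains the sign in B.\<close>
  define R where "R \<phi> \<psi> = (Q (\<lambda>x. \<phi> x + \<psi> x) - Q \<phi> - Q \<psi>) / 2" for \<phi> \<psi>
  define B where "B \<phi> \<psi> = Complex (R \<phi> \<psi>) (- R \<phi> (\<lambda>x. \<i> * \<psi> x))" for \<phi> \<psi>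
  define \<sigma> where "\<sigma> = sum_measure (sum_measure \<rho>1 \<rho>2) \<rho>3"
  have r: "radon_measure \<rho>1" "radon_measure \<rho>2" "radon_measure \<rho>3" using FT unfolding has_fourier_transform_def by blast+
  have \<sigma>: "radon_measure \<sigma>" unfolding \<sigma>_def by (rule radon_sum_measure[OF radon_sum_measure[OF r(1,2)] r(3)])
  note parts = sum_measure3[OF r fourier_continuous[OF h] fourier_sq_integrable[OF h FT(1)]
      fourier_sq_integrable[OF h FT(2)] fourier_sq_integrable[OF h FT(3)], folded \<sigma>_def L2norm_sq]
  have Ql: "(mean_sq \<omega> \<phi> \<longlongrightarrow> Q \<phi>) ?L" if "\<phi> \<in> Cc" for \<phi>
    unfolding Q_def by (rule mean_sq_tendsto[OF ac(1) c(1) that])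
  have Rl: "((\<lambda>i. Re (mean_pair \<omega> \<omega> \<phi> \<psi> i)) \<longlongrightarrow> R \<phi> \<psi>) ?L" if \<phi>: "\<phi> \<in> Cc" and \<psi>: "\<psi> \<in> Cc" for \<phi> \<psi>
  proof (rule Lim_transform_eventually)
    show "((\<lambda>i. (mean_sq \<omega> (\<lambda>x. \<phi> x + \<psi> x) i - mean_sq \<omega> \<phi> i - mean_sq \<omega> \<psi> i) / 2) \<longlongrightarrow> R \<phi> \<psi>) ?L"
      unfolding R_def by (intro tendsto_divide tendsto_diff tendsto_const Ql Cc_add \<phi> \<psi>) simp
    show "\<forall>\<^sub>F i in ?L. (mean_sq \<omega> (\<lambda>x. \<phi> x + \<psi> x) i - mean_sq \<omega> \<phi> i - mean_sq \<omega> \<psi> i) / 2 = Re (mean_pair \<omega> \<omega> \<phi> \<psi> i)"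
      using ev
    proof eventually_elim
      case (elim i)
      show ?case unfolding mean_sq_add[OF elim c(1) \<phi> \<psi>] by simp
    qed
  qed
  have Bl: "(mean_pair \<omega> \<omega> \<phi> \<psi> \<longlongrightarrow> B \<phi> \<psi>) ?L" if \<phi>: "\<phi> \<in> Cc" and \<psi>: "\<psi> \<in> Cc" for \<phi> \<psi>
  proof (rule Lim_transform_eventually)
    show "((\<lambda>i. Complex (Re (mean_pair \<omega> \<omega> \<phi> \<psi> i)) (- Re (mean_pair \<omega> \<omega> \<phi> (\<lambda>x. \<i> * \<psi> x) i))) \<longlongrightarrow> B \<phi> \<psi>) ?L"
      unfolding B_def by (intro tendsto_Complex tendsto_minus Rl \<phi> \<psi> Cc_cmult[OF \<psi>])
    show "\<forall>\<^sub>F i in ?L. Complex (Re (mean_pair \<omega> \<omega> \<phi> \<psi> i)) (- Re (mean_pair \<omega> \<omega> \<phi> (\<lambda>x. \<i> * \<psi> x) i)) = mean_pair \<omega> \<omega> \<phi> \<psi> i"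
      using ev
    proof eventually_elim
      case (elim i)
      show ?case unfolding mean_pair_cmult_right[OF elim c(1) \<psi>] by (simp add: complex_eq_iff)
    qed
  qed
  have Q0: "0 \<le> Q \<phi>" if "\<phi> \<in> Cc" for \<phi>
    by (rule tendsto_lowerbound[OF Ql[OF that] _ nb]) (simp add: mean_sq_nonneg)
  have Q3: "Q \<phi> \<le> 3 * (L2norm \<sigma> (fourier_fun h \<phi>))\<^sup>2" if \<phi>: "\<phi> \<in> Cc" for \<phi>
    unfolding parts(2)[OF \<phi> \<phi> \<phi> \<phi>]
  proof (rule tendsto_le[OF nb _ Ql[OF \<phi>]])
    show "((\<lambda>i. 3 * (mean_sq \<omega>1 \<phi> i + mean_sq \<omega>2 \<phi> i + mean_sq \<omega>3 \<phi> i)) \<longlongrightarrow>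
        3 * ((L2norm \<rho>1 (fourier_fun h \<phi>))\<^sup>2 + (L2norm \<rho>2 (fourier_fun h \<phi>))\<^sup>2 + (L2norm \<rho>3 (fourier_fun h \<phi>))\<^sup>2)) ?L"
      unfolding L2norm_sq
      by (intro tendsto_mult tendsto_add tendsto_const mean_sq_tendsto_fourier[OF ac(2) c(2) \<phi> FT(1)]
          mean_sq_tendsto_fourier[OF ac(3) c(3) \<phi> FT(2)] mean_sq_tendsto_fourier[OF ac(4) c(4) \<phi> FT(3)])
    show "\<forall>\<^sub>F i in ?L. mean_sq \<omega> \<phi> i \<le> 3 * (mean_sq \<omega>1 \<phi> i + mean_sq \<omega>2 \<phi> i + mean_sq \<omega>3 \<phi> i)"
      using ev by eventually_elim (rule mean_sq_le3[OF _ c sum \<phi>])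
  qed
  have "\<exists>\<rho>. radon_measure \<rho> \<and> (\<forall>\<phi>\<in>Cc. integrable \<rho> (\<lambda>\<xi>. (cmod (fourier_fun h \<phi> \<xi>))\<^sup>2) \<and>
     (\<integral>\<xi>. (cmod (fourier_fun h \<phi> \<xi>))\<^sup>2 \<partial>\<rho>) = Q \<phi>)"
  proof (rule discrete_fourier_representation[where \<sigma> = \<sigma> and B = B and C = 3])
    fix \<phi> \<psi> \<psi>' :: "'a \<Rightarrow> complex" assume \<phi>: "\<phi> \<in> Cc" and \<psi>: "\<psi> \<in> Cc" and \<psi>': "\<psi>' \<in> Cc"
    have "(mean_pair \<omega> \<omega> \<phi> (\<lambda>x. \<psi> x + \<psi>' x) \<longlongrightarrow> B \<phi> \<psi> + B \<phi> \<psi>') ?L"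
      by (rule Lim_transform_eventually[OF tendsto_add[OF Bl[OF \<phi> \<psi>] Bl[OF \<phi> \<psi>']]])
         (use ev in \<open>eventually_elim, simp add: mean_pair_add_right[OF _ c(1) c(1) \<phi> \<psi> \<psi>']\<close>)
    from tendsto_unique[OF nb Bl[OF \<phi> Cc_add[OF \<psi> \<psi>']] this]
    show "B \<phi> (\<lambda>x. \<psi> x + \<psi>' x) = B \<phi> \<psi> + B \<phi> \<psi>'" .
  next
    fix \<phi> \<psi> :: "'a \<Rightarrow> complex" and xs assume \<phi>: "\<phi> \<in> Cc" and \<psi>: "\<psi> \<in> Cc"
    have "(mean_pair \<omega> \<omega> \<phi> (trig_op (trig_adj xs) \<psi>) \<longlongrightarrow> B (trig_op xs \<phi>) \<psi>) ?L"
      by (rule Lim_transform_eventually[OF Bl[OF trig_op_Cc[OF \<phi>] \<psi>]])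
         (use ev in \<open>eventually_elim, simp add: mean_pair_trig_adj[OF _ c(1) c(1) \<phi> \<psi>]\<close>)
    from tendsto_unique[OF nb Bl[OF \<phi> trig_op_Cc[OF \<psi>]] this]
    show "B \<phi> (trig_op (trig_adj xs) \<psi>) = B (trig_op xs \<phi>) \<psi>" .
  next
    fix \<phi> \<psi> :: "'a \<Rightarrow> complex" assume \<phi>: "\<phi> \<in> Cc" and \<psi>: "\<psi> \<in> Cc"
    have "\<forall>\<^sub>F i in ?L. cmod (mean_pair \<omega> \<omega> \<phi> \<psi> i) \<le> sqrt (mean_sq \<omega> \<phi> i) * sqrt (mean_sq \<omega> \<psi> i)"
      using ev by eventually_elim (rule mean_pair_bound[OF _ c(1) c(1) \<phi> \<psi>])
    then have "cmod (B \<phi> \<psi>) \<le> sqrt (Q \<phi>) * sqrt (Q \<psi>)"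
      by (rule tendsto_le[OF nb tendsto_mult[OF tendsto_real_sqrt[OF Ql[OF \<phi>]] tendsto_real_sqrt[OF Ql[OF \<psi>]]] tendsto_norm[OF Bl[OF \<phi> \<psi>]]])
    also have "\<dots> \<le> (sqrt 3 * L2norm \<sigma> (fourier_fun h \<phi>)) * (sqrt 3 * L2norm \<sigma> (fourier_fun h \<psi>))"
    proof -
      have sq: "sqrt (Q \<phi>) \<le> sqrt 3 * L2norm \<sigma> (fourier_fun h \<phi>)" if "\<phi> \<in> Cc" for \<phi>
        using real_sqrt_le_mono[OF Q3[OF that]] L2norm_nonneg[of \<sigma> "fourier_fun h \<phi>"] by (simp add: real_sqrt_mult)
      show ?thesis using Q0 \<phi> \<psi> by (intro mult_mono sq) (auto simp: L2norm_nonneg)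
    qed
    also have "\<dots> = 3 * (L2norm \<sigma> (fourier_fun h \<phi>) * L2norm \<sigma> (fourier_fun h \<psi>))" by simp
    finally show "cmod (B \<phi> \<psi>) \<le> 3 * (L2norm \<sigma> (fourier_fun h \<phi>) * L2norm \<sigma> (fourier_fun h \<psi>))" .
  next
    fix \<phi> \<psi> :: "'a \<Rightarrow> complex" assume "\<phi> \<in> Cc" "\<psi> \<in> Cc"
    show "Q (\<lambda>x. \<phi> x + \<psi> x) = Q \<phi> + Q \<psi> + 2 * Re (B \<phi> \<psi>)" unfolding B_def R_def by (simp add: field_simps)
  next
    fix \<phi> :: "'a \<Rightarrow> complex" and z assume \<phi>: "\<phi> \<in> Cc"
    have "(mean_sq \<omega> (\<lambda>x. z * \<phi> x) \<longlongrightarrow> (cmod z)\<^sup>2 * Q \<phi>) ?L"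
      by (rule Lim_transform_eventually[OF tendsto_mult[OF tendsto_const Ql[OF \<phi>]]])
         (use ev in \<open>eventually_elim, simp add: mean_sq_cmult[OF _ c(1) \<phi>]\<close>)
    from tendsto_unique[OF nb Ql[OF Cc_cmult[OF \<phi>]] this]
    show "Q (\<lambda>x. z * \<phi> x) = (cmod z)\<^sup>2 * Q \<phi>" .
  qed (use h \<sigma> parts(1) disc Q0 Q3 in simp_all)
  then obtain \<rho> where \<rho>: "radon_measure \<rho>" "\<And>\<phi>. \<phi> \<in> Cc \<Longrightarrow> integrable \<rho> (\<lambda>\<xi>. (cmod (fourier_fun h \<phi> \<xi>))\<^sup>2)"
    "\<And>\<phi>. \<phi> \<in> Cc \<Longrightarrow> (\<integral>\<xi>. (cmod (fourier_fun h \<phi> \<xi>))\<^sup>2 \<partial>\<rho>) = Q \<phi>" by blast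
  have "conv_cm_fun \<gamma> (conv_fun h \<phi> (tilde_fun \<phi>)) 0 = complex_of_real (Q \<phi>)" if "\<phi> \<in> Cc" for \<phi>
    using autocorrelation_real[OF ac(1) c(1) that] unfolding Q_def conv_cm_fun_def autocorrelation_test_def .
  with \<rho> show ?thesis unfolding has_fourier_transform_def by (intro exI[of _ \<rho>]) simp
qed

text \<open>For the two vanishing components in the discrete case. The restriction of the zero
  functional is shown to be 0 only on \<open>Cc\<close>, so the convolution is evaluated through
  \<open>cm_integral_Cc\<close>.\<close>

lemma zero_autocorrelation: "is_autocorrelation h I le A (\<lambda>\<phi>. 0) (\<lambda>\<phi>. 0)"
proof -
  have z: "complex_measure (\<lambda>\<phi> :: 'a \<Rightarrow> complex. 0)" unfolding complex_measure_def by (auto intro: exI[of _ 0])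
  have "\<forall>\<^sub>F i in net_filter I le. 0 = conv_cm (restrict_cm (\<lambda>\<phi>. 0) (A i)) (tilde_cm (restrict_cm (\<lambda>\<phi>. 0) (A i))) \<phi> / complex_of_real (measure h (A i))"
    if \<phi>: "\<phi> \<in> Cc" for \<phi>
    using eventually_net_filter_mem[OF vH_directed]
  proof eventually_elim
    case (elim i)
    define R where "R = restrict_cm (\<lambda>\<phi>. 0) (A i)"
    have R: "complex_measure R"
      unfolding R_def by (rule complex_measure_restrict_cm[OF vH_open[OF elim] vH_compact[OF elim] z])
    \<comment> \<open>Writing 0 as a sum of three zero measures gives x = x + x + x for the value
      x.\<close>
    have R0: "R \<psi> = 0" if "\<psi> \<in> Cc" for \<psi>
      using restrict_cm_add3[OF vH_open[OF elim] vH_compact[OF elim] z z z z _ that] unfolding R_def by simp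
    have "cm_integral R (\<lambda>s. \<phi> (s + t)) = 0" for t
      using cm_integral_Cc[OF R Cc_plus_arg[OF \<phi>]] R0[OF Cc_plus_arg[OF \<phi>]] by simp
    then have "conv_cm R (tilde_cm R) \<phi> = tilde_cm R (\<lambda>t. 0)"
      unfolding conv_cm_def using cm_integral_Cc[OF complex_measure_tilde[OF R] Cc_zero] by simp
    also have "\<dots> = 0" by (rule complex_measure_zero[OF complex_measure_tilde[OF R]])
    finally show ?case unfolding R_def by simp
  qed
  then show ?thesis
    unfolding is_autocorrelation_def using z by (auto intro: Lim_transform_eventually[OF tendsto_const])
qed

end

section \<open>Null measures, atoms of Haar measure and the equivalence\<close>

lemma radon_null_measure: "radon_measure (null_measure borel :: 'a :: topological_space measure)"
proof -
  have "(INF U\<in>{U. open U \<and> B \<subseteq> U}. 0 :: ennreal) = 0" for B :: "'a set"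
    by (rule cINF_const) (use open_UNIV in blast)
  moreover have "(SUP K\<in>{K. compact K \<and> K \<subseteq> U}. 0 :: ennreal) = 0" for U :: "'a set"
    by (rule cSUP_const) (use compact_empty in blast)
  ultimately show ?thesis unfolding radon_measure_def by simp
qed

lemma zero_fourier_transform:
  fixes h :: "'a :: lca_group measure"
  assumes h: "haar_measure h"
  shows "has_fourier_transform h (\<lambda>\<phi>. 0) (null_measure borel)"
proof -
  have "(\<lambda>\<xi>. (cmod (fourier_fun h \<phi> \<xi>))\<^sup>2) \<in> borel_measurable borel" if "\<phi> \<in> Cc" for \<phi>
    by (intro borel_measurable_continuous_onI continuous_intros fourier_continuous[OF h that])
  then show ?thesis unfolding has_fourier_transform_def conv_cm_fun_def using radon_null_measure by simp
qed

lemma zero_translation_bounded: "translation_bounded (\<lambda>\<phi> :: 'a :: lca_group \<Rightarrow> complex. 0)"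
proof -
  obtain U K where U: "open U" "(0 :: 'a) \<in> U" "U \<subseteq> K" "compact K" using locally_compact by blast
  have "closure U \<subseteq> K" using U(3,4) by (intro closure_minimal compact_imp_closed)
  then have "compact (closure U)" using U(4) compact_Int_closed[of K "closure U"] by (simp add: inf.absorb2)
  moreover have "total_variation (\<lambda>\<phi>. 0) B \<le> 0" for B :: "'a set"
  proof -
    \<comment> \<open>The constant \<open>top\<close> is a lower semicontinuous majorant, whatever B
      is.\<close>
    have "total_variation (\<lambda>\<phi>. 0) B \<le> lsc_integral (\<lambda>\<phi> :: 'a \<Rightarrow> complex. 0) (\<lambda>x. top)"
      unfolding total_variation_def by (rule upper_variation_integral_le) auto
    also have "\<dots> \<le> 0" unfolding lsc_integral_def by (rule SUP_least) simp
    finally show ?thesis .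
  qed
  then have "(SUP t. total_variation (\<lambda>\<phi>. 0) ((+) t ` U)) \<le> 0" by (rule SUP_least)
  moreover have "complex_measure (\<lambda>\<phi> :: 'a \<Rightarrow> complex. 0)" unfolding complex_measure_def by (auto intro: exI[of _ 0])
  ultimately show ?thesis unfolding translation_bounded_def using U(1,2) by (auto intro!: exI[of _ U])
qed

text \<open>By invariance every point has the same positive mass, so an open neighbourhood of finite
  measure, which outer regularity provides, contains only finitely many points. Removing the others,
  a finite and hence closed set, leaves the single point open.\<close>

lemma haar_atom_discrete:
  fixes M :: "'a :: {t2_space, ab_group_add} measure"
  assumes M: "haar_measure M" and atom: "emeasure M {\<xi>0} \<noteq> 0"
  shows "open {\<xi> :: 'a}"
proof -
  have r: "radon_measure M" using M unfolding haar_measure_def by blast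
  have s: "sets M = sets borel" by (rule radon_sets[OF r])
  define c where "c = emeasure M {\<xi>0}"
  have c: "c \<noteq> 0" "c < top" unfolding c_def using atom radon_compact[OF r, of "{\<xi>0}"] by simp_all
  have inv: "\<forall>t. \<forall>B\<in>sets borel. emeasure M ((+) t ` B) = emeasure M B"
    using M unfolding haar_measure_def by blast
  have pt: "emeasure M {\<eta>} = c" for \<eta>
    using inv[rule_format, of "{\<xi>0}" "\<eta> - \<xi>0"] unfolding c_def by simp
  have "{\<xi>} \<in> sets borel" by simp
  from radon_outer[OF r this] have "(INF U\<in>{U. open U \<and> {\<xi>} \<subseteq> U}. emeasure M U) < top" using c(2) pt by simp
  then obtain U where U: "open U" "{\<xi>} \<subseteq> U" "emeasure M U < top" unfolding INF_less_iff by blast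
  obtain c' where c': "c = ennreal c'" "0 < c'" using c by (cases c rule: ennreal_cases) (auto simp: less_le)
  obtain u where u: "emeasure M U = ennreal u" "0 \<le> u" using U(3) by (cases "emeasure M U" rule: ennreal_cases) auto
  have "finite U"
  proof (rule ccontr)
    assume inf: "infinite U"
    obtain n :: nat where n: "u < real n * c'" using reals_Archimedean3[OF c'(2)] by blast
    obtain F where F: "F \<subseteq> U" "finite F" "card F = n" using infinite_arbitrarily_large[OF inf] by blast
    have "ennreal (real n * c') = (\<Sum>x\<in>F. c)" unfolding c'(1) using F(3) c'(2) by (simp add: sum_ennreal del: sum_constant) simp
    also have "\<dots> = emeasure M F" using emeasure_eq_sum_singleton[OF F(2), of M] pt s by simp
    also have "\<dots> \<le> emeasure M U" using F(1) U(1) s by (intro emeasure_mono) auto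
    finally show False unfolding u(1) using n u(2) by (simp add: ennreal_le_iff)
  qed
  then have "open (U - (U - {\<xi>}))" using U(1) by (intro open_Diff finite_imp_closed) auto
  moreover have "U - (U - {\<xi>}) = {\<xi>}" using U(2) by blast
  ultimately show ?thesis by simp
qed

lemma countable_null_sets:
  fixes \<rho> :: "'a :: t1_space measure"
  assumes "sets \<rho> = sets borel" "countable C" "\<And>x. emeasure \<rho> {x} = 0"
  shows "C \<in> null_sets \<rho>"
proof -
  have "(\<Union>x\<in>C. {x}) \<in> null_sets \<rho>"
    using assms by (intro null_sets_UN') (auto simp: null_sets_def)
  then show ?thesis by simp
qed

theorem theorem8p3:
  fixes h :: "'a :: lca_group measure" and hdual :: "'a dual measure"
    and I :: "'i set" and le :: "'i \<Rightarrow> 'i \<Rightarrow> bool" and A :: "'i \<Rightarrow> 'a set"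
    and \<omega> \<gamma> :: "('a \<Rightarrow> complex) \<Rightarrow> complex"
  assumes "haar_measure h"
    and "haar_measure hdual"
    and "van_hove_net h I le A"
    and "translation_bounded \<omega>"
    and "is_autocorrelation h I le A \<omega> \<gamma>"
  shows "(\<exists>\<omega>pp \<omega>ac \<omega>sc. refined_eberlein_decomposition h hdual I le A \<omega> \<omega>pp \<omega>ac \<omega>sc) \<longleftrightarrow>
    (\<exists>\<omega>1 \<omega>2 \<omega>3 \<gamma>1 \<gamma>2 \<gamma>3 \<rho>1 \<rho>2 \<rho>3.
       translation_bounded \<omega>1 \<and> translation_bounded \<omega>2 \<and> translation_bounded \<omega>3 \<and>
       (\<forall>\<phi>\<in>Cc. \<omega> \<phi> = \<omega>1 \<phi> + \<omega>2 \<phi> + \<omega>3 \<phi>) \<and>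
       is_autocorrelation h I le A \<omega>1 \<gamma>1 \<and> has_fourier_transform h \<gamma>1 \<rho>1 \<and>
       is_autocorrelation h I le A \<omega>2 \<gamma>2 \<and> has_fourier_transform h \<gamma>2 \<rho>2 \<and>
       is_autocorrelation h I le A \<omega>3 \<gamma>3 \<and> has_fourier_transform h \<gamma>3 \<rho>3 \<and>
       pure_point \<rho>1 \<and> absolutely_continuous hdual \<rho>2 \<and> singular_continuous hdual \<rho>3)"
proof
  assume "\<exists>\<omega>pp \<omega>ac \<omega>sc. refined_eberlein_decomposition h hdual I le A \<omega> \<omega>pp \<omega>ac \<omega>sc"
  then obtain \<omega>pp \<omega>ac \<omega>sc \<gamma>' \<rho> \<rho>pp \<rho>ac \<rho>sc \<eta>pp \<eta>ac \<eta>sc where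
    t: "translation_bounded \<omega>pp" "translation_bounded \<omega>ac" "translation_bounded \<omega>sc"
      "\<forall>\<phi>\<in>Cc. \<omega> \<phi> = \<omega>pp \<phi> + \<omega>ac \<phi> + \<omega>sc \<phi>" and
    L: "lebesgue_decomposition hdual \<rho> \<rho>pp \<rho>ac \<rho>sc" and
    e: "is_autocorrelation h I le A \<omega>pp \<eta>pp" "has_fourier_transform h \<eta>pp \<rho>pp"
      "is_autocorrelation h I le A \<omega>ac \<eta>ac" "has_fourier_transform h \<eta>ac \<rho>ac"
      "is_autocorrelation h I le A \<omega>sc \<eta>sc" "has_fourier_transform h \<eta>sc \<rho>sc"
    unfolding refined_eberlein_decomposition_def by (elim exE conjE) (rule that)
  have "pure_point \<rho>pp" "absolutely_continuous hdual \<rho>ac" "singular_continuous hdual \<rho>sc"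
    using L unfolding lebesgue_decomposition_def by blast+
  with t e show "\<exists>\<omega>1 \<omega>2 \<omega>3 \<gamma>1 \<gamma>2 \<gamma>3 \<rho>1 \<rho>2 \<rho>3.
       translation_bounded \<omega>1 \<and> translation_bounded \<omega>2 \<and> translation_bounded \<omega>3 \<and>
       (\<forall>\<phi>\<in>Cc. \<omega> \<phi> = \<omega>1 \<phi> + \<omega>2 \<phi> + \<omega>3 \<phi>) \<and>
       is_autocorrelation h I le A \<omega>1 \<gamma>1 \<and> has_fourier_transform h \<gamma>1 \<rho>1 \<and>
       is_autocorrelation h I le A \<omega>2 \<gamma>2 \<and> has_fourier_transform h \<gamma>2 \<rho>2 \<and>
       is_autocorrelation h I le A \<omega>3 \<gamma>3 \<and> has_fourier_transform h \<gamma>3 \<rho>3 \<and>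
       pure_point \<rho>1 \<and> absolutely_continuous hdual \<rho>2 \<and> singular_continuous hdual \<rho>3"
    by (intro exI conjI)
next
  assume "\<exists>\<omega>1 \<omega>2 \<omega>3 \<gamma>1 \<gamma>2 \<gamma>3 \<rho>1 \<rho>2 \<rho>3.
       translation_bounded \<omega>1 \<and> translation_bounded \<omega>2 \<and> translation_bounded \<omega>3 \<and>
       (\<forall>\<phi>\<in>Cc. \<omega> \<phi> = \<omega>1 \<phi> + \<omega>2 \<phi> + \<omega>3 \<phi>) \<and>
       is_autocorrelation h I le A \<omega>1 \<gamma>1 \<and> has_fourier_transform h \<gamma>1 \<rho>1 \<and>
       is_autocorrelation h I le A \<omega>2 \<gamma>2 \<and> has_fourier_transform h \<gamma>2 \<rho>2 \<and>
       is_autocorrelation h I le A \<omega>3 \<gamma>3 \<and> has_fourier_transform h \<gamma>3 \<rho>3 \<and>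
       pure_point \<rho>1 \<and> absolutely_continuous hdual \<rho>2 \<and> singular_continuous hdual \<rho>3"
  then obtain \<omega>1 \<omega>2 \<omega>3 \<gamma>1 \<gamma>2 \<gamma>3 \<rho>1 \<rho>2 \<rho>3 where
    t: "translation_bounded \<omega>1" "translation_bounded \<omega>2" "translation_bounded \<omega>3" and
    sum: "\<forall>\<phi>\<in>Cc. \<omega> \<phi> = \<omega>1 \<phi> + \<omega>2 \<phi> + \<omega>3 \<phi>" and
    ac: "is_autocorrelation h I le A \<omega>1 \<gamma>1" and FT1: "has_fourier_transform h \<gamma>1 \<rho>1" and
    ac2: "is_autocorrelation h I le A \<omega>2 \<gamma>2" and FT2: "has_fourier_transform h \<gamma>2 \<rho>2" and
    ac3: "is_autocorrelation h I le A \<omega>3 \<gamma>3" and FT3: "has_fourier_transform h \<gamma>3 \<rho>3" and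
    pp: "pure_point \<rho>1" and abs: "absolutely_continuous hdual \<rho>2" and sc: "singular_continuous hdual \<rho>3"
    by (elim exE conjE) (rule that)
  have cm: "complex_measure \<omega>" "complex_measure \<omega>1" "complex_measure \<omega>2" "complex_measure \<omega>3"
    using t assms(4) unfolding translation_bounded_def by blast+
  have sum': "\<omega> \<phi> = \<omega>1 \<phi> + \<omega>2 \<phi> + \<omega>3 \<phi>" if "\<phi> \<in> Cc" for \<phi> using sum that by blast
  have r: "radon_measure \<rho>1" "radon_measure \<rho>2" "radon_measure \<rho>3"
    using FT1 FT2 FT3 unfolding has_fourier_transform_def by blast+
  have hd: "sets hdual = sets borel"
    using radon_sets assms(2) unfolding haar_measure_def by blast
  show "\<exists>\<omega>pp \<omega>ac \<omega>sc. refined_eberlein_decomposition h hdual I le A \<omega> \<omega>pp \<omega>ac \<omega>sc"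
  proof (cases "\<forall>\<xi>. emeasure hdual {\<xi>} = 0")
    case True
    have null: "S \<in> null_sets \<rho>2" if "S \<in> null_sets hdual" for S
      using abs that unfolding absolutely_continuous_def by blast
    \<comment> \<open>\<open>lebesgue_decomposition\<close> also asks that the absolutely continuous
      part has no atoms; here this comes from Haar measure having none.\<close>
    have cont2: "emeasure \<rho>2 {\<xi>} = 0" for \<xi>
    proof -
      have "{\<xi>} \<in> null_sets hdual" using True hd by (simp add: null_sets_def)
      then show ?thesis using null by blast
    qed
    have cont3: "emeasure \<rho>3 {\<xi>} = 0" for \<xi>
      using sc unfolding singular_continuous_def continuous_measure_def by blast
    \<comment> \<open>The countable set that carries \<rho>1 on K is null for every measure without
      atoms, in particular for \<rho>2 and \<rho>3.\<close>
    have atoms: "\<exists>S\<in>sets borel. emeasure \<rho>1 (K - S) = 0 \<and> emeasure \<rho>' (K \<inter> S) = 0"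
      if K: "compact K" and \<rho>': "sets \<rho>' = sets borel" "\<And>\<xi>. emeasure \<rho>' {\<xi>} = 0" for K \<rho>'
    proof -
      obtain C where C: "countable C" "C \<subseteq> K" "emeasure \<rho>1 (K - C) = 0" using pp K unfolding pure_point_def by blast
      have "C \<in> null_sets \<rho>'" by (rule countable_null_sets[OF \<rho>'(1) C(1) \<rho>'(2)])
      then have "C \<in> sets borel" "emeasure \<rho>' (K \<inter> C) = 0"
        using \<rho>'(1) C(2) by (auto simp: null_sets_def inf.absorb2)
      with C(3) show ?thesis by blast
    qed
    \<comment> \<open>S carries \<rho>3 on K and is Haar-null there, hence null for \<rho>2; so its
      complement carries \<rho>2 on K and is null for \<rho>3 there.\<close>
    have sing23: "\<exists>S\<in>sets borel. emeasure \<rho>2 (K - S) = 0 \<and> emeasure \<rho>3 (K \<inter> S) = 0" if K: "compact K" for K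
    proof -
      obtain S where S: "S \<in> sets borel" "emeasure hdual (S \<inter> K) = 0" "emeasure \<rho>3 (K - S) = 0"
        using sc K unfolding singular_continuous_def singular_measure_def by blast
      have "K \<in> sets borel" using K by (intro borel_closed compact_imp_closed)
      then have "S \<inter> K \<in> null_sets hdual" using S(1,2) hd by (simp add: null_sets_def sets.Int)
      then have "emeasure \<rho>2 (S \<inter> K) = 0" using null by blast
      then show ?thesis
        using S(3) borel_comp[OF S(1)] by (intro bexI[of _ "- S"]) (simp_all add: Diff_eq Int_commute)
    qed
    define \<rho> where "\<rho> = sum_measure (sum_measure \<rho>1 \<rho>2) \<rho>3"
    have FT: "has_fourier_transform h \<gamma> \<rho>" unfolding \<rho>_def
      by (rule fourier_transform_sum[OF assms(1,3) cm sum' assms(5) ac ac2 ac3 FT1 FT2 FT3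
            atoms[OF _ radon_sets[OF r(2)] cont2] atoms[OF _ radon_sets[OF r(3)] cont3] sing23])
    have s: "sets \<rho>2 = sets \<rho>1" "sets \<rho>3 = sets (sum_measure \<rho>1 \<rho>2)" using r by (simp_all add: radon_sets)
    have "emeasure \<rho> S = emeasure \<rho>1 S + emeasure \<rho>2 S + emeasure \<rho>3 S" if "S \<in> sets borel" for S
      unfolding \<rho>_def using that r(1) emeasure_sum_measure[OF s(2), of S] emeasure_sum_measure[OF s(1), of S]
      by (simp add: radon_sets)
    then have L: "lebesgue_decomposition hdual \<rho> \<rho>1 \<rho>2 \<rho>3"
      unfolding lebesgue_decomposition_def continuous_measure_def using r pp abs sc cont2 by blast
    show ?thesis unfolding refined_eberlein_decomposition_def
      by (intro exI conjI) (fact t sum assms(5) FT L ac FT1 ac2 FT2 ac3 FT3)+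
  next
    case False
    then obtain \<xi>0 where \<xi>0: "emeasure hdual {\<xi>0} \<noteq> 0" by blast
    have disc: "open {\<xi>}" for \<xi> :: "'a dual" by (rule haar_atom_discrete[OF assms(2) \<xi>0])
    obtain \<rho> where \<rho>: "has_fourier_transform h \<gamma> \<rho>"
      using discrete_fourier_transform[OF assms(1,3) cm sum' assms(5) ac ac2 ac3 FT1 FT2 FT3 disc] by blast
    have r\<rho>: "radon_measure \<rho>" using \<rho> unfolding has_fourier_transform_def by blast
    \<comment> \<open>Compact sets are finite, so K itself is the countable set.\<close>
    have "pure_point \<rho>" unfolding pure_point_def
    proof (intro allI impI)
      fix K :: "'a dual set" assume "compact K"
      then have "finite K" by (rule discrete_compact_finite[OF disc])
      then show "\<exists>C. countable C \<and> C \<subseteq> K \<and> emeasure \<rho> (K - C) = 0"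
        by (intro exI[of _ K]) (simp add: countable_finite)
    qed
    \<comment> \<open>The null measure is absolutely continuous, continuous and singular at once, so
      it fills both remaining parts.\<close>
    then have L: "lebesgue_decomposition hdual \<rho> \<rho> (null_measure borel) (null_measure borel)"
      unfolding lebesgue_decomposition_def continuous_measure_def singular_continuous_def singular_measure_def absolutely_continuous_def
      using r\<rho> radon_null_measure hd by (auto simp: null_sets_def intro: bexI[of _ "{}"])
    have z: "\<forall>\<phi>\<in>Cc. \<omega> \<phi> = \<omega> \<phi> + 0 + 0" by simp
    show ?thesis unfolding refined_eberlein_decomposition_def
      by (rule exI[of _ \<omega>], rule exI[of _ "\<lambda>\<phi>. 0"], rule exI[of _ "\<lambda>\<phi>. 0"], intro exI conjI)
        (fact assms(4) zero_translation_bounded z assms(5) \<rho> L zero_autocorrelation[OF assms(1,3)] zero_fourier_transform[OF assms(1)])+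
  qed
qed

end
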